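(* Let $p$ be a prime, $\chi$ a non-trivial multiplicative (Dirichlet) character modulo $p$, $a,b$ integers with $\gcd(ab,p)=1$, $r\geqslant 2$ an integer, and $K,M,N>1$ real numbers with $p>\max\{K,M,N\}$. Let $\boldsymbol\alpha=(\alpha_m)_{1\leqslant m\leqslant M}$ and $\boldsymbol\beta=(\beta_{k,n})_{1\leqslant k\leqslant K,\,1\leqslant n\leqslant N}$ be arbitrary complex weights (indices are integers), with $\|\boldsymbol\alpha\|_\infty=\max_m|\alpha_m|$ and $\|\boldsymbol\beta\|_2=(\sum_{k,n}|\beta_{k,n}|^2)^{1/2}$. Define $$\mathfrak{T}=\sum_{1\leqslant k\leqslant K}\ \sum_{1\leqslant m\leqslant M}\ \sum_{1\leqslant n\leqslant N}\alpha_m\beta_{k,n}\chi(ak+bmn),\qquad \mathscr{L}_1=|a|K+|b|MN.$$ If $N>4p^{\frac{1}{r}}$, then $$|\mathfrak{T}|\leqslant \|\boldsymbol\alpha\|_\infty\|\boldsymbol\beta\|_2\,M(NK)^{\frac12}\,\Delta_2\,p^{o(1)},$$ where $$\Delta_2=\Big(1+\frac{K}{M^{2}}\Big)^{\frac{1}{4r}}\Big(1+\mathscr{L}_1MNp^{-1-\frac{1}{r}}\Big)^{\frac{1}{2r}}\Big(\frac{p^{1+\frac{1}{r}}}{K(MN)^2}\Big)^{\frac{1}{4r}}+M^{-\frac12}.$$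
   Context: Here $p^{o(1)}$ means: for every $\varepsilon>0$ there is $p_0$ depending only on $\varepsilon$ and $r$ such that for all primes $p\geqslant p_0$ the bound holds with $p^{o(1)}$ replaced by $p^{\varepsilon}$, uniformly over $\chi$, $a$, $b$, $K$, $M$, $N$ and the weights. *)

theory Defs
  imports Complex_Main "HOL-Number_Theory.Number_Theory"
begin

text \<open>
  Dirichlet characters are functions on the integers, since the argument a k + b m n
  may be negative. The value at 1 is forced to be 1 by the multiplicativity and its
  non-vanishing at 1.
\<close>
definition dirichlet_character :: "nat \<Rightarrow> (int \<Rightarrow> complex) \<Rightarrow> bool" where
  "dirichlet_character q chi \<longleftrightarrow>
     (\<forall>x y. [x = y] (mod int q) \<longrightarrow> chi x = chi y) \<and>
     (\<forall>x y. chi (x * y) = chi x * chi y) \<and>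
     (\<forall>x. chi x = 0 \<longleftrightarrow> \<not> coprime x (int q))"

definition principal_character :: "nat \<Rightarrow> int \<Rightarrow> complex" where
  "principal_character q x = (if coprime x (int q) then 1 else 0)"

definition nontrivial_character :: "nat \<Rightarrow> (int \<Rightarrow> complex) \<Rightarrow> bool" where
  "nontrivial_character q chi \<longleftrightarrow>
     dirichlet_character q chi \<and> chi \<noteq> principal_character q"

definition pos_upto :: "real \<Rightarrow> nat set" where
  "pos_upto X = {n. 1 \<le> n \<and> real n \<le> X}"

lemma pos_upto_altdef: "pos_upto X = {1..nat \<lfloor>X\<rfloor>}"
  unfolding pos_upto_def by (auto simp: le_nat_floor) linarith

lemma finite_pos_upto [simp, intro]: "finite (pos_upto X)"
  by (simp add: pos_upto_altdef)

lemma pos_upto_nonempty: "1 < X \<Longrightarrow> pos_upto X \<noteq> {}"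
  unfolding pos_upto_def by (auto intro!: exI[of _ 1])

definition sup_norm :: "real \<Rightarrow> (nat \<Rightarrow> complex) \<Rightarrow> real" where
  "sup_norm M \<alpha> = Max ((\<lambda>m. norm (\<alpha> m)) ` pos_upto M)"

definition l2_norm :: "real \<Rightarrow> real \<Rightarrow> (nat \<Rightarrow> nat \<Rightarrow> complex) \<Rightarrow> real" where
  "l2_norm K N \<beta> = sqrt (\<Sum>k\<in>pos_upto K. \<Sum>n\<in>pos_upto N. (norm (\<beta> k n))\<^sup>2)"

definition trilinear_sum ::
  "(int \<Rightarrow> complex) \<Rightarrow> int \<Rightarrow> int \<Rightarrow> real \<Rightarrow> real \<Rightarrow> real \<Rightarrow>
   (nat \<Rightarrow> complex) \<Rightarrow> (nat \<Rightarrow> nat \<Rightarrow> complex) \<Rightarrow> complex" where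
  "trilinear_sum chi a b K M N \<alpha> \<beta> =
     (\<Sum>k\<in>pos_upto K. \<Sum>m\<in>pos_upto M. \<Sum>n\<in>pos_upto N.
        \<alpha> m * \<beta> k n * chi (a * int k + b * int m * int n))"

definition L1 :: "int \<Rightarrow> int \<Rightarrow> real \<Rightarrow> real \<Rightarrow> real \<Rightarrow> real" where
  "L1 a b K M N = real_of_int \<bar>a\<bar> * K + real_of_int \<bar>b\<bar> * M * N"

definition Delta2 :: "nat \<Rightarrow> nat \<Rightarrow> int \<Rightarrow> int \<Rightarrow> real \<Rightarrow> real \<Rightarrow> real \<Rightarrow> real" where
  "Delta2 p r a b K M N =
     (1 + K / M\<^sup>2) powr (1 / (4 * real r)) *
     (1 + L1 a b K M N * M * N * real p powr (- 1 - 1 / real r)) powr (1 / (2 * real r)) *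
     (real p powr (1 + 1 / real r) / (K * (M * N)\<^sup>2)) powr (1 / (4 * real r)) +
     M powr (- 1 / 2)"

end

theory Submission
  imports "HOL-Analysis.FPS_Convergence" "HOL-Computational_Algebra.Fundamental_Theorem_Algebra"
    "HOL-Algebra.Algebraic_Closure_Type"
    "HOL-Real_Asymp.Real_Asymp" "Berlekamp_Zassenhaus.Finite_Field" Defs
begin

text \<open>
  By Cauchy--Schwarz over \<open>(k, n)\<close>, the square of the sum is at most \<open>\<parallel>\<beta>\<parallel>\<^sup>2 \<parallel>\<alpha>\<parallel>\<^sup>2\<close> times the
  diagonal \<open>K M N\<close> plus the sums \<open>\<bar>\<Sum>\<^sub>k\<^sub>,\<^sub>n \<chi>(a k + b m\<^sub>1 n) \<chi>(a k + b m\<^sub>2 n)\<^sup>*\<bar>\<close> over \<open>m\<^sub>1 \<noteq> m\<^sub>2\<close>. Shift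
  \<open>n\<close> by \<open>u v\<close> with \<open>u \<le> U\<close>, \<open>v < V\<close>, where \<open>V\<close> is about \<open>p\<close> to the \<open>1/r\<close> and \<open>U V \<le> N\<close>. The
  inner sum over \<open>v\<close> is then a sum of \<open>\<chi>(x + v) \<chi>(y + v)\<^sup>*\<close> over an interval, where
  \<open>x = (a k + b m\<^sub>1 n) / (b m\<^sub>1 u)\<close> and \<open>y = (a k + b m\<^sub>2 n) / (b m\<^sub>2 u)\<close> modulo \<open>p\<close>. By Hoelder's
  inequality it remains to bound two quantities.

  The first is the number of pairs of tuples \<open>(k, n, u, m\<^sub>1, m\<^sub>2)\<close> with the same \<open>(x, y)\<close>. Lifting the
  two congruences to equations in integers, half of the variables are fixed and the others are
  divisors of fixed nonzero numbers, so that the divisor bound applies.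

  The second is the \<open>2 r\<close>-th moment over all residues \<open>x\<close>, \<open>y\<close> of the maximal interval sum. Intervals
  are split into dyadic blocks; the moment of a block expands into squares of complete sums of
  products of \<open>2 r\<close> shifted characters, to which the Weil bound applies unless every shift occurs
  at least twice.

  The Weil bound is proved with the L-function of the character: it is a polynomial since \<open>\<chi>\<close> is
  nontrivial, and its logarithmic derivative has as coefficients the character sums over all
  extension fields. These are \<open>O\<close> of the square root of the field size by the method of Stepanov and
  Bombieri, which places the zeros of the L-function and hence bounds its linear coefficient.
\<close>

hide_const (open) Polynomials.degree Polynomials.lead_coeff Module.smult Divisibility.prime
  Divisibility.irreducible Coset.order up_ring.coeff up_ring.monom

section \<open>Polynomials over a finite field\<close>


text \<open>Averaging over both residues \<open>x\<close> and \<open>y\<close> makes the expanded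
  moment factor into two conjugate complete sums, so square-root cancellation is gained twice: a
  block of length V has a moment of order V^r p^2 + V^(2r) p, and the two terms balance at V =
  p^(1/r). The condition on \<open>N\<close> then leaves room for the shifts \<open>u\<close>. The
  range of \<open>v\<close> is cut by 1 <= n + u v <= N and so varies with the tuple; hence the
  maximal interval sum, which costs powers of log p. The integers \<open>a\<close> and
  \<open>b\<close> are arbitrary, but the divisor function is p^o(1) only at arguments polynomial in
  \<open>p\<close>. If |a| K + |b| M N is at least p^4, then \<open>Delta2\<close> is at least 1 and
  the trivial bound suffices. For the Weil bound only the radius of convergence of the logarithmic
  derivative matters, so the error in the point counts is needed only up to a constant. Stepanov's
  method bounds each count from above; lower bounds come from the known total.\<close>

lemma finite_polys_degree_le: "finite {f :: 'a :: {finite, zero} poly. degree f \<le> n}"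
proof (rule finite_subset)
  show "{f :: 'a poly. degree f \<le> n} \<subseteq> Poly ` {xs. set xs \<subseteq> UNIV \<and> length xs \<le> Suc n}"
  proof
    fix f :: "'a poly" assume "f \<in> {f. degree f \<le> n}"
    hence "length (coeffs f) \<le> Suc n" by (cases "f = 0") (auto simp: length_coeffs)
    thus "f \<in> Poly ` {xs. set xs \<subseteq> UNIV \<and> length xs \<le> Suc n}"
      by (intro image_eqI[of _ _ "coeffs f"]) auto
  qed
qed (intro finite_imageI finite_lists_length_le finite)

lemma card_polys_degree_le:
  "card {f :: 'a :: {finite, comm_monoid_add} poly. degree f \<le> n} = CARD('a) ^ Suc n"
proof -
  let ?X = "{f :: 'a poly. degree f \<le> n}" and ?Y = "{..n} \<rightarrow>\<^sub>E (UNIV :: 'a set)"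
  have "bij_betw (\<lambda>f. restrict (coeff f) {..n}) ?X ?Y"
  proof (rule bij_betwI)
    show "(\<lambda>c. \<Sum>i\<le>n. monom (c i) i) \<in> ?Y \<rightarrow> ?X"
      by (auto intro!: degree_sum_le order.trans[OF degree_monom_le])
  next
    fix f assume "f \<in> ?X"
    thus "(\<Sum>i\<le>n. monom (restrict (coeff f) {..n} i) i) = f"
      by (intro poly_eqI) (auto simp: coeff_sum coeff_eq_0 if_distrib cong: if_cong)
  next
    fix c assume "c \<in> ?Y"
    thus "restrict (coeff (\<Sum>i\<le>n. monom (c i) i)) {..n} = c"
      by (auto simp: coeff_sum PiE_def extensional_def restrict_def fun_eq_iff)
  qed auto
  thus ?thesis by (simp add: bij_betw_same_card card_PiE)
qed

text \<open>Pigeonhole in place of linear algebra: there are more coefficient vectors on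
  \<open>T\<close> than polynomials of degree at most \<open>D\<close>, so two vectors give the same
  combination, and their difference is the relation.\<close>

lemma poly_linear_dependence:
  fixes B :: "'t \<Rightarrow> 'a :: {field, finite} poly"
  assumes fin: "finite T" and deg: "\<And>t. t \<in> T \<Longrightarrow> degree (B t) \<le> D" and card: "card T > Suc D"
  obtains c where "\<exists>t\<in>T. c t \<noteq> 0" "(\<Sum>t\<in>T. smult (c t) (B t)) = 0"
proof -
  let ?Phi = "\<lambda>c. \<Sum>t\<in>T. smult (c t) (B t)" and ?X = "T \<rightarrow>\<^sub>E (UNIV :: 'a set)"
  let ?Y = "{f :: 'a poly. degree f \<le> D}"
  have "card (?Phi ` ?X) \<le> card ?Y"
    by (rule card_mono[OF finite_polys_degree_le])
       (auto intro!: degree_sum_le[OF fin] order.trans[OF degree_smult_le] deg)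
  also have "\<dots> = CARD('a) ^ Suc D" by (rule card_polys_degree_le)
  also have "\<dots> < CARD('a) ^ card T"
  proof (rule power_strict_increasing[OF card])
    have "card {0, 1 :: 'a} \<le> CARD('a)" by (rule card_mono) auto
    thus "1 < CARD('a)" by simp
  qed
  also have "\<dots> = card ?X" using fin by (simp add: card_PiE)
  finally have "\<not> inj_on ?Phi ?X" using card_image by fastforce
  then obtain c d where cd: "c \<in> ?X" "d \<in> ?X" "c \<noteq> d" "?Phi c = ?Phi d"
    by (auto simp: inj_on_def)
  from cd(1-3) have "\<exists>t\<in>T. c t - d t \<noteq> 0"
    by (metis PiE_ext right_minus_eq)
  moreover have "?Phi (\<lambda>t. c t - d t) = 0"
    using cd(4) by (simp add: smult_diff_left sum_subtractf)
  ultimately show ?thesis by (intro that)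
qed

text \<open>Among the terms with nonzero coefficient, the one with the smallest exponent of
  \<open>l\<close> cannot cancel: all others contain one more factor \<open>l\<close>, while its
  cofactor does not vanish at \<open>a\<close>.\<close>

lemma linear_independent_of_distinct_orders:
  fixes u :: "'t \<Rightarrow> 'a :: idom poly"
  assumes fin: "finite T" and inj: "inj_on w T"
    and l: "poly l a = 0" "l \<noteq> 0" and u: "\<And>t. t \<in> T \<Longrightarrow> poly (u t) a \<noteq> 0"
    and sum0: "(\<Sum>t\<in>T. smult (c t) (l ^ w t * u t)) = 0" and t: "t \<in> T"
  shows "c t = 0"
proof (rule ccontr)
  assume "c t \<noteq> 0"
  define S where "S = {t \<in> T. c t \<noteq> 0}"
  have S: "finite S" "S \<noteq> {}" using fin t \<open>c t \<noteq> 0\<close> by (auto simp: S_def)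
  obtain s where s: "s \<in> S" "\<And>t. t \<in> S \<Longrightarrow> w s \<le> w t"
    using S by (metis arg_min_if_finite(1) arg_min_least)
  have "(\<Sum>t\<in>T. smult (c t) (l ^ w t * u t)) = (\<Sum>t\<in>S. smult (c t) (l ^ w t * u t))"
    by (rule sum.mono_neutral_right) (auto simp: S_def fin)
  also have "\<dots> = smult (c s) (l ^ w s * u s) + (\<Sum>t\<in>S - {s}. smult (c t) (l ^ w t * u t))"
    by (rule sum.remove[OF S(1) s(1)])
  finally have *: "smult (c s) (l ^ w s * u s) = - (\<Sum>t\<in>S - {s}. smult (c t) (l ^ w t * u t))"
    using sum0 by (simp add: eq_neg_iff_add_eq_0)
  have "l ^ Suc (w s) dvd (\<Sum>t\<in>S - {s}. smult (c t) (l ^ w t * u t))"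
  proof (rule dvd_sum)
    fix t assume t: "t \<in> S - {s}"
    have "w t \<noteq> w s" using t s(1) inj by (auto simp: S_def inj_on_def)
    hence "Suc (w s) \<le> w t" using s(2)[of t] t by auto
    thus "l ^ Suc (w s) dvd smult (c t) (l ^ w t * u t)"
      by (meson dvd_mult2 dvd_smult le_imp_power_dvd)
  qed
  hence "l ^ Suc (w s) dvd l ^ w s * smult (c s) (u s)"
    by (subst mult_smult_right, subst *) (simp only: dvd_minus_iff)
  hence "l ^ w s * l dvd l ^ w s * smult (c s) (u s)" by (simp only: power_Suc2)
  hence "l dvd smult (c s) (u s)" using l(2) by (subst (asm) dvd_mult_cancel_left) auto
  hence "poly (smult (c s) (u s)) a = 0" using l(1) by (metis dvdE mult_zero_left poly_mult)
  thus False using s(1) u[of s] by (auto simp: S_def)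
qed

section \<open>Power series and zeros of polynomials\<close>

text \<open>\<open>P\<close> is the product of the factors 1 - T / z over its roots z, so its linear
  coefficient is minus the sum of the 1 / z, each of norm at most \<open>R\<close>. The induction
  splits off one root.\<close>

lemma coeff_1_le_of_roots_large:
  fixes P :: "complex poly"
  assumes "poly P 0 = 1" and "\<And>z. poly P z = 0 \<Longrightarrow> 1 \<le> R * norm z"
  shows "norm (coeff P 1) \<le> real (degree P) * R"
  using assms
proof (induction "degree P" arbitrary: P)
  case 0
  thus ?case by (auto simp: coeff_eq_0)
next
  case (Suc n)
  have "\<not> constant (poly P)"
    using Suc.hyps(2) by (simp add: constant_degree)
  then obtain z where z: "poly P z = 0"
    using fundamental_theorem_of_algebra by blast
  then obtain Q where Q: "P = [:-z, 1:] * Q"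
    by (metis dvdE poly_eq_0_iff_dvd)
  have z0: "z \<noteq> 0" using z Suc.prems(1) by auto
  define S where "S = smult (-z) Q"
  have P: "P = [:1, -1/z:] * S"
    unfolding Q S_def using z0 by (simp add: smult_add_right)
  have "S \<noteq> 0" using P Suc.hyps(2) by auto
  have deg: "n = degree S"
    using Suc.hyps(2) \<open>S \<noteq> 0\<close> z0 unfolding P by (subst (asm) degree_mult_eq) auto
  have S1: "poly S 0 = 1" using Suc.prems(1) unfolding P by simp
  have IH: "norm (coeff S 1) \<le> real (degree S) * R"
    by (rule Suc.hyps(1)[OF deg S1]) (use Suc.prems(2) in \<open>auto simp: P\<close>)
  have "coeff P 1 = coeff S 1 - 1 / z"
    unfolding P using S1 by (simp add: poly_0_coeff_0)
  hence "norm (coeff P 1) \<le> norm (coeff S 1) + norm (1 / z)"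
    by (metis norm_triangle_ineq4)
  also have "norm (1 / z) \<le> R"
    using Suc.prems(2)[OF z] z0 by (simp add: norm_divide field_simps)
  finally show ?case
    using IH Suc.hyps(2) deg by (auto simp: algebra_simps simp flip: Suc.hyps(2))
qed

text \<open>At a nonzero root z of order k > 0 the function w B'(w) / B(w) has a simple pole with
  residue k z, while \<open>L\<close> is analytic inside its disc of convergence.\<close>

lemma poly_log_deriv_no_roots:
  fixes B :: "complex poly" and L :: "complex fps"
  assumes ode: "fps_X * fps_deriv (fps_of_poly B) = L * fps_of_poly B"
    and B: "B \<noteq> 0" and z: "z \<noteq> 0" "ereal (norm z) < fps_conv_radius L"
  shows "poly B z \<noteq> 0"
proof
  assume root: "poly B z = 0"
  define k where "k = order z B"
  have k: "k > 0" using root B by (simp add: k_def order_root)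
  obtain D where D: "B = [:-z, 1:] ^ k * D" and D0: "poly D z \<noteq> 0"
    using order_decomp[OF B, of z] by (auto simp: k_def poly_eq_0_iff_dvd)
  obtain j where j: "k = Suc j" using k by (cases k) auto
  let ?r = "fps_conv_radius L"
  define g where "g = eval_fps L"
  have ev: "w * poly (pderiv B) w = g w * poly B w" if "ereal (norm w) < ?r" for w
  proof -
    have "eval_fps (fps_X * fps_deriv (fps_of_poly B)) w = w * poly (pderiv B) w"
      by (subst eval_fps_mult) (auto simp flip: fps_of_poly_pderiv)
    moreover have "eval_fps (L * fps_of_poly B) w = g w * poly B w"
      unfolding g_def using that by (subst eval_fps_mult) auto
    ultimately show ?thesis using ode by simp
  qed
  \<comment> \<open>\<open>F\<close> is the difference of the two sides of the equation, divided by
    (w - z)^(k - 1). It vanishes near \<open>z\<close> off \<open>z\<close>, hence at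
    \<open>z\<close> by continuity, where its value is k z D(z).\<close>
  define F where "F = (\<lambda>w. w * (of_nat k * poly D w + (w - z) * poly (pderiv D) w) - g w * (w - z) * poly D w)"
  have F0: "F w = 0" if "w \<noteq> z" "ereal (norm w) < ?r" for w
  proof -
    have "pderiv ([:-z, 1:] ^ Suc j) = smult (of_nat k) ([:-z, 1:] ^ j)"
      unfolding j by (subst pderiv_power_Suc) (simp add: pderiv_pCons)
    hence "pderiv B = [:-z, 1:] ^ Suc j * pderiv D + D * smult (of_nat k) ([:-z, 1:] ^ j)"
      unfolding D j pderiv_mult by simp
    moreover have l: "poly [:-z, 1:] w = w - z" by simp
    ultimately have "poly (pderiv B) w = (w - z) ^ Suc j * poly (pderiv D) w + poly D w * (of_nat k * (w - z) ^ j)"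
      by (simp only: poly_add poly_mult poly_power poly_smult l)
    moreover have "poly B w = (w - z) ^ Suc j * poly D w"
      by (simp only: D j poly_mult poly_power l)
    moreover have "y ^ j * (w * (of_nat k * d + y * d') - x * y * d)
        = w * (y ^ Suc j * d' + d * (of_nat k * y ^ j)) - x * (y ^ Suc j * d)" for x y d d'
      by (simp add: algebra_simps)
    ultimately have "(w - z) ^ j * F w = w * poly (pderiv B) w - g w * poly B w"
      by (simp only: F_def)
    thus ?thesis using ev[OF that(2)] that(1) by simp
  qed
  have "isCont g z"
    unfolding g_def by (intro continuous_eval_fps) (use z in auto)
  hence "isCont F z" unfolding F_def by (intro continuous_intros)
  hence lim: "(F \<longlongrightarrow> F z) (at z)" by (simp add: isCont_def)
  have "eventually (\<lambda>w. w \<in> eball 0 ?r - {z}) (at z)"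
    by (intro eventually_at_in_open) (use z in auto)
  hence "eventually (\<lambda>w. F w = 0) (at z)"
    by eventually_elim (auto intro!: F0)
  hence "(F \<longlongrightarrow> 0) (at z)"
    by (simp add: tendsto_eventually)
  with lim have "F z = 0" using tendsto_unique[OF _ lim] by auto
  thus False using k D0 z by (simp add: F_def)
qed

text \<open>
  Since only the \<open>\<Lambda>\<close> of even index are controlled, the proof works with \<open>A(T) A(-T)\<close>, whose
  logarithmic derivative involves no others.
\<close>
theorem newton_recursion_bound:
  fixes A \<Lambda> :: "nat \<Rightarrow> complex"
  assumes A0: "A 0 = 1" and Am: "\<And>n. n \<ge> m \<Longrightarrow> A n = 0" 
    and rec: "\<And>n. of_nat n * A n = (\<Sum>k=1..n. \<Lambda> k * A (n - k))"
    and R: "R > 0" and bound: "\<And>l. l \<ge> 1 \<Longrightarrow> norm (\<Lambda> (2 * l)) \<le> C * R ^ (2 * l)"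
  shows "norm (A 1) \<le> real (m - 1) * R"
proof -
  define P where "P = Poly (map A [0..<m])"
  have coeffP: "coeff P n = A n" for n
    unfolding P_def using Am[of n] by (simp add: nth_default_def)
  have degP: "degree P \<le> m - 1"
    by (rule degree_le) (use Am coeffP in auto)
  have P0: "poly P 0 = 1" using A0 coeffP by (simp add: poly_0_coeff_0)
  \<comment> \<open>\<open>\<Lambda> 0\<close> does not occur in the recursion; the constant
    coefficient is 0 because \<open>fps_X * fps_deriv\<close> produces none. The recursion then says
    that \<open>L\<close> is T P'(T) / P(T).\<close>
  define L where "L = Abs_fps (\<lambda>n. if n = 0 then 0 else \<Lambda> n)"
  \<comment> \<open>\<open>L'\<close> is L(-T). The operator T d/dT commutes with T -> -T, so
    \<open>L'\<close> belongs to P(-T) as \<open>L\<close> belongs to P(T).\<close>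
  define L' where "L' = Abs_fps (\<lambda>n. (-1) ^ n * fps_nth L n)"
  define P' where "P' = pcompose P [:0, -1:]"
  have coeffP': "coeff P' n = (-1) ^ n * coeff P n" for n
    unfolding P'_def by (simp add: coeff_pcompose_linear)
  have ode1: "of_nat n * coeff P n = (\<Sum>k=0..n. fps_nth L k * coeff P (n - k))" for n
    using rec[of n] by (simp add: coeffP L_def sum.atLeast_Suc_atMost[of 0])
  have ode: "fps_X * fps_deriv (fps_of_poly P) = L * fps_of_poly P"
  proof (rule fps_ext)
    fix n show "fps_nth (fps_X * fps_deriv (fps_of_poly P)) n = fps_nth (L * fps_of_poly P) n"
      using ode1[of n] unfolding fps_mult_nth[of L] by (cases n) (auto simp: fps_X_mult_nth)
  qed
  have ode': "fps_X * fps_deriv (fps_of_poly P') = L' * fps_of_poly P'"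
  proof (rule fps_ext)
    fix n 
    have "of_nat n * coeff P' n = (\<Sum>k=0..n. fps_nth L' k * coeff P' (n - k))"
    proof -
      have "of_nat n * coeff P' n = (-1) ^ n * (of_nat n * coeff P n)"
        by (simp add: coeffP')
      also have "\<dots> = (\<Sum>k=0..n. (-1) ^ n * (fps_nth L k * coeff P (n - k)))"
        by (simp only: ode1 sum_distrib_left)
      also have "\<dots> = (\<Sum>k=0..n. fps_nth L' k * coeff P' (n - k))"
        by (rule sum.cong) (auto simp: L'_def coeffP' simp flip: power_add)
      finally show ?thesis .
    qed
    thus "fps_nth (fps_X * fps_deriv (fps_of_poly P')) n = fps_nth (L' * fps_of_poly P') n"
      unfolding fps_mult_nth[of L'] by (cases n) (auto simp: fps_X_mult_nth)
  qed
  define B where "B = P * P'"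
  have odeB: "fps_X * fps_deriv (fps_of_poly B) = (L + L') * fps_of_poly B"
  proof -
    have "fps_X * fps_deriv (fps_of_poly B) = 
        (fps_X * fps_deriv (fps_of_poly P)) * fps_of_poly P' + fps_of_poly P * (fps_X * fps_deriv (fps_of_poly P'))"
      by (simp add: B_def fps_of_poly_mult algebra_simps)
    thus ?thesis unfolding ode ode' by (simp add: B_def fps_of_poly_mult algebra_simps)
  qed
  have B0: "B \<noteq> 0"
    using P0 by (auto simp: B_def P'_def poly_pcompose dest: arg_cong[of _ _ "\<lambda>p. poly p 0"])
  have C0: "C \<ge> 0"
    using order.trans[OF norm_ge_zero bound[of 1]] R by (simp add: zero_le_mult_iff)
  \<comment> \<open>The odd coefficients of \<open>L + L'\<close> cancel and the even ones are twice
    those of \<open>L\<close>, so the bound on \<open>\<Lambda> (2 * l)\<close> gives a geometric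
    majorant.\<close>
  have rad: "fps_conv_radius (L + L') \<ge> ereal (1 / R)"
    unfolding fps_conv_radius_def
  proof (rule conv_radius_geI_ex')
    fix r :: real assume r: "0 < r" "ereal r < ereal (1 / R)"
    have "norm (fps_nth (L + L') n * of_real r ^ n) \<le> 2 * C * (R * r) ^ n" for n
    proof (cases "even n \<and> n \<noteq> 0")
      case True
      then obtain l where l: "n = 2 * l" "l \<ge> 1" by (auto elim!: evenE)
      have "norm (fps_nth (L + L') n * of_real r ^ n) = 2 * norm (\<Lambda> n) * r ^ n"
        using l r by (simp add: L_def L'_def norm_mult norm_power)
      also have "\<dots> \<le> 2 * (C * R ^ n) * r ^ n"
        using bound[OF l(2)] r l(1) by (intro mult_right_mono mult_left_mono) auto
      finally show ?thesis by (simp add: power_mult_distrib mult_ac)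
    next
      case False
      hence "fps_nth (L + L') n = 0" by (auto simp: L_def L'_def)
      thus ?thesis using C0 R r by simp
    qed
    moreover have "summable (\<lambda>n. 2 * C * (R * r) ^ n)"
      by (intro summable_mult summable_geometric) (use R r in \<open>auto simp: field_simps\<close>)
    ultimately show "summable (\<lambda>n. fps_nth (L + L') n * of_real r ^ n)"
      by (intro summable_comparison_test[OF _ \<open>summable _\<close>]) auto
  qed
  have "1 \<le> R * norm z" if "poly P z = 0" for z
  proof (rule ccontr)
    assume "\<not> 1 \<le> R * norm z"
    hence "norm z < 1 / R" using R by (simp add: field_simps)
    hence "ereal (norm z) < fps_conv_radius (L + L')" using rad by (meson ereal_less_eq(3) less_ereal.simps(1) order.strict_trans2)
    moreover have "z \<noteq> 0" using that P0 by auto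
    ultimately have "poly B z \<noteq> 0" using poly_log_deriv_no_roots[OF odeB B0] by blast
    thus False using that by (simp add: B_def)
  qed
  from coeff_1_le_of_roots_large[OF P0 this] have "norm (A 1) \<le> real (degree P) * R"
    by (simp add: coeffP)
  also have "\<dots> \<le> real (m - 1) * R" using degP R by (intro mult_right_mono) auto
  finally show ?thesis .
qed

section \<open>Norms from extension fields\<close>

interpretation to_ac: field_hom "to_ac :: 'a :: field \<Rightarrow> 'a alg_closure"
  by unfold_locales auto
interpretation to_ac_poly: map_poly_inj_idom_hom "to_ac :: 'a :: field \<Rightarrow> 'a alg_closure" ..

text \<open>All finite extensions are found inside one algebraic closure: the field with p^n
  elements is the set of the \<open>x\<close> with x^(p^n) = x, so that no extension field has to be
  constructed.\<close>

definition ac_eval :: "'a :: field poly \<Rightarrow> 'a alg_closure \<Rightarrow> 'a alg_closure" where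
  "ac_eval f x = poly (map_poly to_ac f) x"

lemma ac_eval_simps [simp]:
  "ac_eval 0 x = 0" "ac_eval 1 x = 1" "ac_eval (f + g) x = ac_eval f x + ac_eval g x"
  "ac_eval (f - g) x = ac_eval f x - ac_eval g x" "ac_eval (f * g) x = ac_eval f x * ac_eval g x"
  "ac_eval (smult c f) x = to_ac c * ac_eval f x" "ac_eval (f ^ n) x = ac_eval f x ^ n"
  "ac_eval (pCons c f) x = to_ac c + x * ac_eval f x"
  by (simp_all add: ac_eval_def hom_distribs to_ac.map_poly_hom_smult to_ac.map_poly_pCons_hom)

lemma ac_eval_sum: "ac_eval (\<Sum>i\<in>I. f i) x = (\<Sum>i\<in>I. ac_eval (f i) x)"
  by (induction I rule: infinite_finite_induct) auto

lemma ac_eval_prod: "ac_eval (\<Prod>i\<in>I. f i) x = (\<Prod>i\<in>I. ac_eval (f i) x)"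
  by (induction I rule: infinite_finite_induct) auto

lemma ac_eval_altdef: "ac_eval f x = (\<Sum>i\<le>degree f. to_ac (coeff f i) * x ^ i)"
  by (simp add: ac_eval_def poly_altdef)

text \<open>Otherwise a Bezout identity u P + v g = 1 over the base field would become 0 = 1 at
  \<open>x\<close>.\<close>

lemma irreducible_dvd_of_common_root:
  fixes P g :: "'a :: field_gcd poly"
  assumes P: "irreducible P" and x: "ac_eval P x = 0" "ac_eval g x = 0"
  shows "P dvd g"
proof (rule ccontr)
  assume "\<not> P dvd g"
  hence "coprime P g"
    using P by (simp add: prime_elem_imp_coprime irreducible_imp_prime_elem_gcd)
  then obtain u v where "u * P + v * g = 1"
    using bezout_coefficients_fst_snd[of P g] by (metis coprime_imp_gcd_eq_1)
  hence "ac_eval (u * P + v * g) x = 1" by (metis ac_eval_simps(2))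
  thus False using x by simp
qed

lemma to_ac_power_card [simp]: "to_ac (c :: 'a :: prime_card mod_ring) ^ (CARD('a) ^ n) = to_ac c"
proof -
  have "c ^ (CARD('a) ^ n) = c" by (rule finite_field_power_card_power_eq_same[of _ n]) simp
  thus ?thesis by (metis to_ac_power)
qed

lemma power_card_power_add:
  fixes x y :: "'a :: prime_card mod_ring alg_closure"
  shows "(x + y) ^ (CARD('a) ^ n) = x ^ (CARD('a) ^ n) + y ^ (CARD('a) ^ n)"
  by (rule freshmans_dream'[of _ n]) (auto simp: prime_card)

lemma ac_eval_power_card_power:
  fixes f :: "'a :: prime_card mod_ring poly"
  shows "ac_eval f x ^ (CARD('a) ^ n) = ac_eval f (x ^ (CARD('a) ^ n))"
proof -
  have "ac_eval f x ^ (CARD('a) ^ n) = (\<Sum>i\<le>degree f. (to_ac (coeff f i) * x ^ i) ^ (CARD('a) ^ n))"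
    unfolding ac_eval_altdef by (rule freshmans_dream_sum'[of _ n]) (auto simp: prime_card)
  also have "\<dots> = (\<Sum>i\<le>degree f. to_ac (coeff f i) * (x ^ (CARD('a) ^ n)) ^ i)"
    by (simp add: power_mult_distrib mult.commute flip: power_mult)
  finally show ?thesis by (simp add: ac_eval_altdef)
qed

lemma inj_power_card_power:
  fixes x y :: "'a :: prime_card mod_ring alg_closure"
  assumes "x ^ (CARD('a) ^ n) = y ^ (CARD('a) ^ n)"
  shows "x = y"
proof -
  have "(x - y) ^ (CARD('a) ^ n) + y ^ (CARD('a) ^ n) = x ^ (CARD('a) ^ n)"
    by (subst power_card_power_add[symmetric]) simp
  thus ?thesis using assms by simp
qed

lemma card_roots_le:
  fixes f :: "'a :: idom poly"
  assumes "f \<noteq> 0" "\<And>x. x \<in> Y \<Longrightarrow> poly f x = 0"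
  shows "card Y \<le> degree f"
proof -
  have "card Y \<le> card {x. poly f x = 0}"
    by (rule card_mono) (use assms poly_roots_finite in auto)
  also have "\<dots> \<le> degree f" by (rule card_poly_roots_bound) fact
  finally show ?thesis .
qed

text \<open>The norm from the field with p^n elements to the prime field is the power map with
  exponent 1 + p + ... + p^(n - 1); this is that exponent.\<close>

definition norm_exp :: "nat \<Rightarrow> nat \<Rightarrow> nat" where
  "norm_exp p n = (\<Sum>j<n. p ^ j)"

lemma norm_exp_add: "norm_exp p (a + s) = norm_exp p a + p ^ a * norm_exp p s"
  by (induction s) (simp_all add: norm_exp_def power_add algebra_simps)

lemma norm_exp_mult: "norm_exp p (s * k) = norm_exp p s * (\<Sum>i<k. p ^ (s * i))"
proof (induction k)
  case (Suc k)
  have "norm_exp p (s * Suc k) = norm_exp p (s * k + s)" by (simp add: add.commute)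
  thus ?case using Suc by (simp add: norm_exp_add distrib_left mult.commute)
qed (simp add: norm_exp_def)

lemma norm_exp_eq: "p > 0 \<Longrightarrow> (p - 1) * norm_exp p n + 1 = p ^ n"
  by (induction n) (auto simp: norm_exp_def algebra_simps nat_distrib gr0_conv_Suc)

section \<open>Conjugates of a root of an irreducible polynomial, and norms\<close>

context
  fixes P :: "'a :: prime_card mod_ring poly" and x s
  assumes P: "irreducible P" and x: "ac_eval P x = 0"
  defines "s \<equiv> degree P"
begin

lemma degree_pos_of_irreducible: "s > 0"
proof (rule ccontr)
  assume "\<not> s > 0"
  moreover have "P \<noteq> 0" using P by auto
  ultimately have "is_unit P" by (simp add: is_unit_iff_degree s_def)
  thus False using P irreducible_not_unit by blast
qed

lemma conjugate_root: "ac_eval P (x ^ (CARD('a) ^ n)) = 0"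
  using ac_eval_power_card_power[of P x n] x by (simp add: power_0_left)

text \<open>The values g(x) with deg g < \<open>s\<close> are p^s distinct elements, because
  \<open>P\<close> is irreducible of degree \<open>s\<close>. The \<open>t\<close>-th power of
  Frobenius fixes them all, so they are roots of X^(p^t) - X.\<close>

lemma frobenius_period_ge_degree:
  assumes t: "t > 0" "x ^ (CARD('a) ^ t) = x"
  shows "s \<le> t"
proof -
  let ?X = "{g :: 'a mod_ring poly. degree g \<le> s - 1}"
  let ?f = "monom 1 (CARD('a) ^ t) - monom 1 1 :: 'a mod_ring alg_closure poly"
  have p1: "1 < CARD('a)" by (rule nontriv)
  have inj: "inj_on (\<lambda>g. ac_eval g x) ?X"
  proof (rule inj_onI, rule ccontr)
    fix g h assume gh: "g \<in> ?X" "h \<in> ?X" "ac_eval g x = ac_eval h x" "g \<noteq> h"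
    have "P dvd g - h"
      by (rule irreducible_dvd_of_common_root[OF P x]) (use gh in simp)
    hence "s \<le> degree (g - h)" unfolding s_def by (rule dvd_imp_degree_le) (use gh in simp)
    moreover have "degree (g - h) \<le> s - 1" using gh by (intro degree_diff_le) auto
    ultimately show False using degree_pos_of_irreducible by simp
  qed
  have deg: "degree ?f \<le> CARD('a) ^ t"
    by (intro degree_diff_le order.trans[OF degree_monom_le]) auto
  have "CARD('a) ^ t > 1" using p1 t(1) by (rule one_less_power)
  hence lead: "coeff ?f (CARD('a) ^ t) = 1" unfolding coeff_diff coeff_monom by simp
  have "?f \<noteq> 0"
  proof
    assume "?f = 0"
    with lead show False by (simp only: coeff_0 zero_neq_one)
  qed
  have "CARD('a) ^ Suc (s - 1) = card ((\<lambda>g. ac_eval g x) ` ?X)"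
    by (simp only: card_image[OF inj] card_polys_degree_le CARD_mod_ring)
  also have "\<dots> \<le> degree ?f"
  proof (rule card_roots_le[OF \<open>?f \<noteq> 0\<close>], safe)
    fix g :: "'a mod_ring poly"
    show "poly ?f (ac_eval g x) = 0"
      using ac_eval_power_card_power[of g x t] t(2) by (simp add: poly_monom)
  qed
  also note deg
  finally have "Suc (s - 1) \<le> t" by (rule power_le_imp_le_exp[OF p1])
  thus ?thesis by simp
qed

lemma inj_conjugates: "inj_on (\<lambda>j. x ^ (CARD('a) ^ j)) {..<s}"
proof (rule linorder_inj_onI)
  fix i j assume "i < j" "i \<in> {..<s}" "j \<in> {..<s}"
  show "x ^ (CARD('a) ^ i) \<noteq> x ^ (CARD('a) ^ j)"
  proof
    assume eq: "x ^ (CARD('a) ^ i) = x ^ (CARD('a) ^ j)"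
    have "(x ^ (CARD('a) ^ (j - i))) ^ (CARD('a) ^ i) = x ^ (CARD('a) ^ i)"
      using \<open>i < j\<close> eq by (simp flip: power_mult power_add)
    hence "x ^ (CARD('a) ^ (j - i)) = x" by (rule inj_power_card_power)
    hence "s \<le> j - i" using \<open>i < j\<close> by (intro frobenius_period_ge_degree) auto
    thus False using \<open>i < j\<close> \<open>j \<in> _\<close> by simp
  qed
qed auto

lemma roots_eq_conjugates: "{y. ac_eval P y = 0} = (\<lambda>j. x ^ (CARD('a) ^ j)) ` {..<s}"
proof (rule sym, rule card_subset_eq)
  have nz: "map_poly to_ac P \<noteq> 0" using P by auto
  show fin: "finite {y. ac_eval P y = 0}"
    unfolding ac_eval_def using poly_roots_finite[OF nz] .
  show sub: "(\<lambda>j. x ^ (CARD('a) ^ j)) ` {..<s} \<subseteq> {y. ac_eval P y = 0}"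
    using conjugate_root by auto
  have "card {y. ac_eval P y = 0} \<le> degree (map_poly to_ac P)"
    by (rule card_roots_le[OF nz]) (simp add: ac_eval_def)
  also have "degree (map_poly to_ac P) = s" unfolding s_def by simp
  finally show "card ((\<lambda>j. x ^ (CARD('a) ^ j)) ` {..<s}) = card {y. ac_eval P y = 0}"
    using card_mono[OF fin sub] unfolding card_image[OF inj_conjugates] card_lessThan by (rule antisym[rotated])
qed

lemma card_roots_irreducible: "card {y. ac_eval P y = 0} = s"
  by (simp add: roots_eq_conjugates card_image[OF inj_conjugates])

lemma frobenius_power_degree: "x ^ (CARD('a) ^ s) = x"
proof -
  have "x ^ (CARD('a) ^ s) \<in> {y. ac_eval P y = 0}" using conjugate_root by simp
  then obtain i where i: "i < s" "x ^ (CARD('a) ^ s) = x ^ (CARD('a) ^ i)"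
    unfolding roots_eq_conjugates by auto
  have "(x ^ (CARD('a) ^ (s - i))) ^ (CARD('a) ^ i) = x ^ (CARD('a) ^ i)"
    using i by (simp flip: power_mult power_add)
  hence *: "x ^ (CARD('a) ^ (s - i)) = x" by (rule inj_power_card_power)
  hence "s \<le> s - i" using i by (intro frobenius_period_ge_degree) auto
  hence "i = 0" using i by simp
  thus ?thesis using * by simp
qed

lemma map_poly_to_ac_split:
  assumes monic: "lead_coeff P = 1"
  shows "map_poly to_ac P = (\<Prod>j<s. [:- (x ^ (CARD('a) ^ j)), 1:])" (is "?L = ?R")
proof (rule ccontr)
  assume ne: "?L \<noteq> ?R"
  have dR: "degree ?R = s" by (subst degree_prod_eq_sum_degree) auto
  have lR: "lead_coeff ?R = 1" by (simp add: lead_coeff_prod)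
  have "degree (?L - ?R) < s"
  proof (rule degree_lessI)
    show "?L - ?R \<noteq> 0 \<or> s > 0" using degree_pos_of_irreducible by simp
    show "\<forall>k\<ge>s. coeff (?L - ?R) k = 0"
    proof (intro allI impI)
      fix k assume "k \<ge> s"
      show "coeff (?L - ?R) k = 0"
      proof (cases "k = s")
        case True
        thus ?thesis using monic lR dR by (simp add: s_def)
      next
        case False
        thus ?thesis using \<open>k \<ge> s\<close> dR by (simp add: coeff_eq_0 s_def)
      qed
    qed
  qed
  moreover have "s \<le> degree (?L - ?R)"
  proof -
    have "s = card ((\<lambda>j. x ^ (CARD('a) ^ j)) ` {..<s})" by (simp add: card_image[OF inj_conjugates])
    also have "\<dots> \<le> degree (?L - ?R)"
    proof (rule card_roots_le)
      fix y assume "y \<in> (\<lambda>j. x ^ (CARD('a) ^ j)) ` {..<s}"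
      then obtain j where "j < s" "y = x ^ (CARD('a) ^ j)" by auto
      thus "poly (?L - ?R) y = 0"
        using conjugate_root[of j] by (auto simp: ac_eval_def poly_prod intro!: prod_zero)
    qed (use ne in simp)
    finally show ?thesis .
  qed
  ultimately show False by simp
qed

text \<open>Since \<open>a\<close> lies in the prime field, a - x^(p^j) is the p^j-th power of a -
  x, so the product over the conjugates is a norm. This links values of polynomials over the prime
  field with points of extension fields.\<close>

lemma irreducible_poly_eval_eq_norm:
  assumes monic: "lead_coeff P = 1"
  shows "to_ac (poly P a) = (to_ac a - x) ^ norm_exp (CARD('a)) s"
proof -
  have "to_ac (poly P a) = poly (map_poly to_ac P) (to_ac a)" by (rule to_ac.poly_map_poly[symmetric])
  also have "\<dots> = (\<Prod>j<s. to_ac a - x ^ (CARD('a) ^ j))"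
    unfolding map_poly_to_ac_split[OF monic] poly_prod by (intro prod.cong) auto
  also have "\<dots> = (\<Prod>j<s. (to_ac a - x) ^ (CARD('a) ^ j))"
  proof (rule prod.cong)
    fix j
    have "(to_ac a - x) ^ (CARD('a) ^ j) + x ^ (CARD('a) ^ j) = to_ac a"
      unfolding power_card_power_add[symmetric] diff_add_cancel by (rule to_ac_power_card)
    thus "to_ac a - x ^ (CARD('a) ^ j) = (to_ac a - x) ^ (CARD('a) ^ j)"
      by (metis add_diff_cancel_right')
  qed (rule refl)
  also have "\<dots> = (to_ac a - x) ^ norm_exp (CARD('a)) s"
    unfolding norm_exp_def by (rule power_sum[symmetric])
  finally show ?thesis .
qed

text \<open>The exponent is that of degree \<open>s\<close> times a sum of \<open>k\<close> powers
  of \<open>p\<close>, and each of these Frobenius powers fixes P(a).\<close>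

lemma irreducible_poly_eval_power_eq_norm:
  assumes monic: "lead_coeff P = 1" and n: "n = s * k"
  shows "(to_ac a - x) ^ norm_exp (CARD('a)) n = to_ac (poly P a ^ k)"
proof -
  have "(to_ac a - x) ^ norm_exp (CARD('a)) n = to_ac (poly P a) ^ (\<Sum>i<k. CARD('a) ^ (s * i))"
    unfolding n norm_exp_mult irreducible_poly_eval_eq_norm[OF monic] by (rule power_mult)
  also have "\<dots> = (\<Prod>i<k. to_ac (poly P a) ^ (CARD('a) ^ (s * i)))" by (rule power_sum)
  also have "\<dots> = (\<Prod>i<k. to_ac (poly P a))" by (intro prod.cong refl to_ac_power_card)
  also have "\<dots> = to_ac (poly P a ^ k)" by simp
  finally show ?thesis .
qed

lemma frobenius_power_multiple: "x ^ (CARD('a) ^ (s * k)) = x"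
proof (induction k)
  case (Suc k)
  have "x ^ (CARD('a) ^ (s * Suc k)) = (x ^ (CARD('a) ^ s)) ^ (CARD('a) ^ (s * k))"
    by (simp only: mult_Suc_right power_add power_mult[of x])
  thus ?case by (simp only: frobenius_power_degree Suc)
qed simp

end

section \<open>The Stepanov--Bombieri method\<close>

text \<open>The number of unknowns against the degree of the equations. The terms (p - 1) J^2
  cancel; the surplus \<open>2 * m + 4\<close> in the range of one index contributes (2 m + 4) (p -
  1) J on the right, enough for (p - 2) J m and the lower order terms.\<close>

lemma stepanov_parameter_bound:
  fixes p J Q m :: nat
  assumes Q: "(p - 1) * J + 1 = Q" and p: "p \<ge> 3" and J: "J \<ge> 1"
  shows "(p - 2) * (J * m) + Q * (J - 1) + (J + (2 * m + 4)) < (J + (2 * m + 4)) * (p - 1) * J"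
proof -
  obtain p' where p': "p = p' + 3" using p by (metis add.commute le_Suc_ex)
  obtain J' where J': "J = J' + 1" using J by (metis add.commute le_Suc_ex)
  have "p - 2 = p' + 1" "p - 1 = p' + 2" "J - 1 = J'" by (simp_all add: p' J')
  moreover have "(p' + 1) * ((J' + 1) * m) + ((p' + 2) * (J' + 1) + 1) * J' + (J' + 1 + (2 * m + 4))
      < (J' + 1 + (2 * m + 4)) * (p' + 2) * (J' + 1)"
    by (simp add: algebra_simps)
  ultimately show ?thesis
    unfolding Q[symmetric] J' by simp
qed

lemma mixed_radix_unique:
  fixes J Q :: nat
  assumes "J * i + j1 < Q" "J * i' + j1' < Q" "j1 < J" "j1' < J"
    and eq: "J * i + j1 + Q * j2 = J * i' + j1' + Q * j2'"
  shows "j2 = j2' \<and> i = i' \<and> j1 = j1'"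
proof -
  have *: "(r + d * q) div d = q" if "r < d" for r d q :: nat
    using that by simp
  have 1: "j2 = j2'"
    using arg_cong[OF eq, of "\<lambda>n. n div Q"] unfolding *[OF assms(1)] *[OF assms(2)] .
  hence 2: "j1 + J * i = j1' + J * i'" using eq by simp
  have 3: "i = i'"
    using arg_cong[OF 2, of "\<lambda>n. n div J"] unfolding *[OF assms(3)] *[OF assms(4)] .
  show ?thesis using 1 2 3 by simp
qed

text \<open>
  Bombieri's version of the method, which needs no derivatives. With \<open>Q = p ^ l\<close>, at the points to
  be counted the power \<open>G ^ Q\<close> of the auxiliary polynomial agrees, up to a power of \<open>h\<close>, with a
  polynomial of much smaller degree depending linearly on the coefficients of \<open>G\<close>; these can be
  chosen such that the latter is zero. The terms of \<open>G\<close> have distinct orders at \<open>a1\<close>, so \<open>G \<noteq> 0\<close>.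
\<close>
theorem stepanov_bound:
  fixes F f1 :: "'a :: prime_card mod_ring poly" and a1 c :: "'a mod_ring"
  assumes F: "F = [:a1, -1:] * f1" and f1: "poly f1 a1 \<noteq> 0" and p3: "CARD('a) \<ge> 3"
    and c: "c \<noteq> 0" and l: "l \<ge> 1"
  defines "m \<equiv> degree F" and "p \<equiv> CARD('a)"
  shows "(p - 1) * card {x. x ^ (p ^ (2 * l)) = x \<and> ac_eval F x ^ norm_exp p (2 * l) = to_ac c}
      \<le> p ^ (2 * l) + (3 * p * m + 4 * p + 1) * p ^ l"
proof -
  define Y where "Y = {x. x ^ (p ^ (2 * l)) = x \<and> ac_eval F x ^ norm_exp p (2 * l) = to_ac c}"
  define Q where "Q = p ^ l"
  define J where "J = norm_exp p l"
  define J2 where "J2 = J + (2 * m + 4)"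
  define T where "T = {..<J2} \<times> {..<p - 1} \<times> {..<J}"
  define h where "h = F ^ J"
  define \<tau> where "\<tau> = [:a1, -1:]"
  have F\<tau>: "F = \<tau> * f1" by (simp only: F \<tau>_def)
  have p: "p \<ge> 3" using p3 by (simp add: p_def)
  have Q: "(p - 1) * J + 1 = Q"
    unfolding J_def Q_def using p by (intro norm_exp_eq) simp
  have "norm_exp p l = 1 + (\<Sum>j=1..<l. p ^ j)"
    unfolding norm_exp_def lessThan_atLeast0 using l by (subst sum.atLeast_Suc_lessThan) auto
  hence J: "J \<ge> 1" by (simp add: J_def)
  have finT: "finite T" by (simp add: T_def)
  have degh: "degree (h ^ i) \<le> k * (J * m)" if "i \<le> k" for i k
  proof -
    have "degree (h ^ i) \<le> degree h * i" by (rule degree_power_le)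
    also have "degree h \<le> m * J" unfolding h_def m_def by (rule degree_power_le)
    also have "m * J * i \<le> k * (J * m)" using that by (simp add: mult_ac mult_le_mono)
    finally show ?thesis by simp
  qed
  have deg\<tau>: "degree (\<tau> ^ i) \<le> i" for i
    using degree_power_le[of \<tau> i] by (simp add: \<tau>_def)
  \<comment> \<open>At a counted point, y = h(x) satisfies y^(Q + 1) = c and z = \<tau>(x) satisfies
    z^(Q Q) = z. So the \<open>Q\<close>-th power of the term h^i \<tau>^(j1 + Q j2) of
    \<open>G\<close>, times h^(p - 2), has there the value of \<open>E\<close>: the digits
    \<open>j1\<close> and \<open>j2\<close> change places, and a degree of order Q^2 J2 drops to one
    of order Q J.\<close>
  define E where "E = (\<lambda>(j2, i, j1). smult (c ^ i) (h ^ (p - 2 - i) * \<tau> ^ (Q * j1 + j2)))"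
  define D where "D = (p - 2) * (J * m) + (Q * (J - 1) + (J2 - 1))"
  have "degree (E t) \<le> D" if "t \<in> T" for t
  proof -
    obtain j2 i j1 where t: "t = (j2, i, j1)" by (cases t)
    have "degree (E t) \<le> degree (h ^ (p - 2 - i)) + degree (\<tau> ^ (Q * j1 + j2))"
      unfolding E_def t prod.case by (intro order.trans[OF degree_smult_le] degree_mult_le)
    also have "\<dots> \<le> (p - 2) * (J * m) + (Q * j1 + j2)"
      by (intro add_mono degh deg\<tau>) simp
    also have "Q * j1 + j2 \<le> Q * (J - 1) + (J2 - 1)"
      using that by (intro add_mono mult_le_mono2) (auto simp: T_def t)
    finally show ?thesis by (simp add: D_def)
  qed
  moreover have "Suc D < card T"
  proof -
    have "Suc D = (p - 2) * (J * m) + Q * (J - 1) + J2" by (simp add: D_def J2_def)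
    also have "\<dots> < J2 * (p - 1) * J"
      unfolding J2_def by (rule stepanov_parameter_bound[OF Q p J])
    also have "\<dots> = card T" by (simp add: T_def card_cartesian_product)
    finally show ?thesis .
  qed
  ultimately obtain C where C: "\<exists>t\<in>T. C t \<noteq> 0" "(\<Sum>t\<in>T. smult (C t) (E t)) = 0"
    using poly_linear_dependence[OF finT] by metis
  \<comment> \<open>\<open>w t\<close> is the order of the term at \<open>a1\<close>: as
    \<open>F\<close> has a simple zero there, h^i contributes exactly J i. The range i < p - 1 makes
    J i + j1 < Q, so that \<open>i\<close>, \<open>j1\<close> and \<open>j2\<close> can be read off
    from the exponent.\<close>
  define w where "w = (\<lambda>(j2, i, j1). J * i + j1 + Q * j2)"
  define u where "u = (\<lambda>(j2 :: nat, i, j1 :: nat). f1 ^ (J * i))"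
  define G where "G = (\<Sum>t\<in>T. smult (C t) (\<tau> ^ w t * u t))"
  have inj: "inj_on w T"
  proof (rule inj_onI)
    fix s t assume st: "s \<in> T" "t \<in> T" "w s = w t"
    obtain j2 i j1 where s: "s = (j2, i, j1)" by (cases s)
    obtain j2' i' j1' where t: "t = (j2', i', j1')" by (cases t)
    have *: "J * i + j1 < Q" if "i < p - 1" "j1 < J" for i j1
    proof -
      have "J * i + j1 < J * (i + 1)" using that by simp
      also have "\<dots> \<le> J * (p - 1)" using that by (intro mult_le_mono2) simp
      finally show ?thesis using Q by (simp add: mult.commute)
    qed
    have "J * i + j1 < Q" "J * i' + j1' < Q" 
      by (rule *; use st in \<open>simp add: s t T_def\<close>)+
    moreover have "j1 < J" "j1' < J" "J * i + j1 + Q * j2 = J * i' + j1' + Q * j2'" 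
      using st by (simp_all add: s t T_def w_def)
    ultimately have "j2 = j2' \<and> i = i' \<and> j1 = j1'" by (rule mixed_radix_unique)
    thus "s = t" unfolding s t by simp
  qed
  have G0: "G \<noteq> 0"
  proof
    assume "G = 0"
    have "poly \<tau> a1 = 0" "\<tau> \<noteq> 0" by (simp_all add: \<tau>_def)
    moreover have "poly (u t) a1 \<noteq> 0" for t using f1 by (cases t) (simp add: u_def)
    ultimately have "C t = 0" if "t \<in> T" for t
      using \<open>G = 0\<close> that unfolding G_def by (intro linear_independent_of_distinct_orders[OF finT inj])
    with C(1) show False by blast
  qed
  have G_term: "\<tau> ^ w (j2, i, j1) * u (j2, i, j1) = h ^ i * \<tau> ^ (j1 + Q * j2)" for j2 i j1
    unfolding w_def u_def h_def F\<tau> prod.case power_add power_mult_distrib power_mult by (simp only: mult_ac)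
  have degG: "degree G \<le> (p - 2) * (J * m) + ((J - 1) + Q * (J2 - 1))"
    unfolding G_def
  proof (rule degree_sum_le[OF finT])
    fix t assume "t \<in> T"
    obtain j2 i j1 where t: "t = (j2, i, j1)" by (cases t)
    have "degree (smult (C t) (\<tau> ^ w t * u t)) \<le> degree (h ^ i) + degree (\<tau> ^ (j1 + Q * j2))"
      unfolding t G_term by (intro order.trans[OF degree_smult_le] degree_mult_le)
    also have "\<dots> \<le> (p - 2) * (J * m) + (j1 + Q * j2)"
      using \<open>t \<in> T\<close> by (intro add_mono degh deg\<tau>) (auto simp: t T_def)
    also have "j1 + Q * j2 \<le> (J - 1) + Q * (J2 - 1)"
      using \<open>t \<in> T\<close> by (intro add_mono mult_le_mono2) (auto simp: T_def t)
    finally show "degree (smult (C t) (\<tau> ^ w t * u t)) \<le> (p - 2) * (J * m) + ((J - 1) + Q * (J2 - 1))"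
      by simp
  qed
  have root: "ac_eval G x = 0" if x: "x \<in> Y" for x
  proof -
    define y where "y = ac_eval h x"
    define z where "z = ac_eval \<tau> x"
    have zQ: "z ^ (Q * Q) = z"
    proof -
      have "z ^ (p ^ (2 * l)) = ac_eval \<tau> (x ^ (p ^ (2 * l)))"
        unfolding z_def p_def by (rule ac_eval_power_card_power)
      also have "x ^ (p ^ (2 * l)) = x" using x by (simp add: Y_def)
      finally show ?thesis by (simp only: z_def Q_def mult_2 power_add)
    qed
    have "norm_exp p (2 * l) = J * (Q + 1)"
      unfolding mult_2 norm_exp_add by (simp add: J_def Q_def algebra_simps)
    hence "y ^ (Q + 1) = ac_eval F x ^ norm_exp p (2 * l)"
      by (simp only: y_def h_def ac_eval_simps power_mult)
    hence yQ: "y ^ (Q + 1) = to_ac c" using x by (simp only: Y_def mem_Collect_eq)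
    have y0: "y \<noteq> 0" using yQ c by (cases "y = 0") auto
    have "ac_eval G x ^ Q = (\<Sum>t\<in>T. ac_eval (smult (C t) (\<tau> ^ w t * u t)) x ^ Q)"
      unfolding G_def ac_eval_sum Q_def p_def
      by (rule freshmans_dream_sum'[of _ l]) (auto simp: prime_card)
    hence "ac_eval G x ^ Q * y ^ (p - 2) = (\<Sum>t\<in>T. ac_eval (smult (C t) (\<tau> ^ w t * u t)) x ^ Q * y ^ (p - 2))"
      by (simp only: sum_distrib_right)
    also have "\<dots> = (\<Sum>t\<in>T. ac_eval (smult (C t) (E t)) x)"
    proof (rule sum.cong)
      fix t assume "t \<in> T"
      obtain j2 i j1 where t: "t = (j2, i, j1)" by (cases t)
      have i: "i \<le> p - 2" using \<open>t \<in> T\<close> by (auto simp: t T_def)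
      have C': "to_ac (C t) ^ Q = to_ac (C t)" unfolding Q_def p_def by (rule to_ac_power_card)
      have "i + (p - 2 - i) = p - 2" using i by simp
      hence "(y ^ i) ^ Q * y ^ (p - 2) = y ^ (i * Q + (i + (p - 2 - i)))"
        by (simp only: power_add[of y "i * Q"] power_mult[of y i])
      also have "i * Q + (i + (p - 2 - i)) = (Q + 1) * i + (p - 2 - i)" by simp
      also have "y ^ \<dots> = to_ac (c ^ i) * y ^ (p - 2 - i)"
        by (simp only: power_add[of y "(Q + 1) * i"] power_mult[of y "Q + 1"] yQ to_ac_power)
      finally have 1: "(y ^ i) ^ Q * y ^ (p - 2) = to_ac (c ^ i) * y ^ (p - 2 - i)" .
      have "(j1 + Q * j2) * Q = Q * j1 + Q * Q * j2" by (simp add: algebra_simps)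
      hence "(z ^ (j1 + Q * j2)) ^ Q = z ^ (Q * j1 + Q * Q * j2)" by (simp only: power_mult[symmetric])
      also have "\<dots> = z ^ (Q * j1 + j2)"
        by (simp only: power_add[of z "Q * j1"] power_mult[of z "Q * Q"] zQ)
      finally have 2: "(z ^ (j1 + Q * j2)) ^ Q = z ^ (Q * j1 + j2)" .
      have 3: "ac_eval (smult (C t) (\<tau> ^ w t * u t)) x = to_ac (C t) * (y ^ i * z ^ (j1 + Q * j2))"
        by (simp only: t G_term ac_eval_simps y_def z_def)
      have 4: "ac_eval (smult (C t) (E t)) x = to_ac (C t) * (to_ac (c ^ i) * (y ^ (p - 2 - i) * z ^ (Q * j1 + j2)))"
        by (simp only: t E_def prod.case ac_eval_simps y_def z_def)
      have "(to_ac (C t) * (y ^ i * z ^ (j1 + Q * j2))) ^ Q * y ^ (p - 2)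
          = to_ac (C t) ^ Q * ((y ^ i) ^ Q * y ^ (p - 2)) * (z ^ (j1 + Q * j2)) ^ Q"
        by (simp only: power_mult_distrib mult_ac)
      thus "ac_eval (smult (C t) (\<tau> ^ w t * u t)) x ^ Q * y ^ (p - 2) = ac_eval (smult (C t) (E t)) x"
        unfolding 1 2 3 4 C' by (simp only: mult.assoc)
    qed (rule refl)
    also have "\<dots> = 0"
      using ac_eval_sum[of "\<lambda>t. smult (C t) (E t)" T x] unfolding C(2) ac_eval_simps(1) by (rule sym)
    finally have "ac_eval G x ^ Q = 0" using y0 by (metis mult_eq_0_iff power_not_zero)
    thus ?thesis by (metis power_not_zero)
  qed
  have "card Y \<le> degree (map_poly to_ac G)"
    by (rule card_roots_le) (use G0 root in \<open>auto simp: ac_eval_def\<close>)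
  also have "\<dots> = degree G" by simp
  finally have "card Y \<le> (p - 2) * (J * m) + ((J - 1) + Q * (J2 - 1))" using degG by simp
  hence "(p - 1) * card Y \<le> (p - 1) * ((p - 2) * (J * m) + ((J - 1) + Q * (J2 - 1)))"
    by (rule mult_le_mono2)
  also have "\<dots> \<le> (p - 1) * ((p - 2) * (J * m) + (J + Q * J2))"
    by (intro mult_le_mono2 add_mono) simp_all
  \<comment> \<open>The main term is Q (p - 1) J <= Q Q, the expected count; every other term is
    O(Q) for fixed \<open>p\<close> and \<open>m\<close>.\<close>
  also have "\<dots> = ((p - 1) * J) * ((p - 2) * m) + (p - 1) * J + Q * ((p - 1) * J) + Q * (p - 1) * (2 * m + 4)"
  proof -
    have "a * (b * (J * m) + (J + Q * (J + (2 * m + 4)))) = (a * J) * (b * m) + a * J + Q * (a * J) + Q * a * (2 * m + 4)" for a b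
      by (simp add: algebra_simps)
    thus ?thesis unfolding J2_def .
  qed
  also have "\<dots> \<le> Q * (p * m) + Q + Q * Q + Q * p * (2 * m + 4)"
  proof -
    have "(p - 1) * J \<le> Q" "p - 1 \<le> p" "p - 2 \<le> p" using Q by simp_all
    thus ?thesis by (intro add_mono mult_le_mono order.refl)
  qed
  also have "\<dots> = Q * Q + (3 * p * m + 4 * p + 1) * Q" by (simp add: algebra_simps)
  finally show ?thesis unfolding Y_def Q_def mult_2 power_add .
qed

section \<open>The Euler product\<close>

definition monic_polys :: "nat \<Rightarrow> 'a :: {comm_semiring_1} poly set" where
  "monic_polys n = {g. lead_coeff g = 1 \<and> degree g = n}"

lemma finite_monic_polys: "finite (monic_polys n :: 'a :: {finite, comm_semiring_1} poly set)"
  by (rule finite_subset[OF _ finite_polys_degree_le[of n]]) (auto simp: monic_polys_def)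

lemma monic_polys_0: "monic_polys 0 = {1}"
  by (auto simp: monic_polys_def elim!: degree_eq_zeroE)

lemma bij_betw_monic_polys_Suc:
  "bij_betw (\<lambda>f. monom 1 (Suc n) + f) {f :: 'a :: comm_ring_1 poly. degree f \<le> n} (monic_polys (Suc n))"
proof (rule bij_betwI)
  show "(\<lambda>f. monom 1 (Suc n) + f) \<in> {f :: 'a poly. degree f \<le> n} \<rightarrow> monic_polys (Suc n)"
    by (auto simp: monic_polys_def degree_add_eq_left degree_monom_eq coeff_eq_0)
  show "(\<lambda>g. g - monom 1 (Suc n)) \<in> monic_polys (Suc n) \<rightarrow> {f :: 'a poly. degree f \<le> n}"
  proof safe
    fix g :: "'a poly" assume g: "g \<in> monic_polys (Suc n)"
    show "degree (g - monom 1 (Suc n)) \<le> n"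
    proof (rule degree_le, intro allI impI)
      fix i assume "n < i"
      thus "coeff (g - monom 1 (Suc n)) i = 0"
        using g by (cases "i = Suc n") (auto simp: monic_polys_def coeff_eq_0)
    qed
  qed
qed auto

lemma card_monic_polys: "card (monic_polys n :: 'a :: {finite, comm_ring_1} poly set) = CARD('a) ^ n"
  by (cases n) (simp_all add: monic_polys_0 card_polys_degree_le flip: bij_betw_same_card[OF bij_betw_monic_polys_Suc])

lemma prime_poly_monic:
  fixes P :: "'a :: field_gcd poly"
  assumes "prime P"
  shows "lead_coeff P = 1" "irreducible P" "degree P > 0" "P \<noteq> 0"
proof -
  show "P \<noteq> 0" using assms by auto
  have "normalize P = P" using assms by simp
  hence "unit_factor P = 1"
    using unit_factor_mult_normalize[of P] \<open>P \<noteq> 0\<close> by (metis mult_cancel_right1)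
  thus "lead_coeff P = 1"
    by (simp add: unit_factor_poly_def one_pCons unit_factor_field_def)
  show "irreducible P" using assms by (simp add: prime_elem_imp_irreducible)
  show "degree P > 0"
    using assms \<open>P \<noteq> 0\<close> by (metis is_unit_iff_degree neq0_conv not_prime_unit)
qed

lemma normalize_monic_poly: "lead_coeff g = 1 \<Longrightarrow> normalize g = (g :: 'a :: field_gcd poly)"
  by (simp add: normalize_poly_def flip: one_pCons)

lemma prime_polyI:
  fixes P :: "'a :: field_gcd poly"
  assumes "irreducible P" "lead_coeff P = 1"
  shows "prime P"
  unfolding normalization_semidom_class.prime_def using assms by (simp add: irreducible_imp_prime_elem_gcd normalize_monic_poly)

lemma monic_polys_mult_iff:
  fixes P :: "'a :: idom poly"
  assumes "P \<in> monic_polys d"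
  shows "P * g \<in> monic_polys n \<longleftrightarrow> d \<le> n \<and> g \<in> monic_polys (n - d)"
proof (cases "g = 0")
  case False
  have P: "lead_coeff P = 1" "degree P = d" "P \<noteq> 0" using assms by (auto simp: monic_polys_def)
  have "lead_coeff (P * g) = lead_coeff g" by (simp only: lead_coeff_mult P(1) mult_1)
  moreover have "degree (P * g) = d + degree g" by (simp only: degree_mult_eq[OF P(3) False] P(2))
  ultimately have "P * g \<in> monic_polys n \<longleftrightarrow> lead_coeff g = 1 \<and> d + degree g = n"
    unfolding monic_polys_def mem_Collect_eq by (simp only:)
  thus ?thesis by (auto simp: monic_polys_def)
qed (auto simp: monic_polys_def)

lemma monic_polys_power:
  fixes P :: "'a :: idom poly"
  assumes "lead_coeff P = 1"
  shows "P ^ j \<in> monic_polys (j * degree P)"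
proof -
  have "P \<noteq> 0" using assms by auto
  have "lead_coeff (P ^ j) = 1" by (simp only: lead_coeff_power assms power_one)
  moreover have "degree (P ^ j) = j * degree P"
    using degree_power_eq[OF \<open>P \<noteq> 0\<close>, of j] by (simp only: mult.commute)
  ultimately show ?thesis unfolding monic_polys_def by blast
qed

text \<open>The coefficient of T^k in T L'(T) / L(T), where L is the sum of \<psi>(g) T^deg(g) over
  monic g. As for the von Mangoldt function, a prime P occurs at the exponents j deg(P) with
  coefficient deg(P) \<psi>(P)^j.\<close>

definition mangoldt_sum :: "('a :: field_gcd poly \<Rightarrow> complex) \<Rightarrow> nat \<Rightarrow> complex" where
  "mangoldt_sum \<psi> k = (\<Sum>P | prime P \<and> degree P dvd k. of_nat (degree P) * \<psi> P ^ (k div degree P))"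

lemma finite_prime_polys_dvd:
  "k > 0 \<Longrightarrow> finite {P :: 'a :: {finite, field_gcd} poly. prime P \<and> degree P dvd k}"
  by (rule finite_subset[OF _ finite_polys_degree_le[of k]]) (auto dest: dvd_imp_le)

text \<open>The analogue of log n being the sum of the von Mangoldt function over the divisors of n:
  P is counted once for each of its powers dividing \<open>g\<close>. The condition
  \<open>j * degree P \<le> n\<close> follows from divisibility and makes the range of (P, j) the
  same for all \<open>g\<close>.\<close>

lemma degree_monic_eq_sum_prime_powers:
  fixes g :: "'a :: {finite, field_gcd} poly"
  assumes g: "g \<in> monic_polys n"
  shows "n = (\<Sum>(P, j) | prime P \<and> j > 0 \<and> j * degree P \<le> n \<and> P ^ j dvd g. degree P)"
proof -
  have g0: "g \<noteq> 0" and deg: "degree g = n" using g by (auto simp: monic_polys_def)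
  have "normalize g = g" using g unfolding monic_polys_def by (intro normalize_monic_poly) blast
  have "n = degree (\<Prod>P\<in>prime_factors g. P ^ multiplicity P g)"
    by (simp add: prod_prime_factors[OF g0] \<open>normalize g = g\<close> deg)
  also have "\<dots> = (\<Sum>P\<in>prime_factors g. multiplicity P g * degree P)"
    by (subst degree_prod_eq_sum_degree)
       (auto intro!: sum.cong simp: degree_power_eq in_prime_factors_imp_prime prime_poly_monic)
  also have "\<dots> = (\<Sum>P\<in>prime_factors g. \<Sum>j\<in>{1..multiplicity P g}. degree P)" by simp
  also have "\<dots> = (\<Sum>(P, j)\<in>Sigma (prime_factors g) (\<lambda>P. {1..multiplicity P g}). degree P)"
    by (rule sum.Sigma) auto
  also have "Sigma (prime_factors g) (\<lambda>P. {1..multiplicity P g}) = 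
      {(P, j). prime P \<and> j > 0 \<and> j * degree P \<le> n \<and> P ^ j dvd g}"
  proof (safe, goal_cases)
    case (3 P j)
    hence "P ^ j dvd g" by (simp add: power_dvd_iff_le_multiplicity g0 multiplicity_dvd')
    hence "degree (P ^ j) \<le> degree g" by (rule dvd_imp_degree_le) (rule g0)
    moreover have "P \<noteq> 0" using 3 by (intro prime_poly_monic(4) in_prime_factors_imp_prime)
    ultimately show ?case by (simp add: degree_power_eq deg mult.commute)
  next
    case (5 P j)
    hence "P dvd g" by (metis dvd_power dvd_trans)
    thus ?case using 5 g0 by (simp add: prime_factors_dvd)
  next
    case (6 P j)
    thus ?case using g0 prime_poly_monic(3)[OF 6(1)] by (auto simp: power_dvd_iff_le_multiplicity is_unit_iff_degree)
  qed (auto simp: prime_factors_dvd multiplicity_dvd')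
  finally show ?thesis .
qed

text \<open>The identity T L' = (T L' / L) L, proved by counting instead of with power series:
  \<open>n\<close> is the sum of deg(P) over the prime powers P^j dividing g, the sums are
  exchanged, and the cofactor of P^j in g is an arbitrary monic polynomial of degree n - j
  deg(P).\<close>

theorem euler_product_recursion:
  fixes \<psi> :: "'a :: {finite, field_gcd} poly \<Rightarrow> complex"
  assumes mult: "\<And>f g. \<psi> (f * g) = \<psi> f * \<psi> g" and one: "\<psi> 1 = 1"
  shows "of_nat n * (\<Sum>g\<in>monic_polys n. \<psi> g) =
           (\<Sum>k=1..n. mangoldt_sum \<psi> k * (\<Sum>g\<in>monic_polys (n - k). \<psi> g))"
proof -
  have pow: "\<psi> (f ^ j) = \<psi> f ^ j" for f j by (induction j) (simp_all add: mult one)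
  define I where "I = {(P :: 'a poly, j). prime P \<and> j > 0 \<and> j * degree P \<le> n}"
  have finI: "finite I"
  proof (rule finite_subset)
    show "I \<subseteq> {P. degree P \<le> n} \<times> {..n}"
    proof safe
      fix P j assume "(P, j) \<in> I"
      hence "0 < degree P" "0 < j" "j * degree P \<le> n" by (auto simp: I_def prime_poly_monic)
      thus "degree P \<le> n" "j \<le> n" by (auto intro: order.trans[rotated])
    qed
  qed (auto intro: finite_polys_degree_le)
  define S where "S = (\<lambda>m. \<Sum>g\<in>monic_polys m. \<psi> g)"
  have "of_nat n * S n = (\<Sum>g\<in>monic_polys n. of_nat n * \<psi> g)"
    by (simp add: S_def sum_distrib_left)
  also have "\<dots> = (\<Sum>g\<in>monic_polys n. \<Sum>(P, j) | (P, j) \<in> I \<and> P ^ j dvd g. of_nat (degree P) * \<psi> g)"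
  proof (rule sum.cong)
    fix g :: "'a poly" assume "g \<in> monic_polys n"
    from degree_monic_eq_sum_prime_powers[OF this]
    have "n = (\<Sum>(P, j) | (P, j) \<in> I \<and> P ^ j dvd g. degree P)"
      by (simp add: I_def case_prod_unfold conj_assoc)
    hence "of_nat n * \<psi> g = of_nat (\<Sum>(P, j) | (P, j) \<in> I \<and> P ^ j dvd g. degree P) * \<psi> g"
      by (rule arg_cong)
    thus "of_nat n * \<psi> g = (\<Sum>(P, j) | (P, j) \<in> I \<and> P ^ j dvd g. of_nat (degree P) * \<psi> g)"
      by (simp add: case_prod_unfold sum_distrib_right)
  qed (rule refl)
  also have "\<dots> = (\<Sum>g\<in>monic_polys n. \<Sum>(P, j)\<in>I. if P ^ j dvd g then of_nat (degree P) * \<psi> g else 0)"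
    by (intro sum.cong refl sum.mono_neutral_cong_left finI) (auto simp: case_prod_unfold)
  also have "\<dots> = (\<Sum>(P, j)\<in>I. \<Sum>g\<in>monic_polys n. if P ^ j dvd g then of_nat (degree P) * \<psi> g else 0)"
    unfolding case_prod_unfold by (rule sum.swap)
  also have "\<dots> = (\<Sum>(P, j)\<in>I. of_nat (degree P) * \<psi> P ^ j * S (n - j * degree P))"
  proof (rule sum.cong, safe)
    fix P j assume "(P, j) \<in> I"
    hence P: "prime P" "j > 0" "j * degree P \<le> n" by (auto simp: I_def)
    note Pm = prime_poly_monic[OF P(1)]
    have bij: "bij_betw (\<lambda>g. P ^ j * g) (monic_polys (n - j * degree P)) {g \<in> monic_polys n. P ^ j dvd g}"
    proof (rule bij_betw_imageI)
      show "inj_on (\<lambda>g. P ^ j * g) (monic_polys (n - j * degree P))"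
        using Pm(4) by (auto intro!: inj_onI)
      show "(\<lambda>g. P ^ j * g) ` monic_polys (n - j * degree P) = {g \<in> monic_polys n. P ^ j dvd g}"
        using monic_polys_mult_iff[OF monic_polys_power[OF Pm(1)], of j _ n] P(3) by (auto elim!: dvdE)
    qed
    have "(\<Sum>g\<in>monic_polys n. if P ^ j dvd g then of_nat (degree P) * \<psi> g else 0) =
        (\<Sum>g | g \<in> monic_polys n \<and> P ^ j dvd g. of_nat (degree P) * \<psi> g)"
      by (intro sum.mono_neutral_cong_right finite_monic_polys) auto
    also have "\<dots> = (\<Sum>g\<in>monic_polys (n - j * degree P). of_nat (degree P) * \<psi> (P ^ j * g))"
      by (rule sum.reindex_bij_betw[OF bij, symmetric])
    finally show "(\<Sum>g\<in>monic_polys n. if P ^ j dvd g then of_nat (degree P) * \<psi> g else 0) =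
        of_nat (degree P) * \<psi> P ^ j * S (n - j * degree P)"
      by (simp add: mult pow S_def sum_distrib_left mult_ac)
  qed
  also have "\<dots> = (\<Sum>(k, P)\<in>Sigma {1..n} (\<lambda>k. {P. prime P \<and> degree P dvd k}).
      of_nat (degree P) * \<psi> P ^ (k div degree P) * S (n - k))"
    by (rule sum.reindex_bij_witness[of _ "\<lambda>(k, P). (P, k div degree P)" "\<lambda>(P, j). (j * degree P, P)"])
       (auto simp: I_def prime_poly_monic Suc_le_eq intro: dvd_div_mult_self)
  also have "\<dots> = (\<Sum>k=1..n. \<Sum>P | prime P \<and> degree P dvd k. of_nat (degree P) * \<psi> P ^ (k div degree P) * S (n - k))"
    by (intro sum.Sigma[symmetric]) (auto intro!: finite_prime_polys_dvd)
  finally show ?thesis by (simp add: S_def mangoldt_sum_def sum_distrib_right)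
qed

text \<open>For \<psi> = 1 the L-series has the coefficients q^n, and the recursion can be solved
  for its last term. In effect the elements of the field with q^n elements are counted by their
  minimal polynomials.\<close>

lemma sum_degree_prime_polys:
  assumes "n > 0"
  shows "(\<Sum>P :: 'a :: {finite, field_gcd} poly | prime P \<and> degree P dvd n. degree P) = CARD('a) ^ n"
  using assms
proof (induction n rule: less_induct)
  case (less n)
  let ?L = "\<lambda>n. mangoldt_sum (\<lambda>_ :: 'a poly. 1) n" and ?q = "of_nat (CARD('a)) :: complex"
  have eq: "?L k = of_nat (\<Sum>P :: 'a poly | prime P \<and> degree P dvd k. degree P)" for k
    by (simp add: mangoldt_sum_def)
  have "of_nat n * ?q ^ n = (\<Sum>k=1..n. ?L k * ?q ^ (n - k))"
    using euler_product_recursion[of "\<lambda>_ :: 'a poly. 1" n] by (simp add: card_monic_polys)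
  also have "{1..n} = insert n {1..<n}" using less.prems by auto
  also have "(\<Sum>k\<in>\<dots>. ?L k * ?q ^ (n - k)) = ?L n + (\<Sum>k=1..<n. ?L k * ?q ^ (n - k))"
    by simp
  also have "(\<Sum>k=1..<n. ?L k * ?q ^ (n - k)) = (\<Sum>k=1..<n. ?q ^ n)"
  proof (rule sum.cong)
    fix k assume k: "k \<in> {1..<n}"
    hence "?L k = ?q ^ k" unfolding eq using less.IH[of k] by simp
    thus "?L k * ?q ^ (n - k) = ?q ^ n" using k by (simp flip: power_add)
  qed simp
  also have "\<dots> = (of_nat n - 1) * ?q ^ n" using less.prems by (simp add: of_nat_diff)
  finally have "?L n = ?q ^ n" by (simp add: algebra_simps)
  thus ?case unfolding eq by (metis of_nat_eq_iff of_nat_power)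
qed

section \<open>The Weil bound\<close>

text \<open>Only \<open>a1\<close> has a prescribed exponent. A simple zero of the polynomial inside
  \<open>chi\<close> makes the sums over monic polynomials of large degree vanish, and it gives the
  terms in the Stepanov argument distinct orders.\<close>

locale weil_character_sum =
  fixes chi :: "'a :: prime_card mod_ring \<Rightarrow> complex" and A :: "'a mod_ring set"
    and e :: "'a mod_ring \<Rightarrow> nat" and a1 :: "'a mod_ring"
  assumes chi_mult: "chi (x * y) = chi x * chi y" and chi_0: "chi 0 = 0" and chi_1: "chi 1 = 1"
    and norm_chi: "norm (chi x) \<le> 1" and chi_nontrivial: "\<exists>y. y \<noteq> 0 \<and> chi y \<noteq> 1"
    and a1: "a1 \<in> A" "e a1 = 1" and card_ge_3: "CARD('a) \<ge> 3"
begin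

lemma chi_power: "chi (x ^ n) = chi x ^ n"
  by (induction n) (simp_all add: chi_1 chi_mult)

lemma sum_chi: "(\<Sum>x\<in>UNIV. chi x) = 0"
proof -
  obtain y where y: "y \<noteq> 0" "chi y \<noteq> 1" using chi_nontrivial by blast
  have "(\<Sum>x\<in>UNIV. chi x) = (\<Sum>x\<in>UNIV. chi (y * x))"
    by (rule sum.reindex_bij_witness[of _ "\<lambda>x. y * x" "\<lambda>x. x / y"]) (use y in auto)
  also have "\<dots> = chi y * (\<Sum>x\<in>UNIV. chi x)" by (simp only: chi_mult sum_distrib_left)
  finally have "(1 - chi y) * (\<Sum>x\<in>UNIV. chi x) = 0" by (simp add: algebra_simps)
  thus ?thesis using y by simp
qed

text \<open>Chosen such that X - x receives the summand at \<open>x\<close> of the sum to be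
  bounded. Evaluating \<open>g\<close> at the points of \<open>A\<close>, rather than the given
  polynomial at the zeros of \<open>g\<close>, makes \<psi> completely multiplicative at
  once.\<close>

definition \<psi> :: "'a mod_ring poly \<Rightarrow> complex" where
  "\<psi> g = chi (\<Prod>a\<in>A. poly g a ^ e a)"

lemma \<psi>_mult: "\<psi> (f * g) = \<psi> f * \<psi> g"
  by (simp add: \<psi>_def power_mult_distrib prod.distrib chi_mult)

lemma \<psi>_1: "\<psi> 1 = 1"
  by (simp add: \<psi>_def chi_1)

lemma finite_A: "finite A" by simp

text \<open>
  Adding multiples of \<open>l\<close> to a polynomial moves its value at \<open>a1\<close> through all of the field and
  keeps its values at the other points of \<open>A\<close>.
\<close>
lemma sum_\<psi>_monic_eq_0:
  assumes n: "n \<ge> card A"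
  shows "(\<Sum>g\<in>monic_polys n. \<psi> g) = 0"
proof -
  define l where "l = (\<Prod>a\<in>A - {a1}. [:-a, 1:])"
  have "card A > 0" using a1 by (simp add: card_gt_0_iff finite_A) blast
  have "degree l = (\<Sum>a\<in>A - {a1}. degree [:-a, 1:])"
    unfolding l_def by (rule degree_prod_eq_sum_degree) simp
  hence degl: "degree l < n" using n \<open>card A > 0\<close> a1 by simp
  have l1: "poly l a1 \<noteq> 0" by (simp add: l_def poly_prod)
  have l0: "poly l a = 0" if "a \<in> A - {a1}" for a
    using that unfolding l_def poly_prod by (intro prod_zero) auto
  have shift: "(\<Sum>g\<in>monic_polys n. \<psi> g) = (\<Sum>g\<in>monic_polys n. \<psi> (g + smult c l))" for c
  proof (rule sum.reindex_bij_witness[of _ "\<lambda>g. g + smult c l" "\<lambda>g. g - smult c l"])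
    have *: "g + smult b l \<in> monic_polys n" if "g \<in> monic_polys n" for g b
    proof -
      have g: "degree g = n" "coeff g n = 1" using that by (auto simp: monic_polys_def)
      have d: "degree (smult b l) < n" using degl degree_smult_le[of b l] by simp
      hence "degree (g + smult b l) = n" using g degree_add_eq_left[of "smult b l" g] by simp
      moreover have "coeff (g + smult b l) n = 1" using g d by (simp add: coeff_eq_0[OF degl])
      ultimately show ?thesis unfolding monic_polys_def by simp
    qed
    show "g - smult c l \<in> monic_polys n" if "g \<in> monic_polys n" for g
      using *[OF that, of "-c"] by simp
    show "g + smult c l \<in> monic_polys n" if "g \<in> monic_polys n" for g
      using *[OF that, of c] .
  qed auto
  have "of_nat CARD('a) * (\<Sum>g\<in>monic_polys n. \<psi> g) = (\<Sum>c\<in>(UNIV :: 'a mod_ring set). \<Sum>g\<in>monic_polys n. \<psi> (g + smult c l))"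
    by (simp flip: shift)
  also have "\<dots> = (\<Sum>g\<in>monic_polys n. \<Sum>c\<in>UNIV. \<psi> (g + smult c l))"
    by (rule sum.swap)
  also have "\<dots> = 0"
  proof (rule sum.neutral, rule ballI)
    fix g :: "'a mod_ring poly"
    define b where "b = (\<Prod>a\<in>A - {a1}. poly g a ^ e a)"
    have "\<psi> (g + smult c l) = chi (poly g a1 + c * poly l a1) * chi b" for c
    proof -
      have "(\<Prod>a\<in>A - {a1}. poly (g + smult c l) a ^ e a) = b"
        unfolding b_def by (rule prod.cong) (simp_all add: l0)
      thus ?thesis using a1 unfolding \<psi>_def by (simp add: prod.remove[OF finite_A a1(1)] chi_mult)
    qed
    hence "(\<Sum>c\<in>UNIV. \<psi> (g + smult c l)) = (\<Sum>c\<in>UNIV. chi (poly g a1 + c * poly l a1)) * chi b"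
      by (simp add: sum_distrib_right)
    also have "(\<Sum>c\<in>UNIV. chi (poly g a1 + c * poly l a1)) = (\<Sum>x\<in>UNIV. chi x)"
      by (rule sum.reindex_bij_witness[of _ "\<lambda>x. (x - poly g a1) / poly l a1" "\<lambda>c. poly g a1 + c * poly l a1"])
         (use l1 in auto)
    finally show "(\<Sum>c\<in>UNIV. \<psi> (g + smult c l)) = 0" by (simp add: sum_chi)
  qed
  finally show ?thesis by simp
qed

lemma sum_\<psi>_monic_1: "(\<Sum>g\<in>monic_polys 1. \<psi> g) = (\<Sum>x\<in>UNIV. chi (\<Prod>a\<in>A. (a - x) ^ e a))"
proof -
  have monic1: "[:coeff g 0, 1:] = g" if "degree g = Suc 0" "coeff g (Suc 0) = 1" for g :: "'a mod_ring poly"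
    using that by (intro poly_eqI) (auto simp: coeff_pCons coeff_eq_0 split: nat.splits)
  have "(\<Sum>x\<in>UNIV. chi (\<Prod>a\<in>A. (a - x) ^ e a)) = (\<Sum>x\<in>UNIV. \<psi> [:-x, 1:])"
    by (simp add: \<psi>_def)
  also have "\<dots> = (\<Sum>g\<in>monic_polys 1. \<psi> g)"
    by (rule sum.reindex_bij_witness[of _ "\<lambda>g. - coeff g 0" "\<lambda>x. [:-x, 1:]"])
       (auto simp: monic_polys_def monic1)
  finally show ?thesis ..
qed

section \<open>Elements of extension fields, classified by the norm of \<open>F\<close>\<close>

definition F :: "'a mod_ring poly" where "F = (\<Prod>a\<in>A. [:a, -1:] ^ e a)"

text \<open>If deg(P) divides \<open>n\<close>, this is the norm of F(x) from the field with p^n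
  elements, for every root x of the monic irreducible \<open>P\<close>.\<close>

definition norm_value :: "nat \<Rightarrow> 'a mod_ring poly \<Rightarrow> 'a mod_ring" where
  "norm_value n P = (\<Prod>a\<in>A. poly P a ^ e a) ^ (n div degree P)"

text \<open>The number of elements x of the field with p^n elements for which the norm of F(x) is
  \<open>c\<close>, counted through their minimal polynomials.\<close>

definition class_degree :: "nat \<Rightarrow> 'a mod_ring \<Rightarrow> nat" where
  "class_degree n c = (\<Sum>P | prime P \<and> degree P dvd n \<and> norm_value n P = c. degree P)"

lemma norm_value_eq:
  assumes P: "prime P" "degree P dvd n" and x: "ac_eval P x = 0"
  shows "ac_eval F x ^ norm_exp (CARD('a)) n = to_ac (norm_value n P)"
proof -
  note Pm = prime_poly_monic[OF P(1)]
  define k where "k = n div degree P"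
  have n: "n = degree P * k" using P(2) by (simp add: k_def)
  have "ac_eval F x ^ norm_exp (CARD('a)) n = (\<Prod>a\<in>A. ((to_ac a - x) ^ norm_exp (CARD('a)) n) ^ e a)"
    unfolding F_def ac_eval_prod by (simp add: prod_power_distrib mult.commute flip: power_mult)
  also have "\<dots> = (\<Prod>a\<in>A. to_ac (poly P a ^ k) ^ e a)"
    by (intro prod.cong refl arg_cong[of _ _ "\<lambda>y. y ^ _"] irreducible_poly_eval_power_eq_norm[OF Pm(2) x Pm(1) n])
  also have "\<dots> = to_ac (norm_value n P)"
    by (simp add: norm_value_def k_def to_ac_prod prod_power_distrib mult.commute flip: power_mult)
  finally show ?thesis .
qed

text \<open>Each prime polynomial of the class contributes its deg(P) roots to the set counted by
  Stepanov's method, and different primes have no common root.\<close>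

lemma class_degree_bound:
  assumes l: "l \<ge> 1" and c: "c \<noteq> 0"
  shows "(CARD('a) - 1) * class_degree (2 * l) c
           \<le> CARD('a) ^ (2 * l) + (3 * CARD('a) * degree F + 4 * CARD('a) + 1) * CARD('a) ^ l"
proof -
  let ?p = "CARD('a)"
  define S where "S = {P :: 'a mod_ring poly. prime P \<and> degree P dvd 2 * l \<and> norm_value (2 * l) P = c}"
  define R where "R = (\<lambda>P :: 'a mod_ring poly. {x. ac_eval P x = 0})"
  define Y where "Y = {x. x ^ (?p ^ (2 * l)) = x \<and> ac_eval F x ^ norm_exp ?p (2 * l) = to_ac c}"
  have finS: "finite S"
    by (rule finite_subset[OF _ finite_prime_polys_dvd[of "2 * l"]]) (use l in \<open>auto simp: S_def\<close>)
  have "finite {x :: 'a mod_ring alg_closure. poly (monom 1 (?p ^ (2 * l)) - monom 1 1) x = 0}"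
  proof (rule poly_roots_finite, rule notI)
    assume "monom 1 (?p ^ (2 * l)) - monom 1 1 = (0 :: 'a mod_ring alg_closure poly)"
    hence "?p ^ (2 * l) = 1" by (simp add: monom_eq_iff')
    thus False using l card_ge_3 by simp
  qed
  hence finY: "finite Y" by (rule rev_finite_subset) (auto simp: Y_def poly_monom)
  have root: "\<exists>x. x \<in> R P" if "P \<in> S" for P
    using that prime_poly_monic(3)[of P] alg_closed_imp_poly_has_root[of "map_poly to_ac P"]
    by (auto simp: S_def R_def ac_eval_def)
  have cardR: "finite (R P) \<and> card (R P) = degree P" if PS: "P \<in> S" for P
  proof -
    obtain x where x: "ac_eval P x = 0" using root[OF PS] by (auto simp: R_def)
    have "card (R P) = degree P"
      unfolding R_def using that by (intro card_roots_irreducible[OF _ x] prime_poly_monic) (simp add: S_def)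
    moreover have "degree P > 0" using that by (simp add: S_def prime_poly_monic)
    ultimately show ?thesis by (metis card.infinite less_numeral_extra(3))
  qed
  have RY: "R P \<subseteq> Y" if "P \<in> S" for P
  proof
    fix x assume x: "x \<in> R P"
    have P: "prime P" "degree P dvd 2 * l" "norm_value (2 * l) P = c" using that by (auto simp: S_def)
    have x0: "ac_eval P x = 0" using x by (simp add: R_def)
    have "x ^ (?p ^ (degree P * (2 * l div degree P))) = x"
      by (rule frobenius_power_multiple[OF prime_poly_monic(2)[OF P(1)] x0])
    thus "x \<in> Y" using norm_value_eq[OF P(1,2) x0] P(2,3) by (simp add: Y_def)
  qed
  have disj: "R P \<inter> R P' = {}" if "P \<in> S" "P' \<in> S" "P \<noteq> P'" for P P'
  proof (rule ccontr)
    assume "R P \<inter> R P' \<noteq> {}"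
    then obtain x where x: "ac_eval P x = 0" "ac_eval P' x = 0" by (auto simp: R_def)
    have P: "prime P" "prime P'" using that by (auto simp: S_def)
    have "P dvd P'" using x P by (intro irreducible_dvd_of_common_root prime_poly_monic)
    thus False using P that(3) primes_dvd_imp_eq by blast
  qed
  have "class_degree (2 * l) c = (\<Sum>P\<in>S. card (R P))"
    using cardR by (simp add: class_degree_def S_def)
  also have "\<dots> = card (\<Union>P\<in>S. R P)"
    by (rule card_UN_disjoint[symmetric]) (use finS cardR disj in auto)
  also have "\<dots> \<le> card Y" by (rule card_mono[OF finY]) (use RY in auto)
  finally have "(?p - 1) * class_degree (2 * l) c \<le> (?p - 1) * card Y" by (rule mult_le_mono2)
  also have "\<dots> \<le> ?p ^ (2 * l) + (3 * ?p * degree F + 4 * ?p + 1) * ?p ^ l"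
    unfolding Y_def
  proof (rule stepanov_bound[OF _ _ card_ge_3 c l])
    show "F = [:a1, -1:] * (\<Prod>a\<in>A - {a1}. [:a, -1:] ^ e a)"
      unfolding F_def prod.remove[OF finite_A a1(1)] a1(2) by simp
    show "poly (\<Prod>a\<in>A - {a1}. [:a, -1:] ^ e a) a1 \<noteq> 0" by (simp add: poly_prod)
  qed
  finally show ?thesis .
qed

text \<open>Norm value 0 means P(a) = 0 for some \<open>a\<close> in \<open>A\<close>, and then the
  prime \<open>P\<close> is X - a.\<close>

lemma class_degree_0_le:
  assumes "n > 0"
  shows "class_degree n 0 \<le> card A"
proof -
  define S where "S = {P :: 'a mod_ring poly. prime P \<and> degree P dvd n \<and> norm_value n P = 0}"
  have S: "\<exists>a\<in>A. P = [:-a, 1:]" if "P \<in> S" for P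
  proof -
    have P: "prime P" "norm_value n P = 0" using that by (auto simp: S_def)
    hence "(\<Prod>a\<in>A. poly P a ^ e a) = 0" unfolding norm_value_def by (metis power_not_zero)
    then obtain a where a: "a \<in> A" "poly P a = 0" by auto
    hence "[:-a, 1:] dvd P" by (simp add: poly_eq_0_iff_dvd)
    moreover have "prime [:-a, 1:]"
      by (intro prime_polyI irreducible_linear_poly) auto
    ultimately show ?thesis using P(1) a(1) primes_dvd_imp_eq by blast
  qed
  have "class_degree n 0 = (\<Sum>P\<in>S. degree P)" by (simp add: class_degree_def S_def)
  also have "\<dots> = (\<Sum>P\<in>S. 1)" by (intro sum.cong refl) (auto dest!: S)
  also have "\<dots> = card S" by simp
  also have "\<dots> \<le> card ((\<lambda>a. [:-a, 1:]) ` A)" by (rule card_mono) (auto dest!: S)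
  also have "\<dots> \<le> card A" by (rule card_image_le) simp
  finally show ?thesis .
qed

text \<open>Stepanov's method yields one upper bound \<open>B\<close> for all classes c \<noteq> 0,
  and no lower bound. As the values of \<open>chi\<close> sum to 0, \<open>B\<close> may be
  subtracted from every class size; the deficits are then nonnegative, and their sum is known
  because all classes together have p^(2 l) elements. The main terms cancel in it.\<close>

lemma mangoldt_sum_bound:
  assumes l: "l \<ge> 1"
  shows "norm (mangoldt_sum \<psi> (2 * l))
           \<le> real (3 * CARD('a) * degree F + 4 * CARD('a) + 1 + card A) * sqrt CARD('a) ^ (2 * l)"
proof -
  let ?p = "CARD('a)" and ?S = "{P :: 'a mod_ring poly. prime P \<and> degree P dvd 2 * l}"
  let ?N = "class_degree (2 * l)"
  define C where "C = 3 * ?p * degree F + 4 * ?p + 1"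
  define B where "B = (real ?p ^ (2 * l) + C * real ?p ^ l) / (real ?p - 1)"
  have finS: "finite ?S" by (rule finite_prime_polys_dvd) (use l in simp)
  have p1: "real ?p - 1 > 0" using card_ge_3 by simp
  have "mangoldt_sum \<psi> (2 * l) = (\<Sum>P\<in>?S. of_nat (degree P) * chi (norm_value (2 * l) P))"
    by (simp add: mangoldt_sum_def \<psi>_def norm_value_def chi_power)
  also have "\<dots> = (\<Sum>c\<in>UNIV. \<Sum>P | P \<in> ?S \<and> norm_value (2 * l) P = c. of_nat (degree P) * chi (norm_value (2 * l) P))"
    by (rule sum.group[symmetric]) (use finS in auto)
  also have "\<dots> = (\<Sum>c\<in>UNIV. of_nat (?N c) * chi c)"
    by (intro sum.cong refl) (simp add: class_degree_def sum_distrib_right conj_assoc)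
  also have "\<dots> = (\<Sum>c\<in>UNIV. of_nat (?N c) * chi c) - of_real B * (\<Sum>c\<in>UNIV. chi c)"
    by (simp add: sum_chi)
  also have "\<dots> = (\<Sum>c\<in>UNIV. (of_nat (?N c) - of_real B) * chi c)"
    by (simp add: sum_distrib_left sum_subtractf algebra_simps)
  also have "\<dots> = (\<Sum>c\<in>UNIV - {0}. (of_nat (?N c) - of_real B) * chi c)"
    by (rule sum.mono_neutral_right) (auto simp: chi_0)
  also have "norm \<dots> \<le> (\<Sum>c\<in>UNIV - {0}. B - real (?N c))"
  proof (rule sum_norm_le)
    fix c :: "'a mod_ring" assume c: "c \<in> UNIV - {0}"
    have "real ((?p - 1) * ?N c) \<le> real (?p ^ (2 * l) + C * ?p ^ l)"
      unfolding C_def of_nat_le_iff by (rule class_degree_bound) (use l c in auto)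
    hence "(real ?p - 1) * real (?N c) \<le> real ?p ^ (2 * l) + C * real ?p ^ l"
      using card_ge_3 by (simp add: of_nat_diff)
    hence le: "real (?N c) \<le> B" unfolding B_def using p1 by (simp add: pos_le_divide_eq mult.commute)
    have "norm ((of_nat (?N c) - of_real B) * chi c) \<le> norm (of_nat (?N c) - of_real B :: complex) * 1"
      unfolding norm_mult by (intro mult_left_mono norm_chi norm_ge_zero)
    also have "of_nat (?N c) - of_real B = (of_real (real (?N c) - B) :: complex)" by simp
    also have "norm \<dots> = B - real (?N c)" unfolding norm_of_real using le by simp
    finally show "norm ((of_nat (?N c) - of_real B) * chi c) \<le> B - real (?N c)" by simp
  qed
  also have "\<dots> = (real ?p - 1) * B - (\<Sum>c\<in>UNIV - {0}. real (?N c))"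
    using card_ge_3 by (simp add: sum_subtractf card_Diff_singleton of_nat_diff)
  also have "(real ?p - 1) * B = real ?p ^ (2 * l) + C * real ?p ^ l"
    unfolding B_def using p1 by simp
  also have "(\<Sum>c\<in>UNIV - {0}. real (?N c)) = real (\<Sum>c\<in>UNIV. ?N c) - real (?N 0)"
    by (simp add: sum.remove[of UNIV 0])
  also have "(\<Sum>c\<in>UNIV. ?N c) = (\<Sum>c\<in>UNIV. \<Sum>P | P \<in> ?S \<and> norm_value (2 * l) P = c. degree P)"
    by (simp add: class_degree_def conj_assoc)
  also have "\<dots> = (\<Sum>P\<in>?S. degree P)"
    by (rule sum.group) (use finS in auto)
  also have "\<dots> = ?p ^ (2 * l)" using sum_degree_prime_polys[of "2 * l", where ?'a = "'a mod_ring"] l by simp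
  finally have "norm (mangoldt_sum \<psi> (2 * l)) \<le> C * real ?p ^ l + real (?N 0)"
    by simp
  also have "real (?N 0) \<le> real (card A) * real ?p ^ l"
  proof -
    have "real (?N 0) \<le> real (card A) * 1" using class_degree_0_le[of "2 * l"] l by simp
    also have "\<dots> \<le> real (card A) * real ?p ^ l"
      using card_ge_3 by (intro mult_left_mono one_le_power) auto
    finally show ?thesis .
  qed
  also have "C * real ?p ^ l + real (card A) * real ?p ^ l = real (C + card A) * sqrt ?p ^ (2 * l)"
  proof -
    have "sqrt ?p ^ (2 * l) = real ?p ^ l" unfolding power_mult by simp
    thus ?thesis by (simp add: algebra_simps)
  qed
  finally show ?thesis unfolding C_def by simp
qed

text \<open>The sum is the coefficient of T in an L-series that is a polynomial of degree below
  \<open>card A\<close>. The large factor in the bound for \<open>mangoldt_sum\<close> does not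
  depend on \<open>l\<close> and therefore leaves no trace.\<close>

theorem weil_bound: "norm (\<Sum>x\<in>UNIV. chi (\<Prod>a\<in>A. (a - x) ^ e a)) \<le> real (card A - 1) * sqrt CARD('a)"
  unfolding sum_\<psi>_monic_1[symmetric]
proof (rule newton_recursion_bound[where \<Lambda> = "mangoldt_sum \<psi>"])
  show "of_nat n * (\<Sum>g\<in>monic_polys n. \<psi> g) =
           (\<Sum>k=1..n. mangoldt_sum \<psi> k * (\<Sum>g\<in>monic_polys (n - k). \<psi> g))" for n
    by (rule euler_product_recursion[OF \<psi>_mult \<psi>_1])
  show "norm (mangoldt_sum \<psi> (2 * l))
           \<le> real (3 * CARD('a) * degree F + 4 * CARD('a) + 1 + card A) * sqrt CARD('a) ^ (2 * l)"
    if "l \<ge> 1" for l using mangoldt_sum_bound[OF that] .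
qed (simp_all add: monic_polys_0 \<psi>_1 sum_\<psi>_monic_eq_0)

end

section \<open>Dirichlet characters on the integers, and the Weil bound for them\<close>

lemma dirichlet_characterD:
  assumes "dirichlet_character q chi"
  shows "[x = y] (mod int q) \<Longrightarrow> chi x = chi y" "chi (x * y) = chi x * chi y"
    "chi x = 0 \<longleftrightarrow> \<not> coprime x (int q)" "chi 1 = 1"
proof -
  show mult: "chi (x * y) = chi x * chi y" for x y
    using assms by (auto simp: dirichlet_character_def)
  show z: "chi x = 0 \<longleftrightarrow> \<not> coprime x (int q)" for x
    using assms by (auto simp: dirichlet_character_def)
  show "[x = y] (mod int q) \<Longrightarrow> chi x = chi y"
    using assms by (auto simp: dirichlet_character_def)
  have "chi 1 * chi 1 = chi 1 * 1" "chi 1 \<noteq> 0" using mult[of 1 1] z[of 1] by auto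
  thus "chi 1 = 1" unfolding mult_cancel_left by blast
qed

lemma dirichlet_character_power:
  assumes "dirichlet_character q chi"
  shows "chi (x ^ n) = chi x ^ n"
  by (induction n) (simp_all add: dirichlet_characterD[OF assms])

lemma dirichlet_character_prod:
  assumes "dirichlet_character q chi"
  shows "chi (\<Prod>i\<in>I. f i) = (\<Prod>i\<in>I. chi (f i))"
  by (induction I rule: infinite_finite_induct) (simp_all add: dirichlet_characterD[OF assms])

lemma dirichlet_character_power_totient:
  assumes chi: "dirichlet_character q chi" and q: "q > 0" and x: "chi x \<noteq> 0"
  shows "chi x ^ totient q = 1"
proof -
  define y where "y = nat (x mod int q)"
  have y: "int y = x mod int q" using q by (simp add: y_def)
  have "coprime x (int q)" using x dirichlet_characterD(3)[OF chi] by blast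
  hence "coprime y q" using q by (simp add: y flip: coprime_int_iff)
  hence "[y ^ totient q = 1] (mod q)" by (rule euler_theorem)
  hence "[int y ^ totient q = 1] (mod int q)" by (metis cong_int_iff of_nat_1 of_nat_power)
  moreover have "[int y = x] (mod int q)" by (simp add: y)
  ultimately have "[x ^ totient q = 1] (mod int q)"
    by (meson cong_pow cong_sym cong_trans)
  hence "chi (x ^ totient q) = chi 1" by (rule dirichlet_characterD(1)[OF chi])
  thus ?thesis by (simp add: dirichlet_character_power[OF chi] dirichlet_characterD(4)[OF chi])
qed

lemma norm_dirichlet_character:
  assumes chi: "dirichlet_character q chi" and q: "q > 0"
  shows "norm (chi x) = (if chi x = 0 then 0 else 1)"
proof (cases "chi x = 0")
  case False
  have "norm (chi x) ^ totient q = 1"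
    using dirichlet_character_power_totient[OF chi q False] by (metis norm_one norm_power)
  hence "norm (chi x) = 1"
    using q by (intro power_eq_imp_eq_base[of "norm (chi x)" "totient q" 1]) auto
  thus ?thesis using False by simp
qed simp

lemma norm_dirichlet_character_le:
  "dirichlet_character q chi \<Longrightarrow> q > 0 \<Longrightarrow> norm (chi x) \<le> 1"
  by (simp add: norm_dirichlet_character)

text \<open>The nonzero values are roots of unity of order dividing p - 1, so conjugation is
  inversion, that is the power p - 2. A product of values of \<open>chi\<close> and their conjugates
  thereby becomes a value of \<open>chi\<close> at one polynomial.\<close>

lemma cnj_dirichlet_character:
  assumes chi: "dirichlet_character p chi" and p: "prime p" "p \<ge> 3"
  shows "cnj (chi x) = chi (x ^ (p - 2))"
proof (cases "chi x = 0")
  case False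
  have "chi x ^ (p - 2) * chi x = chi x ^ totient p"
  proof -
    have "totient p = Suc (p - 2)" using p by (simp add: totient_prime)
    thus ?thesis by (simp only: power_Suc2)
  qed
  also have "\<dots> = 1" using p by (intro dirichlet_character_power_totient[OF chi _ False]) (simp add: prime_gt_0_nat)
  also have "1 = cnj (chi x) * chi x"
    using norm_dirichlet_character[OF chi, of x] False p
    by (simp add: complex_norm_square[symmetric] mult.commute prime_gt_0_nat)
  finally show ?thesis using False by (simp add: dirichlet_character_power[OF chi])
next
  case True
  thus ?thesis using p by (simp add: dirichlet_character_power[OF chi])
qed

text \<open>
  There is no type of cardinality \<open>p\<close> for a variable prime \<open>p\<close>. Instead, a type is built whose
  cardinality is a counterexample to the Weil bound whenever a counterexample exists; the bound,
  proved for this type, then refutes the existence of counterexamples.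
\<close>

definition weil_bound_at :: "nat \<Rightarrow> bool" where
  "weil_bound_at p \<longleftrightarrow> (\<forall>chi A e a1. nontrivial_character p chi \<longrightarrow> A \<subseteq> {0..<int p} \<longrightarrow> a1 \<in> A \<longrightarrow>
     e a1 = 1 \<longrightarrow> norm (\<Sum>x\<in>{0..<int p}. chi (\<Prod>a\<in>A. (a + x) ^ e a)) \<le> real (card A - 1) * sqrt p)"

text \<open>The default 3 gives the type below a prime cardinality also when there is no
  counterexample.\<close>

definition exceptional_prime :: nat where
  "exceptional_prime = (if \<exists>p. prime p \<and> p \<ge> 3 \<and> \<not> weil_bound_at p
     then SOME p. prime p \<and> p \<ge> 3 \<and> \<not> weil_bound_at p else 3)"

lemma exceptional_prime: "prime exceptional_prime" "exceptional_prime \<ge> 3"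
proof -
  have *: "prime exceptional_prime \<and> exceptional_prime \<ge> 3"
  proof (cases "\<exists>p. prime p \<and> p \<ge> 3 \<and> \<not> weil_bound_at p")
    case True
    thus ?thesis using someI_ex[OF True] by (simp add: exceptional_prime_def)
  next
    case False
    thus ?thesis by (simp only: exceptional_prime_def if_False) simp
  qed
  thus "prime exceptional_prime" "exceptional_prime \<ge> 3" by auto
qed

typedef exceptional_index = "{..<exceptional_prime}"
  using exceptional_prime(2) by (intro exI[of _ 0]) simp

lemma card_exceptional_index: "CARD(exceptional_index) = exceptional_prime"
  using type_definition.card[OF type_definition_exceptional_index] by simp

instance exceptional_index :: prime_card
  by standard (simp add: card_exceptional_index exceptional_prime)

lemma weil_bound_at_card:
  assumes "CARD('a :: prime_card) = p" "p \<ge> 3"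
  shows "weil_bound_at p"
  unfolding weil_bound_at_def
proof (intro allI impI)
  fix chi :: "int \<Rightarrow> complex" and A :: "int set" and e :: "int \<Rightarrow> nat" and a1 :: int
  assume nontriv: "nontrivial_character p chi" and A: "A \<subseteq> {0..<int p}" and a1: "a1 \<in> A" "e a1 = 1"
  have chi: "dirichlet_character p chi" using nontriv by (simp add: nontrivial_character_def)
  have p: "prime p" using assms(1) prime_card[where ?'a = 'a] by simp
  note chiD = dirichlet_characterD[OF chi]
  let ?chi = "\<lambda>x :: 'a mod_ring. chi (to_int_mod_ring x)" and ?A = "of_int ` A :: 'a mod_ring set"
  let ?e = "\<lambda>x :: 'a mod_ring. e (to_int_mod_ring x)"
  have to_int: "to_int_mod_ring (of_int n :: 'a mod_ring) = n mod int p" for n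
    unfolding of_int_of_int_mod_ring assms(1)[symmetric] by transfer simp
  have of_int: "?chi (of_int n) = chi n" for n
    unfolding to_int by (rule chiD(1)) simp
  have to_int_A: "to_int_mod_ring (of_int a :: 'a mod_ring) = a" if "a \<in> A" for a
    using that A by (auto simp: to_int)
  have of_to: "of_int (to_int_mod_ring x) = x" for x :: "'a mod_ring"
    by (simp add: of_int_of_int_mod_ring)
  interpret weil_character_sum ?chi ?A ?e "of_int a1"
  proof
    fix x y :: "'a mod_ring"
    show "?chi (x * y) = ?chi x * ?chi y"
      using of_int[of "to_int_mod_ring x * to_int_mod_ring y"] by (simp add: of_to chiD(2))
    show "norm (?chi x) \<le> 1" using p by (intro norm_dirichlet_character_le[OF chi] prime_gt_0_nat)
    show "?chi 0 = 0" using p by (simp add: chiD(3) prime_gt_1_nat) (use assms in auto)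
    show "?chi 1 = 1" by (simp add: chiD(4))
    have "\<exists>y. coprime y (int p) \<and> chi y \<noteq> 1"
    proof (rule ccontr)
      assume "\<not> ?thesis"
      hence "chi y = principal_character p y" for y
        using chiD(3)[of y] by (auto simp: principal_character_def)
      thus False using nontriv by (auto simp: nontrivial_character_def)
    qed
    then obtain y where y: "coprime y (int p)" "chi y \<noteq> 1" by blast
    have "of_int y \<noteq> (0 :: 'a mod_ring)"
      using y(1) of_int[of y] chiD(3)[of y] \<open>?chi 0 = 0\<close> by auto
    thus "\<exists>y. y \<noteq> 0 \<and> ?chi y \<noteq> 1" using y(2) of_int[of y] by metis
    show "of_int a1 \<in> ?A" using a1 by simp
    show "?e (of_int a1) = 1" using a1 by (simp add: to_int_A)
    show "3 \<le> CARD('a)" using assms by simp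
  qed
  have inj: "inj_on (of_int :: int \<Rightarrow> 'a mod_ring) A" by (metis inj_onI to_int_A)
  have "(\<Sum>x\<in>{0..<int p}. chi (\<Prod>a\<in>A. (a + x) ^ e a)) = (\<Sum>x\<in>UNIV. ?chi (\<Prod>a\<in>?A. (a + x) ^ ?e a))"
  proof (rule sum.reindex_bij_witness[of _ to_int_mod_ring "of_int :: int \<Rightarrow> 'a mod_ring"])
    fix x assume "x \<in> {0..<int p}"
    thus "to_int_mod_ring (of_int x :: 'a mod_ring) = x" by (simp add: to_int)
    have "?chi (\<Prod>a\<in>?A. (a + of_int x) ^ ?e a) = ?chi (of_int (\<Prod>a\<in>A. (a + x) ^ e a))"
      by (simp add: prod.reindex[OF inj] to_int_A cong: prod.cong)
    thus "?chi (\<Prod>a\<in>?A. (a + of_int x) ^ ?e a) = chi (\<Prod>a\<in>A. (a + x) ^ e a)"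
      by (simp only: of_int)
  next
    fix x :: "'a mod_ring"
    show "of_int (to_int_mod_ring x) = x" by (rule of_to)
    show "to_int_mod_ring x \<in> {0..<int p}"
      using range_to_int_mod_ring[where ?'a = 'a] assms(1) by auto
  qed simp
  also have "\<dots> = (\<Sum>x\<in>UNIV. ?chi (\<Prod>a\<in>?A. (a - x) ^ ?e a))"
    by (rule sum.reindex_bij_witness[of _ uminus uminus]) auto
  finally have "norm (\<Sum>x\<in>{0..<int p}. chi (\<Prod>a\<in>A. (a + x) ^ e a)) \<le> real (card ?A - 1) * sqrt CARD('a)"
    using weil_bound by simp
  thus "norm (\<Sum>x\<in>{0..<int p}. chi (\<Prod>a\<in>A. (a + x) ^ e a)) \<le> real (card A - 1) * sqrt p"
    by (simp add: card_image[OF inj] assms(1))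
qed

theorem weil_bound_at_prime:
  assumes "prime p" "p \<ge> 3"
  shows "weil_bound_at p"
proof (rule ccontr)
  assume "\<not> weil_bound_at p"
  hence ex: "\<exists>p. prime p \<and> p \<ge> 3 \<and> \<not> weil_bound_at p" using assms by blast
  have "\<not> weil_bound_at exceptional_prime"
    using someI_ex[OF ex] ex by (simp add: exceptional_prime_def)
  moreover have "weil_bound_at exceptional_prime"
    by (rule weil_bound_at_card[OF card_exceptional_index exceptional_prime(2)])
  ultimately show False by blast
qed

text \<open>Conjugated factors get the exponent \<open>p - 2\<close>, and equal shifts are merged by
  adding exponents. As the residue of \<open>w i0\<close> occurs once and unconjugated, its exponent
  is exactly 1.\<close>

lemma weil_bound_mixed_aux:
  fixes w :: "'i \<Rightarrow> int"
  assumes nontriv: "nontrivial_character p chi" and p: "prime p" "p \<ge> 3"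
    and I: "finite I" "i0 \<in> I" "s i0" and uniq: "\<And>j. j \<in> I \<Longrightarrow> j \<noteq> i0 \<Longrightarrow> \<not> [w j = w i0] (mod int p)"
  shows "norm (\<Sum>x\<in>{0..<int p}. \<Prod>i\<in>I. (if s i then chi (w i + x) else cnj (chi (w i + x)))) \<le> real (card I) * sqrt p"
proof -
  have chi: "dirichlet_character p chi" using nontriv by (simp add: nontrivial_character_def)
  define c where "c = (\<lambda>i. if s i then 1 else p - 2)"
  define A where "A = (\<lambda>i. w i mod int p) ` I"
  define e where "e = (\<lambda>a. \<Sum>i | i \<in> I \<and> w i mod int p = a. c i)"
  have "{i. i \<in> I \<and> w i mod int p = w i0 mod int p} = {i0}"
    using I uniq by (auto simp: cong_def)
  hence e1: "e (w i0 mod int p) = 1" using I by (simp add: e_def c_def)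
  have "(\<Prod>i\<in>I. (if s i then chi (w i + x) else cnj (chi (w i + x)))) = chi (\<Prod>a\<in>A. (a + x) ^ e a)" for x
  proof -
    have "(\<Prod>a\<in>A. (a + x) ^ e a) = (\<Prod>a\<in>A. \<Prod>i | i \<in> I \<and> w i mod int p = a. (w i mod int p + x) ^ c i)"
      unfolding e_def power_sum by (intro prod.cong refl) auto
    also have "\<dots> = (\<Prod>i\<in>I. (w i mod int p + x) ^ c i)"
      by (rule prod.group) (auto simp: I A_def)
    finally have "chi (\<Prod>a\<in>A. (a + x) ^ e a) = (\<Prod>i\<in>I. chi ((w i mod int p + x) ^ c i))"
      by (simp only: dirichlet_character_prod[OF chi])
    also have "\<dots> = (\<Prod>i\<in>I. (if s i then chi (w i + x) else cnj (chi (w i + x))))"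
    proof (rule prod.cong)
      fix i
      have "chi (w i mod int p + x) = chi (w i + x)"
        by (rule dirichlet_characterD(1)[OF chi]) (simp add: cong_def mod_simps)
      thus "chi ((w i mod int p + x) ^ c i) = (if s i then chi (w i + x) else cnj (chi (w i + x)))"
        by (simp add: c_def cnj_dirichlet_character[OF chi p] dirichlet_character_power[OF chi])
    qed (rule refl)
    finally show ?thesis ..
  qed
  moreover have "norm (\<Sum>x\<in>{0..<int p}. chi (\<Prod>a\<in>A. (a + x) ^ e a)) \<le> real (card A - 1) * sqrt p"
  proof -
    have "A \<subseteq> {0..<int p}" "w i0 mod int p \<in> A" using p I by (auto simp: A_def prime_gt_0_nat)
    thus ?thesis using weil_bound_at_prime[OF p] nontriv e1 unfolding weil_bound_at_def by blast
  qed
  moreover have "real (card A - 1) * sqrt p \<le> real (card I) * sqrt p"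
    using card_image_le[OF I(1), of "\<lambda>i. w i mod int p"] by (intro mult_right_mono) (auto simp: A_def)
  ultimately show ?thesis by simp
qed

text \<open>If the isolated factor is conjugated, the whole sum is conjugated, which exchanges the
  two kinds of factors.\<close>

theorem weil_bound_mixed:
  fixes w :: "'i \<Rightarrow> int"
  assumes nontriv: "nontrivial_character p chi" and p: "prime p" "p \<ge> 3"
    and I: "finite I" "i0 \<in> I" and uniq: "\<And>j. j \<in> I \<Longrightarrow> j \<noteq> i0 \<Longrightarrow> \<not> [w j = w i0] (mod int p)"
  shows "norm (\<Sum>x\<in>{0..<int p}. \<Prod>i\<in>I. (if s i then chi (w i + x) else cnj (chi (w i + x)))) \<le> real (card I) * sqrt p"
    (is "norm ?S \<le> _")
proof (cases "s i0")
  case True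
  thus ?thesis by (intro weil_bound_mixed_aux[OF nontriv p I(1,2)] uniq)
next
  case False
  have "norm ?S = norm (cnj ?S)"
    by (simp only: complex_mod_cnj)
  also have "cnj ?S = (\<Sum>x\<in>{0..<int p}. \<Prod>i\<in>I. (if \<not> s i then chi (w i + x) else cnj (chi (w i + x))))"
    unfolding cnj_sum cnj_prod by (intro sum.cong prod.cong refl) auto
  also have "norm \<dots> \<le> real (card I) * sqrt p"
    using False by (intro weil_bound_mixed_aux[OF nontriv p I] uniq)
  finally show ?thesis .
qed

section \<open>Divisors and dyadic intervals\<close>

lemma card_divisors_prime_power_mult_le:
  fixes q m :: nat
  assumes "prime q" "m > 0"
  shows "card {d. d dvd q ^ k * m} \<le> (k + 1) * card {d. d dvd m}"
proof -
  have pp: "{d. d dvd q ^ k} = (\<lambda>i. q ^ i) ` {..k}"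
    using assms(1) by (auto simp: divides_primepow_nat)
  have fin: "finite {d. d dvd m}" using assms by simp
  have "{d. d dvd q ^ k * m} \<subseteq> (\<lambda>(x, y). x * y) ` ({d. d dvd q ^ k} \<times> {d. d dvd m})"
    by (auto dest!: division_decomp)
  hence "card {d. d dvd q ^ k * m} \<le> card ((\<lambda>(x, y). x * y) ` ({d. d dvd q ^ k} \<times> {d. d dvd m}))"
    by (rule card_mono[rotated]) (use fin pp in auto)
  also have "\<dots> \<le> card ({d. d dvd q ^ k} \<times> {d. d dvd m})"
    by (rule card_image_le) (use fin pp in auto)
  also have "\<dots> = card {d. d dvd q ^ k} * card {d. d dvd m}" by (rule card_cartesian_product)
  also have "card {d. d dvd q ^ k} \<le> k + 1"
    unfolding pp using card_image_le[of "{..k}" "\<lambda>i. q ^ i"] by simp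
  finally show ?thesis by simp
qed

text \<open>A prime power q^k contributes k + 1 divisors. For q >= 2^(1/\<delta>) this is at most
  q^(k \<delta>); each of the at most \<open>B\<close> smaller primes costs one factor
  \<open>C0\<close>, whatever its exponent.\<close>

theorem divisor_bound:
  fixes \<delta> :: real
  assumes \<delta>: "\<delta> > 0"
  obtains C where "C \<ge> 1" "\<And>n. n > 0 \<Longrightarrow> real (card {d :: nat. d dvd n}) \<le> C * real n powr \<delta>"
proof -
  define t where "t = \<delta> * ln 2"
  have t: "t > 0" using \<delta> by (simp add: t_def)
  define C0 where "C0 = 1 + 1 / t"
  have C0: "C0 \<ge> 1" using t by (simp add: C0_def)
  define B where "B = nat \<lceil>2 powr (1 / \<delta>)\<rceil>"
  define S where "S = (\<lambda>n :: nat. {q. prime q \<and> q < B \<and> q dvd n})"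
  have finS: "finite (S n)" for n by (rule finite_subset[of _ "{..<B}"]) (auto simp: S_def)
  have small: "real (k + 1) \<le> C0 * real q powr (k * \<delta>)" if "q \<ge> 2" for k q :: nat
  proof -
    have "real (k + 1) \<le> C0 * (1 + k * t)" using t by (simp add: C0_def field_simps)
    also have "\<dots> \<le> C0 * exp (k * t)" using C0 by (intro mult_left_mono exp_ge_add_one_self) simp
    also have "exp (k * t) = 2 powr (k * \<delta>)" by (simp add: t_def powr_def mult_ac)
    also have "\<dots> \<le> real q powr (k * \<delta>)" using that \<delta> by (intro powr_mono2) auto
    finally show ?thesis using C0 by simp
  qed
  have large: "real (k + 1) \<le> real q powr (k * \<delta>)" if "q \<ge> B" for k q :: nat
  proof -
    have "k < 2 ^ k" by (rule less_exp)
    hence "real (k + 1) \<le> real (2 ^ k)" unfolding of_nat_le_iff by linarith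
    also have "\<dots> = (2 powr (1 / \<delta>)) powr (k * \<delta>)" using \<delta> by (simp add: powr_powr powr_realpow)
    also have "\<dots> \<le> real q powr (k * \<delta>)"
      using that \<delta> unfolding B_def by (intro powr_mono2) (auto simp: le_nat_iff ceiling_le_iff nat_le_iff)
    finally show ?thesis .
  qed
  have main: "real (card {d :: nat. d dvd n}) \<le> C0 ^ card (S n) * real n powr \<delta>" if "n > 0" for n
    using that
  proof (induction n rule: less_induct)
    case (less n)
    show ?case
    proof (cases "n = 1")
      case True
      thus ?thesis using C0 by simp
    next
      case False
      then obtain q where q: "prime q" "q dvd n" using prime_factor_nat by blast
      define k where "k = multiplicity q n"
      obtain m where m: "n = q ^ k * m" "\<not> q dvd m"
        using multiplicity_decompose'[of n q] less.prems q(1) unfolding k_def by (metis neq0_conv not_prime_unit)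
      have k: "k > 0" unfolding k_def using q less.prems by (simp add: prime_multiplicity_gt_zero_iff)
      have m0: "m > 0" using m less.prems by (cases "m = 0") auto
      have "1 < q ^ k" using k prime_gt_1_nat[OF q(1)] by (rule one_less_power[rotated])
      hence "m < n" using m0 m(1) by simp
      note IH = less.IH[OF this m0]
      have sub: "S m \<subseteq> S n" using m(1) by (auto simp: S_def)
      have "real (card {d. d dvd n}) \<le> real ((k + 1) * card {d. d dvd m})"
        unfolding m(1) of_nat_le_iff by (rule card_divisors_prime_power_mult_le[OF q(1) m0])
      also have "\<dots> = real (k + 1) * real (card {d. d dvd m})" by (rule of_nat_mult)
      also have "\<dots> \<le> (C0 ^ (card (S n) - card (S m)) * real q powr (k * \<delta>)) * (C0 ^ card (S m) * real m powr \<delta>)"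
      proof (rule mult_mono[OF _ IH])
        show "real (k + 1) \<le> C0 ^ (card (S n) - card (S m)) * real q powr (k * \<delta>)"
        proof (cases "q < B")
          case True
          have "q \<in> S n" "q \<notin> S m" using True q m by (auto simp: S_def)
          hence "card (S m) < card (S n)" using sub finS by (intro psubset_card_mono) auto
          hence "C0 ^ 1 \<le> C0 ^ (card (S n) - card (S m))" using C0 by (intro power_increasing) auto
          hence "C0 * real q powr (k * \<delta>) \<le> C0 ^ (card (S n) - card (S m)) * real q powr (k * \<delta>)"
            by (intro mult_right_mono) auto
          with small[OF prime_ge_2_nat[OF q(1)]] show ?thesis by (rule order.trans)
        next
          case False
          have "1 * real q powr (k * \<delta>) \<le> C0 ^ (card (S n) - card (S m)) * real q powr (k * \<delta>)"
            using C0 by (intro mult_right_mono one_le_power) auto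
          with large[of q k] False show ?thesis by simp
        qed
      qed (use C0 in auto)
      also have "\<dots> = C0 ^ (card (S n) - card (S m) + card (S m)) * ((real q powr k) powr \<delta> * real m powr \<delta>)"
        by (simp add: powr_powr power_add)
      also have "card (S n) - card (S m) + card (S m) = card (S n)"
        using card_mono[OF finS sub] by simp
      also have "(real q powr k) powr \<delta> * real m powr \<delta> = real n powr \<delta>"
        using prime_gt_0_nat[OF q(1)] by (simp add: m(1) powr_mult powr_realpow)
      finally show ?thesis .
    qed
  qed
  have "real (card {d :: nat. d dvd n}) \<le> C0 ^ B * real n powr \<delta>" if "n > 0" for n
  proof -
    have "card (S n) \<le> card {..<B}" by (rule card_mono) (auto simp: S_def)
    hence "C0 ^ card (S n) \<le> C0 ^ B" using C0 by (intro power_increasing) auto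
    thus ?thesis using main[OF that] by (meson mult_right_mono order.trans powr_ge_zero)
  qed
  moreover have "C0 ^ B \<ge> 1" using C0 by simp
  ultimately show ?thesis using that by blast
qed

text \<open>Following the binary expansion of \<open>b\<close>, the induction splits off the first
  half of the range whenever \<open>b\<close> exceeds it, so that at most s + 1 dyadic blocks are
  used.\<close>

lemma norm_prefix_sum_le_dyadic:
  fixes z :: "nat \<Rightarrow> 'a :: real_normed_vector"
  assumes "\<And>j i. j \<le> s \<Longrightarrow> i < 2 ^ (s - j) \<Longrightarrow> norm (\<Sum>v=i * 2 ^ j..<(i + 1) * 2 ^ j. z v) \<le> M"
    and "b \<le> 2 ^ s"
  shows "norm (\<Sum>v<b. z v) \<le> (real s + 1) * M"
  using assms
proof (induction s arbitrary: z b)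
  case 0
  from 0(1)[of 0 0] have M: "norm (z 0) \<le> M" by simp
  have "b = 0 \<or> b = 1" using 0(2) by auto
  thus ?case using M order.trans[OF norm_ge_zero M] by auto
next
  case (Suc s)
  have "norm (\<Sum>v=0 * 2 ^ s..<(0 + 1) * 2 ^ s. z v) \<le> M" by (rule Suc.prems(1)) auto
  hence first: "norm (\<Sum>v<2 ^ s. z v) \<le> M" by (simp add: lessThan_atLeast0)
  hence M: "0 \<le> M" using norm_ge_zero order.trans by blast
  show ?case
  proof (cases "b \<le> 2 ^ s")
    case True
    have "norm (\<Sum>v<b. z v) \<le> (real s + 1) * M"
    proof (rule Suc.IH[OF _ True])
      fix j i :: nat assume "j \<le> s" "i < 2 ^ (s - j)"
      moreover have "(2 :: nat) ^ (s - j) \<le> 2 ^ (Suc s - j)" by (rule power_increasing) auto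
      ultimately have "i < 2 ^ (Suc s - j)" by (meson less_le_trans)
      thus "norm (\<Sum>v=i * 2 ^ j..<(i + 1) * 2 ^ j. z v) \<le> M"
        using \<open>j \<le> s\<close> by (intro Suc.prems(1)) auto
    qed
    thus ?thesis using M by (simp add: algebra_simps)
  next
    case False
    define b' where "b' = b - 2 ^ s"
    have b: "b = 2 ^ s + b'" "b' \<le> 2 ^ s" using False Suc.prems(2) by (auto simp: b'_def)
    have "norm (\<Sum>v<b'. z (v + 2 ^ s)) \<le> (real s + 1) * M"
    proof (rule Suc.IH[OF _ b(2)])
      fix j i :: nat assume ji: "j \<le> s" "i < 2 ^ (s - j)"
      have pow: "(2 :: nat) ^ s = 2 ^ (s - j) * 2 ^ j" using ji by (simp flip: power_add)
      have "(\<Sum>v=i * 2 ^ j..<(i + 1) * 2 ^ j. z (v + 2 ^ s)) =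
          (\<Sum>v=i * 2 ^ j + 2 ^ s..<(i + 1) * 2 ^ j + 2 ^ s. z v)"
        by (rule sum.shift_bounds_nat_ivl[symmetric])
      also have "i * 2 ^ j + 2 ^ s = (i + 2 ^ (s - j)) * 2 ^ j" by (simp add: pow algebra_simps)
      also have "(i + 1) * 2 ^ j + 2 ^ s = (i + 2 ^ (s - j) + 1) * 2 ^ j" by (simp add: pow algebra_simps)
      also have "norm (\<Sum>v=(i + 2 ^ (s - j)) * 2 ^ j..<(i + 2 ^ (s - j) + 1) * 2 ^ j. z v) \<le> M"
      proof (rule Suc.prems(1))
        have "(2 :: nat) ^ (Suc s - j) = 2 * 2 ^ (s - j)" using ji by (simp add: Suc_diff_le)
        thus "i + 2 ^ (s - j) < 2 ^ (Suc s - j)" using ji by simp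
      qed (use ji in simp)
      finally show "norm (\<Sum>v=i * 2 ^ j..<(i + 1) * 2 ^ j. z (v + 2 ^ s)) \<le> M" .
    qed
    moreover have "(\<Sum>v<b. z v) = (\<Sum>v<2 ^ s. z v) + (\<Sum>v<b'. z (v + 2 ^ s))"
      unfolding b by (simp add: sum.nat_group lessThan_atLeast0 flip: sum.shift_bounds_nat_ivl sum.atLeastLessThan_concat[of 0 "2 ^ s" "2 ^ s + b'"])
         (simp add: sum.shift_bounds_nat_ivl[of z 0 "2 ^ s" b', symmetric] add.commute sum.atLeastLessThan_concat)
    ultimately have "norm (\<Sum>v<b. z v) \<le> M + (real s + 1) * M"
      using norm_triangle_mono[OF first] by simp
    thus ?thesis by (simp add: algebra_simps)
  qed
qed

lemma norm_interval_sum_le_dyadic: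
  fixes z :: "nat \<Rightarrow> 'a :: real_normed_vector"
  assumes "\<And>j i. j \<le> s \<Longrightarrow> i < 2 ^ (s - j) \<Longrightarrow> norm (\<Sum>v=i * 2 ^ j..<(i + 1) * 2 ^ j. z v) \<le> M"
    and "a \<le> b" "b \<le> 2 ^ s"
  shows "norm (\<Sum>v=a..<b. z v) \<le> 2 * (real s + 1) * M"
proof -
  have "(\<Sum>v=a..<b. z v) = (\<Sum>v<b. z v) - (\<Sum>v<a. z v)"
    using assms(2) by (simp add: lessThan_atLeast0 sum_diff_nat_ivl)
  also have "norm \<dots> \<le> (real s + 1) * M + (real s + 1) * M"
    by (intro order.trans[OF norm_triangle_ineq4] add_mono norm_prefix_sum_le_dyadic[OF assms(1)])
       (use assms in auto)
  finally show ?thesis by (simp add: algebra_simps)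
qed

section \<open>Moments of character sums\<close>

lemma card_image_le_half:
  assumes I: "finite I" "card I = 2 * r" and dup: "\<And>i. i \<in> I \<Longrightarrow> \<exists>j\<in>I. j \<noteq> i \<and> f j = f i"
  shows "card (f ` I) \<le> r"
proof -
  have "2 * card (f ` I) = (\<Sum>a\<in>f ` I. 2)" by simp
  also have "\<dots> \<le> (\<Sum>a\<in>f ` I. card {i \<in> I. f i = a})"
  proof (rule sum_mono)
    fix a assume "a \<in> f ` I"
    then obtain i where i: "i \<in> I" "f i = a" by auto
    then obtain j where j: "j \<in> I" "j \<noteq> i" "f j = f i" using dup by blast
    have "card {i, j} \<le> card {i \<in> I. f i = a}" by (rule card_mono) (use I i j in auto)
    thus "2 \<le> card {i \<in> I. f i = a}" using j by simp
  qed
  also have "\<dots> = card I"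
    using sum.group[OF I(1) finite_imageI[OF I(1), of f] subset_refl, of "\<lambda>_. 1 :: nat"] by simp
  finally show ?thesis using I by simp
qed

text \<open>A function with at most \<open>r\<close> values is a labelling of \<open>I\<close> by
  numbers below \<open>r\<close>, followed by a map from the labels to \<open>W\<close>; the two
  factors count these.\<close>

lemma card_PiE_small_image_le:
  fixes W :: "'w set"
  assumes I: "finite I" and W: "finite W" "W \<noteq> {}"
  shows "card {f \<in> I \<rightarrow>\<^sub>E W. card (f ` I) \<le> r} \<le> r ^ card I * card W ^ r"
proof -
  let ?h = "\<lambda>(\<tau>, \<sigma>). restrict (\<lambda>i. \<sigma> (\<tau> i)) I" and ?R = "{..<r}"
  let ?P = "(I \<rightarrow>\<^sub>E ?R) \<times> (?R \<rightarrow>\<^sub>E W)"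
  have finP: "finite ?P" using I W by (intro finite_cartesian_product finite_PiE) auto
  have "{f \<in> I \<rightarrow>\<^sub>E W. card (f ` I) \<le> r} \<subseteq> ?h ` ?P"
  proof
    fix f assume "f \<in> {f \<in> I \<rightarrow>\<^sub>E W. card (f ` I) \<le> r}"
    hence f: "f \<in> I \<rightarrow>\<^sub>E W" "card (f ` I) \<le> card ?R" by auto
    obtain g where g: "g ` f ` I \<subseteq> ?R" "inj_on g (f ` I)"
      using card_le_inj[OF finite_imageI[OF I] _ f(2)] by auto
    obtain w0 where w0: "w0 \<in> W" using W by auto
    define \<sigma> where "\<sigma> = restrict (\<lambda>k. if k \<in> g ` f ` I then inv_into (f ` I) g k else w0) ?R"
    have "\<sigma> \<in> ?R \<rightarrow>\<^sub>E W"
      using w0 PiE_mem[OF f(1)] by (auto simp: \<sigma>_def inv_into_f_f[OF g(2)])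
    moreover have "restrict (\<lambda>i. g (f i)) I \<in> I \<rightarrow>\<^sub>E ?R" using g by auto
    moreover have "f = ?h (restrict (\<lambda>i. g (f i)) I, \<sigma>)"
    proof
      fix i show "f i = ?h (restrict (\<lambda>i. g (f i)) I, \<sigma>) i"
        using f(1) g by (cases "i \<in> I") (auto simp: \<sigma>_def inv_into_f_f[OF g(2)] image_subset_iff)
    qed
    ultimately show "f \<in> ?h ` ?P" by blast
  qed
  hence "card {f \<in> I \<rightarrow>\<^sub>E W. card (f ` I) \<le> r} \<le> card (?h ` ?P)"
    by (rule card_mono[rotated]) (intro finite_imageI finP)
  also have "\<dots> \<le> card ?P" by (rule card_image_le[OF finP])
  also have "\<dots> = r ^ card I * card W ^ r"
    using I by (simp add: card_cartesian_product card_PiE)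
  finally show ?thesis .
qed

theorem character_moment_bound:
  fixes c :: int and V r :: nat
  assumes nontriv: "nontrivial_character p chi" and p: "prime p" "p \<ge> 3"
    and V: "V \<ge> 1" "V \<le> p" and r: "r \<ge> 1"
  shows "(\<Sum>x\<in>{0..<int p}. \<Sum>y\<in>{0..<int p}.
            norm (\<Sum>v\<in>{c..<c + int V}. chi (x + v) * cnj (chi (y + v))) ^ (2 * r))
           \<le> (2 * real r) ^ (2 * r + 2) * (real V ^ r * (real p)\<^sup>2 + real V ^ (2 * r) * real p)"
proof -
  define W where "W = {c..<c + int V}"
  define I where "I = {..<2 * r}"
  let ?P = "I \<rightarrow>\<^sub>E W" and ?Z = "{0..<int p}" and ?small = "\<lambda>\<phi>. card (\<phi> ` I) \<le> r"
  define Z where "Z = (\<lambda>x y. \<Sum>v\<in>W. chi (x + v) * cnj (chi (y + v)))"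
  define T where "T = (\<lambda>\<phi> x. \<Prod>i\<in>I. (if i < r then chi (\<phi> i + x) else cnj (chi (\<phi> i + x))))"
  define S where "S = (\<lambda>\<phi>. \<Sum>x\<in>?Z. T \<phi> x)"
  have chi: "dirichlet_character p chi" using nontriv by (simp add: nontrivial_character_def)
  have finI: "finite I" "card I = 2 * r" by (simp_all add: I_def)
  have finW: "finite W" "card W = V" "W \<noteq> {}" using V by (simp_all add: W_def)
  have finP: "finite (?P)" using finI finW by (intro finite_PiE) auto
  have eq: "of_real (norm (Z x y) ^ (2 * r)) = (\<Sum>\<phi>\<in>?P. T \<phi> x * cnj (T \<phi> y))" for x y
  proof -
    \<comment> \<open>The last \<open>r\<close> factors come from the conjugate of \<open>Z\<close>,
      with \<open>chi\<close> and its conjugate exchanged. So in each product the part in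
      \<open>x\<close> is \<open>T \<phi> x\<close> and the part in \<open>y\<close> is
      \<open>cnj (T \<phi> y)\<close>.\<close>
    define zz where "zz = (\<lambda>i v. if i < r then chi (x + v) * cnj (chi (y + v)) else cnj (chi (x + v)) * chi (y + v))"
    have "complex_of_real (norm (Z x y) ^ (2 * r)) = of_real ((norm (Z x y))\<^sup>2) ^ r"
      unfolding power_mult by (rule of_real_power)
    also have "\<dots> = (Z x y * cnj (Z x y)) ^ r"
      unfolding complex_norm_square ..
    also have "\<dots> = (\<Prod>i\<in>{..<r}. Z x y) * (\<Prod>i\<in>{r..<2 * r}. cnj (Z x y))"
      by (simp add: power_mult_distrib)
    also have "\<dots> = (\<Prod>i\<in>{..<r}. \<Sum>v\<in>W. zz i v) * (\<Prod>i\<in>{r..<2 * r}. \<Sum>v\<in>W. zz i v)"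
      by (intro arg_cong2[of _ _ _ _ "(*)"] prod.cong) (auto simp: Z_def zz_def)
    also have "\<dots> = (\<Prod>i\<in>I. \<Sum>v\<in>W. zz i v)"
      unfolding I_def by (subst prod.union_disjoint[symmetric]) (auto intro!: prod.cong)
    also have "\<dots> = (\<Sum>\<phi>\<in>?P. \<Prod>i\<in>I. zz i (\<phi> i))"
      by (rule prod_sum_PiE) (use finI finW in auto)
    also have "\<dots> = (\<Sum>\<phi>\<in>?P. T \<phi> x * cnj (T \<phi> y))"
      unfolding T_def cnj_prod prod.distrib[symmetric]
      by (intro sum.cong prod.cong refl) (auto simp: zz_def add.commute)
    finally show ?thesis .
  qed
  have "complex_of_real (\<Sum>x\<in>?Z. \<Sum>y\<in>?Z. norm (Z x y) ^ (2 * r))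
      = (\<Sum>x\<in>?Z. \<Sum>y\<in>?Z. \<Sum>\<phi>\<in>?P. T \<phi> x * cnj (T \<phi> y))"
    by (simp add: eq flip: of_real_power)
  also have "\<dots> = (\<Sum>x\<in>?Z. \<Sum>\<phi>\<in>?P. T \<phi> x * cnj (S \<phi>))"
    by (subst sum.swap) (simp add: S_def sum_distrib_left)
  also have "\<dots> = (\<Sum>\<phi>\<in>?P. S \<phi> * cnj (S \<phi>))"
    by (subst sum.swap) (simp add: S_def sum_distrib_right)
  also have "\<dots> = complex_of_real (\<Sum>\<phi>\<in>?P. (norm (S \<phi>))\<^sup>2)"
    by (simp add: complex_norm_square del: of_real_power)
  finally have "(\<Sum>x\<in>?Z. \<Sum>y\<in>?Z. norm (Z x y) ^ (2 * r)) = (\<Sum>\<phi>\<in>?P. (norm (S \<phi>))\<^sup>2)"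
    unfolding of_real_eq_iff .
  also have "\<dots> \<le> (\<Sum>\<phi>\<in>?P. (if ?small \<phi> then (real p)\<^sup>2 else (2 * real r)\<^sup>2 * real p))"
  proof (rule sum_mono)
    fix \<phi> assume \<phi>: "\<phi> \<in> ?P"
    show "(norm (S \<phi>))\<^sup>2 \<le> (if ?small \<phi> then (real p)\<^sup>2 else (2 * real r)\<^sup>2 * real p)"
    proof (cases "?small \<phi>")
      case True
      have T1: "norm (T \<phi> x) \<le> 1" for x
        unfolding T_def prod_norm[symmetric]
        by (intro prod_le_1) (use norm_dirichlet_character_le[OF chi] p prime_gt_0_nat in \<open>auto simp: \<close>)
      have "norm (S \<phi>) \<le> (\<Sum>x\<in>?Z. 1)"
        unfolding S_def by (intro sum_norm_le T1)
      hence "norm (S \<phi>) \<le> real p" by simp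
      thus ?thesis using True by (simp add: power_mono)
    next
      case False
      then obtain i0 where i0: "i0 \<in> I" "\<And>j. j \<in> I \<Longrightarrow> j \<noteq> i0 \<Longrightarrow> \<phi> j \<noteq> \<phi> i0"
        using card_image_le_half[OF finI, of \<phi>] by blast
      \<comment> \<open>The shifts lie in an interval of \<open>V\<close> <= \<open>p\<close>
        integers, so different shifts stay different modulo \<open>p\<close>.\<close>
      have "\<not> [\<phi> j = \<phi> i0] (mod int p)" if "j \<in> I" "j \<noteq> i0" for j
      proof
        assume "[\<phi> j = \<phi> i0] (mod int p)"
        hence "int p dvd \<phi> j - \<phi> i0" by (simp add: cong_iff_dvd_diff)
        moreover have "\<bar>\<phi> j - \<phi> i0\<bar> < int p"
          using PiE_mem[OF \<phi> that(1)] PiE_mem[OF \<phi> i0(1)] V by (auto simp: W_def)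
        ultimately have "\<phi> j - \<phi> i0 = 0"
          using dvd_imp_le_int[of "\<phi> j - \<phi> i0" "int p"] by linarith
        thus False using i0(2)[OF that] by simp
      qed
      hence "norm (S \<phi>) \<le> real (card I) * sqrt p"
        unfolding S_def T_def by (intro weil_bound_mixed[OF nontriv p finI(1) i0(1)])
      hence "(norm (S \<phi>))\<^sup>2 \<le> (real (card I) * sqrt p)\<^sup>2" by (intro power_mono) auto
      thus ?thesis using False by (simp add: finI power_mult_distrib)
    qed
  qed
  also have "\<dots> = real (card {\<phi> \<in> ?P. ?small \<phi>}) * (real p)\<^sup>2
      + real (card {\<phi> \<in> ?P. \<not> ?small \<phi>}) * ((2 * real r)\<^sup>2 * real p)"
    unfolding sum.If_cases[OF finP] by (simp add: Int_def)
  \<comment> \<open>Degenerate tuples: at most r^(2 r) V^r, each with the trivial bound p^2. All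
    others: at most V^(2 r), each with the squared Weil bound (2 r)^2 p.\<close>
  also have "\<dots> \<le> real (r ^ (2 * r) * V ^ r) * (real p)\<^sup>2 + real (V ^ (2 * r)) * ((2 * real r)\<^sup>2 * real p)"
  proof (intro add_mono mult_right_mono)
    show "real (card {\<phi> \<in> ?P. ?small \<phi>}) \<le> real (r ^ (2 * r) * V ^ r)"
      using card_PiE_small_image_le[OF finI(1) finW(1,3), of r] unfolding finI finW of_nat_le_iff .
    have "card {\<phi> \<in> ?P. \<not> ?small \<phi>} \<le> card (?P)"
      by (rule card_mono[OF finP]) auto
    thus "real (card {\<phi> \<in> ?P. \<not> ?small \<phi>}) \<le> real (V ^ (2 * r))"
      unfolding of_nat_le_iff using finI finW by (simp add: card_PiE)
  qed auto
  also have "\<dots> = real r ^ (2 * r) * (real V ^ r * (real p)\<^sup>2) + (2 * real r)\<^sup>2 * (real V ^ (2 * r) * real p)"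
    unfolding of_nat_mult of_nat_power by (simp only: mult_ac)
  also have "\<dots> \<le> (2 * real r) ^ (2 * r + 2) * (real V ^ r * (real p)\<^sup>2) + (2 * real r) ^ (2 * r + 2) * (real V ^ (2 * r) * real p)"
  proof -
    have r: "1 \<le> 2 * real r" using r by simp
    have "real r ^ (2 * r) \<le> (2 * real r) ^ (2 * r)" by (intro power_mono) simp_all
    also have "\<dots> \<le> (2 * real r) ^ (2 * r + 2)" by (rule power_increasing[OF _ r]) simp
    finally have 1: "real r ^ (2 * r) \<le> (2 * real r) ^ (2 * r + 2)" .
    have 2: "(2 * real r)\<^sup>2 \<le> (2 * real r) ^ (2 * r + 2)" by (rule power_increasing[OF _ r]) simp
    show ?thesis
      by (rule add_mono; rule mult_right_mono; (rule 1 2)?) (intro mult_nonneg_nonneg zero_le_power of_nat_0_le_iff)+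
  qed
  finally show ?thesis unfolding Z_def W_def distrib_left .
qed

text \<open>\<open>Mx\<close> must not depend on the interval, so it is 2 (s + 1) times the maximum
  over all dyadic blocks. A power of the maximum is at most the sum over the blocks; the bounds for
  the 2^(s - j) blocks of length 2^j add up to no more than that for one block of length 2^s, so
  only the number of scales is lost.\<close>

theorem interval_moment_bound:
  fixes s r :: nat
  assumes nontriv: "nontrivial_character p chi" and p: "prime p" "p \<ge> 3"
    and s: "2 ^ s \<le> p" and r: "r \<ge> 1"
  obtains Mx :: "int \<Rightarrow> int \<Rightarrow> real" where
    "\<And>x y a b. a \<le> b \<Longrightarrow> b \<le> 2 ^ s \<Longrightarrow> norm (\<Sum>v=a..<b. chi (x + int v) * cnj (chi (y + int v))) \<le> Mx x y"
    "(\<Sum>x\<in>{0..<int p}. \<Sum>y\<in>{0..<int p}. Mx x y ^ (2 * r)) \<le> 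
       (2 * (real s + 1)) ^ (2 * r) * (real s + 1) * (2 * real r) ^ (2 * r + 2) * 
       ((2 ^ s) ^ r * (real p)\<^sup>2 + (2 ^ s) ^ (2 * r) * real p)"
proof -
  let ?Z = "{0..<int p}"
  define Bl where "Bl = Sigma {..s} (\<lambda>j. {..<(2 :: nat) ^ (s - j)})"
  have finBl: "finite Bl" by (simp add: Bl_def)
  have "(0, 0) \<in> Bl" by (simp add: Bl_def)
  hence Bl0: "Bl \<noteq> {}" by blast
  define g where "g = (\<lambda>x y (j, i). norm (\<Sum>v=i * 2 ^ j..<(i + 1) * 2 ^ j. chi (x + int v) * cnj (chi (y + int v))))"
  define Mx where "Mx = (\<lambda>x y. 2 * (real s + 1) * Max (g x y ` Bl))"
  have g0: "g x y t \<ge> 0" for x y t by (cases t) (simp add: g_def)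
  define C where "C = (2 * real r) ^ (2 * r + 2)"
  define E where "E = C * ((2 ^ s) ^ r * (real p)\<^sup>2 + (2 ^ s) ^ (2 * r) * real p)"
  have "norm (\<Sum>v=a..<b. chi (x + int v) * cnj (chi (y + int v))) \<le> Mx x y" if "a \<le> b" "b \<le> 2 ^ s" for x y a b
    unfolding Mx_def
  proof (rule norm_interval_sum_le_dyadic[OF _ that])
    fix j i :: nat assume "j \<le> s" "i < 2 ^ (s - j)"
    hence "(j, i) \<in> Bl" by (simp add: Bl_def)
    hence "g x y (j, i) \<le> Max (g x y ` Bl)" using finBl by (intro Max_ge) auto
    thus "norm (\<Sum>v=i * 2 ^ j..<(i + 1) * 2 ^ j. chi (x + int v) * cnj (chi (y + int v))) \<le> Max (g x y ` Bl)"
      by (simp add: g_def)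
  qed
  moreover have "(\<Sum>x\<in>?Z. \<Sum>y\<in>?Z. Mx x y ^ (2 * r)) \<le> (2 * (real s + 1)) ^ (2 * r) * ((real s + 1) * E)"
  proof -
    have "(\<Sum>x\<in>?Z. \<Sum>y\<in>?Z. Mx x y ^ (2 * r))
        \<le> (\<Sum>x\<in>?Z. \<Sum>y\<in>?Z. (2 * (real s + 1)) ^ (2 * r) * (\<Sum>t\<in>Bl. g x y t ^ (2 * r)))"
    proof (intro sum_mono)
      fix x y
      have "Max (g x y ` Bl) \<in> g x y ` Bl" using finBl Bl0 by (intro Max_in) auto
      then obtain t where t: "t \<in> Bl" "Max (g x y ` Bl) = g x y t" by auto
      have "g x y t ^ (2 * r) \<le> (\<Sum>t\<in>Bl. g x y t ^ (2 * r))"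
        by (rule member_le_sum[OF t(1)]) (use finBl in \<open>auto intro!: zero_le_power g0\<close>)
      thus "Mx x y ^ (2 * r) \<le> (2 * (real s + 1)) ^ (2 * r) * (\<Sum>t\<in>Bl. g x y t ^ (2 * r))"
        unfolding Mx_def t(2) power_mult_distrib[of _ "g x y t"] by (intro mult_left_mono) simp_all
    qed
    also have "\<dots> = (2 * (real s + 1)) ^ (2 * r) * (\<Sum>x\<in>?Z. \<Sum>y\<in>?Z. \<Sum>t\<in>Bl. g x y t ^ (2 * r))"
      by (simp only: sum_distrib_left)
    also have "(\<Sum>x\<in>?Z. \<Sum>y\<in>?Z. \<Sum>t\<in>Bl. g x y t ^ (2 * r)) = 
        (\<Sum>x\<in>?Z. \<Sum>t\<in>Bl. \<Sum>y\<in>?Z. g x y t ^ (2 * r))"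
      by (intro sum.cong refl sum.swap)
    also have "\<dots> = (\<Sum>t\<in>Bl. \<Sum>x\<in>?Z. \<Sum>y\<in>?Z. g x y t ^ (2 * r))"
      by (rule sum.swap)
    also have "\<dots> = (\<Sum>j\<le>s. \<Sum>i<2 ^ (s - j). \<Sum>x\<in>?Z. \<Sum>y\<in>?Z. g x y (j, i) ^ (2 * r))"
      unfolding Bl_def by (subst sum.Sigma) (auto intro!: sum.cong)
    also have "\<dots> \<le> (\<Sum>j\<le>s. \<Sum>i<(2 :: nat) ^ (s - j). C * ((2 ^ j) ^ r * (real p)\<^sup>2 + (2 ^ j) ^ (2 * r) * real p))"
    proof (intro sum_mono)
      fix j i assume j: "j \<in> {..s}"
      have "(2 :: nat) ^ j \<le> 2 ^ s" using j by (intro power_increasing) auto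
      hence "2 ^ j \<le> p" using s by (rule order.trans)
      have eq: "(\<Sum>v=i * 2 ^ j..<(i + 1) * 2 ^ j. chi (x + int v) * cnj (chi (y + int v))) = 
          (\<Sum>v\<in>{int (i * 2 ^ j)..<int (i * 2 ^ j) + int (2 ^ j)}. chi (x + v) * cnj (chi (y + v)))" for x y
      proof -
        have "(\<Sum>v=m..<m + l. f (int v)) = (\<Sum>v\<in>{int m..<int m + int l}. f v)" for m l and f :: "int \<Rightarrow> complex"
          by (rule sum.reindex_bij_witness[of _ nat int]) auto
        moreover have "(i + 1) * 2 ^ j = i * 2 ^ j + 2 ^ j" by simp
        ultimately show ?thesis by (simp only:)
      qed
      have "(\<Sum>x\<in>?Z. \<Sum>y\<in>?Z. g x y (j, i) ^ (2 * r)) \<le> 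
          C * (real (2 ^ j) ^ r * (real p)\<^sup>2 + real (2 ^ j) ^ (2 * r) * real p)"
        unfolding g_def prod.case eq C_def
        by (rule character_moment_bound[OF nontriv p _ \<open>2 ^ j \<le> p\<close> r]) simp
      thus "(\<Sum>x\<in>?Z. \<Sum>y\<in>?Z. g x y (j, i) ^ (2 * r)) \<le>
          C * ((2 ^ j) ^ r * (real p)\<^sup>2 + (2 ^ j) ^ (2 * r) * real p)"
        by simp
    qed
    also have "\<dots> \<le> (\<Sum>j\<le>s. E)"
    proof (rule sum_mono)
      fix j assume j: "j \<in> {..s}"
      have *: "2 ^ (s - j) * (2 ^ j) ^ q \<le> ((2 :: real) ^ s) ^ q" if "q \<ge> 1" for q :: nat
      proof -
        have "(2 :: real) ^ (s - j) * (2 ^ j) ^ q \<le> (2 ^ (s - j)) ^ q * (2 ^ j) ^ q"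
          using that by (intro mult_right_mono self_le_power) auto
        also have "\<dots> = (2 ^ s) ^ q" using j by (simp flip: power_mult_distrib power_add)
        finally show ?thesis .
      qed
      have "(\<Sum>i<(2 :: nat) ^ (s - j). C * ((2 ^ j) ^ r * (real p)\<^sup>2 + (2 ^ j) ^ (2 * r) * real p)) = 
          C * ((2 ^ (s - j) * (2 ^ j) ^ r) * (real p)\<^sup>2 + (2 ^ (s - j) * (2 ^ j) ^ (2 * r)) * real p)"
        by (simp add: algebra_simps)
      also have "\<dots> \<le> E"
        unfolding E_def using r by (intro mult_left_mono add_mono mult_right_mono *) (auto simp: C_def)
      finally show "(\<Sum>i<(2 :: nat) ^ (s - j). C * ((2 ^ j) ^ r * (real p)\<^sup>2 + (2 ^ j) ^ (2 * r) * real p)) \<le> E" .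
    qed
    also have "\<dots> = (real s + 1) * E" by simp
    finally show ?thesis by (simp add: mult_left_mono)
  qed
  ultimately show ?thesis by (intro that[of Mx]) (simp_all only: E_def C_def mult.assoc)
qed

section \<open>Counting collisions\<close>

text \<open>Empty at 0, which every integer divides, so that the set is finite for every
  argument.\<close>

definition pos_divisors :: "int \<Rightarrow> int set" where
  "pos_divisors n = (if n = 0 then {} else {d. d > 0 \<and> d dvd n})"

lemma finite_pos_divisors: "finite (pos_divisors n)"
  by (rule finite_subset[of _ "{1..\<bar>n\<bar>}"]) (auto simp: pos_divisors_def dest: dvd_imp_le_int)

lemma card_pos_divisors_le:
  assumes "\<And>m :: nat. m > 0 \<Longrightarrow> int m \<le> Y \<Longrightarrow> card {d. d dvd m} \<le> D" "\<bar>n\<bar> \<le> Y"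
  shows "card (pos_divisors n) \<le> D"
proof (cases "n = 0")
  case False
  have "pos_divisors n = int ` {d. d dvd nat \<bar>n\<bar>}"
  proof (intro equalityI subsetI)
    fix d assume "d \<in> pos_divisors n"
    hence "d > 0" "d dvd n" using False by (auto simp: pos_divisors_def)
    thus "d \<in> int ` {d. d dvd nat \<bar>n\<bar>}"
      by (intro image_eqI[of _ _ "nat d"]) (auto simp: nat_dvd_iff)
  next
    fix d assume "d \<in> int ` {d. d dvd nat \<bar>n\<bar>}"
    thus "d \<in> pos_divisors n" using False by (auto simp: pos_divisors_def dvd_nat_abs_iff intro!: Nat.gr0I)
  qed
  hence "card (pos_divisors n) = card {d. d dvd nat \<bar>n\<bar>}" by (simp add: card_image)
  also have "\<dots> \<le> D" by (rule assms(1)) (use assms(2) False in auto)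
  finally show ?thesis .
qed (simp add: pos_divisors_def)

lemma card_Sigma_le:
  assumes "finite A" "\<And>x. x \<in> A \<Longrightarrow> finite (B x) \<and> card (B x) \<le> c"
  shows "finite (Sigma A B) \<and> card (Sigma A B) \<le> card A * c"
  using assms sum_bounded_above[of A "\<lambda>x. card (B x)" c] by (auto intro!: finite_SigmaI)

type_synonym tuple5 = "int \<times> int \<times> int \<times> int \<times> int"

text \<open>\<open>n\<close> also takes values below 1, because n + u v has to run through 1..N for
  every shift u v between 0 and \<open>N\<close>.\<close>

definition shift_tuples :: "int \<Rightarrow> int \<Rightarrow> int \<Rightarrow> int \<Rightarrow> tuple5 set" where
  "shift_tuples K M N U = {(k, n, u, m1, m2). k \<in> {1..K} \<and> n \<in> {-N..N} \<and> u \<in> {1..U} \<and>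
     m1 \<in> {1..M} \<and> m2 \<in> {1..M} \<and> m1 \<noteq> m2}"

lemma shift_tuples_subset: "shift_tuples K M N U \<subseteq> {1..K} \<times> {-N..N} \<times> {1..U} \<times> {1..M} \<times> {1..M}"
  by (auto simp: shift_tuples_def)

lemma finite_shift_tuples: "finite (shift_tuples K M N U)"
  by (rule finite_subset[OF shift_tuples_subset]) auto

text \<open>Equality of the points \<open>x\<close> and \<open>y\<close> of two tuples, with
  denominators cleared and the common factor \<open>b\<close> removed. No division modulo
  \<open>p\<close> is left, so the congruences can be lifted to the integers.\<close>

definition collisions :: "nat \<Rightarrow> int \<Rightarrow> int \<Rightarrow> tuple5 set \<Rightarrow> (tuple5 \<times> tuple5) set" where
  "collisions p a b T = {((k, n, u, m1, m2), (k', n', u', m1', m2')).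
     (k, n, u, m1, m2) \<in> T \<and> (k', n', u', m1', m2') \<in> T \<and>
     [(a * k + b * m1 * n) * (u' * m1') = (a * k' + b * m1' * n') * (u * m1)] (mod int p) \<and>
     [(a * k + b * m2 * n) * (u' * m2') = (a * k' + b * m2' * n') * (u * m2)] (mod int p)}"

text \<open>
  Let \<open>h1\<close>, \<open>h2\<close> be the multiples of \<open>p\<close> by which the two sides of the congruences differ. Given
  \<open>k'\<close>, \<open>n'\<close>, \<open>u\<close>, \<open>m1\<close>, \<open>m2\<close>, \<open>h1\<close>, \<open>h2\<close>, the unknown \<open>m1'\<close> divides \<open>a k' m1 u + p h1\<close>, which is not
  zero, and likewise \<open>m2'\<close>; then \<open>u'\<close> divides a known number, and \<open>k\<close>, \<open>n\<close> solve a linear system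
  with determinant \<open>a b (m2 - m1)\<close>.
\<close>
theorem card_collisions_le:
  fixes K M N U a b :: int and p D :: nat
  assumes p: "prime p" and ab: "\<not> int p dvd a" "\<not> int p dvd b"
    and lt: "K < int p" "M < int p" "U < int p" and pos: "K \<ge> 0" "M \<ge> 0" "N \<ge> 0" "U \<ge> 0"
  defines "L \<equiv> \<bar>a\<bar> * K + \<bar>b\<bar> * M * N"
  assumes D: "\<And>m :: nat. m > 0 \<Longrightarrow> int m \<le> 3 * L * (U * M) \<Longrightarrow> card {d. d dvd m} \<le> D"
  defines "H \<equiv> 2 * L * (U * M) div int p"
  shows "card (collisions p a b (shift_tuples K M N U)) \<le>
           nat K * nat (2 * N + 1) * nat U * (nat M)\<^sup>2 * (nat (2 * H + 1))\<^sup>2 * D ^ 3"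
proof -
  let ?p = "int p" and ?C = "collisions p a b (shift_tuples K M N U)"
  have p0: "?p > 0" using p by (simp add: prime_gt_0_nat)
  have prime: "prime ?p" using p by simp
  have ndvd: "\<not> ?p dvd x" if "0 < x" "x < ?p" for x
    using that zdvd_not_zless by blast
  define G where "G = ({1..K} \<times> {-N..N} \<times> {1..U} \<times> {1..M} \<times> {1..M}) \<times> {-H..H} \<times> {-H..H}"
  \<comment> \<open>The lifted congruence reads (a k + b m n) u' m' = p h + (a k' + b m' n') u m.
    All terms but those collected in \<open>c\<close> contain m', so m' divides \<open>c\<close>;
    and u' divides the right side, which is \<open>R\<close>.\<close>
  define c where "c = (\<lambda>k' u m h. a * k' * m * u + ?p * h)"
  define R where "R = (\<lambda>k' n' u m m' h. ?p * h + (a * k' + b * m' * n') * (u * m))"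
  \<comment> \<open>The cutoff makes the bound \<open>D\<close> valid for every argument. The factor
    3 is one L U M for the product a k' m u and two for p h, a difference of two such
    products.\<close>
  define dv where "dv = (\<lambda>x. if \<bar>x\<bar> \<le> 3 * L * (U * M) then pos_divisors x else {})"
  have dv: "finite (dv x) \<and> card (dv x) \<le> D" for x
    using card_pos_divisors_le[OF D] finite_pos_divisors by (auto simp: dv_def)
  define F1 where "F1 = (\<lambda>((k', n' :: int, u, m1, m2 :: int), (h1, h2 :: int)). dv (c k' u m1 h1))"
  define F2 where "F2 = (\<lambda>(((k', n' :: int, u, m1 :: int, m2), (h1 :: int, h2)), m1' :: int). dv (c k' u m2 h2))"
  \<comment> \<open>\<open>R\<close> may vanish for one of the two congruences but not for both: k
    and n would then solve the homogeneous system, against k >= 1.\<close>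
  define F3 where "F3 = (\<lambda>((((k', n', u, m1, m2), (h1, h2)), m1'), m2').
      dv (if R k' n' u m1 m1' h1 \<noteq> 0 then R k' n' u m1 m1' h1 else R k' n' u m2 m2' h2))"
  define G3 where "G3 = Sigma (Sigma (Sigma G F1) F2) F3"
  have finG: "finite G" by (simp add: G_def)
  have s1: "finite (Sigma G F1) \<and> card (Sigma G F1) \<le> card G * D"
    by (rule card_Sigma_le[OF finG]) (auto simp: F1_def dv)
  have s2: "finite (Sigma (Sigma G F1) F2) \<and> card (Sigma (Sigma G F1) F2) \<le> card (Sigma G F1) * D"
    by (rule card_Sigma_le) (use s1 in \<open>auto simp: F2_def dv\<close>)
  have s3: "finite G3 \<and> card G3 \<le> card (Sigma (Sigma G F1) F2) * D"
    unfolding G3_def by (rule card_Sigma_le) (use s2 in \<open>auto simp: F3_def dv\<close>)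
  have "card G3 \<le> card G * D * D * D"
    using s1 s2 s3 by (meson mult_le_mono1 order.trans)
  also have "card G = nat K * nat (2 * N + 1) * nat U * (nat M)\<^sup>2 * (nat (2 * H + 1))\<^sup>2"
    by (simp add: G_def card_cartesian_product power2_eq_square)
  finally have cardG3: "card G3 \<le> nat K * nat (2 * N + 1) * nat U * (nat M)\<^sup>2 * (nat (2 * H + 1))\<^sup>2 * D ^ 3"
    by (simp add: power3_eq_cube mult.assoc)

  define q where "q = (\<lambda>k n u' k' n' u m m'. ((a * k + b * m * n) * (u' * m') - (a * k' + b * m' * n') * (u * m)) div ?p)"
  define \<Phi> where "\<Phi> = (\<lambda>((k, n, u, m1, m2), (k', n', u', m1', m2')).
      (((((k', n', u, m1, m2), (q k n u' k' n' u m1 m1', q k n u' k' n' u m2 m2')), m1'), m2'), u' :: int))"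
  have L_bound: "\<bar>a * k + b * m * n\<bar> \<le> L" if "k \<in> {1..K}" "m \<in> {1..M}" "n \<in> {-N..N}" for k m n
  proof -
    have "\<bar>a * k + b * m * n\<bar> \<le> \<bar>a\<bar> * \<bar>k\<bar> + \<bar>b\<bar> * \<bar>m\<bar> * \<bar>n\<bar>"
      by (metis abs_mult abs_triangle_ineq)
    also have "\<dots> \<le> L"
      unfolding L_def using that by (intro add_mono mult_mono) auto
    finally show ?thesis .
  qed
  have aK_bound: "\<bar>a * k\<bar> \<le> L" if "k \<in> {1..K}" for k
  proof -
    have "\<bar>a * k\<bar> \<le> \<bar>a\<bar> * K" using that by (simp add: abs_mult mult_left_mono)
    also have "\<dots> \<le> L" unfolding L_def using pos by simp
    finally show ?thesis .
  qed
  have L0: "L \<ge> 0" unfolding L_def using pos by simp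
  have um_bound: "\<bar>u * m\<bar> \<le> U * M" if "u \<in> {1..U}" "m \<in> {1..M}" for u m
    using that by (auto simp: abs_mult intro!: mult_mono)
  have step: "(let h = q k n u' k' n' u m m' in
      (a * k + b * m * n) * (u' * m') = R k' n' u m m' h \<and> h \<in> {-H..H} \<and> m' \<in> dv (c k' u m h) \<and>
      \<bar>R k' n' u m m' h\<bar> \<le> 3 * L * (U * M))"
    if t: "k \<in> {1..K}" "n \<in> {-N..N}" "u \<in> {1..U}" "m \<in> {1..M}" 
      "k' \<in> {1..K}" "n' \<in> {-N..N}" "u' \<in> {1..U}" "m' \<in> {1..M}"
      and cong: "[(a * k + b * m * n) * (u' * m') = (a * k' + b * m' * n') * (u * m)] (mod ?p)"
    for k n u m k' n' u' m'
  proof -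
    define x where "x = (a * k + b * m * n) * (u' * m')"
    define y where "y = (a * k' + b * m' * n') * (u * m)"
    define h where "h = q k n u' k' n' u m m'"
    have h: "?p * h = x - y"
      using cong by (simp add: h_def q_def x_def y_def cong_iff_dvd_diff)
    have xR: "x = R k' n' u m m' h" by (simp add: R_def h y_def)
    have x: "\<bar>x\<bar> \<le> L * (U * M)"
      unfolding x_def abs_mult[of _ "u' * m'"] using t L0 by (intro mult_mono L_bound um_bound) auto
    have y: "\<bar>y\<bar> \<le> L * (U * M)"
      unfolding y_def abs_mult[of _ "u * m"] using t L0 by (intro mult_mono L_bound um_bound) auto
    have ph: "\<bar>?p * h\<bar> \<le> 2 * L * (U * M)" unfolding h using x y by linarith
    hence "?p * \<bar>h\<bar> \<le> 2 * L * (U * M)" using p0 by (simp add: abs_mult)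
    hence "?p * \<bar>h\<bar> div ?p \<le> H" unfolding H_def using p0 by (intro zdiv_mono1)
    hence "\<bar>h\<bar> \<le> H" using p0 by simp
    hence hH: "h \<in> {-H..H}" by auto
    have "c k' u m h = m' * ((a * k + b * m * n) * u' - b * n' * (u * m))"
      unfolding c_def h x_def y_def by (simp add: algebra_simps)
    hence dvd: "m' dvd c k' u m h" by simp
    \<comment> \<open>Modulo \<open>p\<close> only a k' m u remains, and none of its factors is
      divisible by \<open>p\<close>.\<close>
    have "\<not> ?p dvd c k' u m h"
    proof
      assume "?p dvd c k' u m h"
      hence "?p dvd a * k' * m * u" unfolding c_def using dvd_add_left_iff[of ?p "?p * h"] by simp
      thus False using prime ab ndvd t lt by (auto simp: prime_dvd_mult_iff)
    qed
    hence "c k' u m h \<noteq> 0" by auto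
    moreover have "\<bar>c k' u m h\<bar> \<le> 3 * L * (U * M)"
    proof -
      have "\<bar>a * k' * (u * m)\<bar> \<le> L * (U * M)"
        unfolding abs_mult[of _ "u * m"] using t L0 by (intro mult_mono aK_bound um_bound) auto
      hence "\<bar>a * k' * m * u\<bar> \<le> L * (U * M)" by (simp only: mult_ac)
      thus ?thesis unfolding c_def using ph by linarith
    qed
    ultimately have "m' \<in> dv (c k' u m h)" using dvd t by (simp add: dv_def pos_divisors_def)
    moreover have "\<bar>R k' n' u m m' h\<bar> \<le> 3 * L * (U * M)" using x abs_ge_zero[of x] unfolding xR by linarith
    ultimately show ?thesis using xR hH by (simp add: Let_def h_def x_def)
  qed
  have coll: "(k, n, u, m1, m2) \<in> shift_tuples K M N U \<and> (k', n', u', m1', m2') \<in> shift_tuples K M N U \<and>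
      [(a * k + b * m1 * n) * (u' * m1') = (a * k' + b * m1' * n') * (u * m1)] (mod ?p) \<and>
      [(a * k + b * m2 * n) * (u' * m2') = (a * k' + b * m2' * n') * (u * m2)] (mod ?p)"
    if "((k, n, u, m1, m2), (k', n', u', m1', m2')) \<in> ?C"
    for k n u m1 m2 k' n' u' m1' m2'
    using that by (simp add: collisions_def)
  have nz: "a \<noteq> 0" "b \<noteq> 0" using ab by auto
  have solve: "n = n2 \<and> k = k2"
    if "a * k + b * m1 * n = a * k2 + b * m1 * n2" "a * k + b * m2 * n = a * k2 + b * m2 * n2" "m1 \<noteq> m2"
    for k n k2 n2 m1 m2
  proof -
    have "b * (m1 - m2) * (n - n2) = (a * k + b * m1 * n - (a * k2 + b * m1 * n2)) - (a * k + b * m2 * n - (a * k2 + b * m2 * n2))"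
      by (simp add: algebra_simps)
    also have "\<dots> = 0" using that by simp
    finally have "n = n2" using nz that(3) by simp
    thus ?thesis using that(1) nz by simp
  qed
  have inj: "inj_on \<Phi> (?C)"
  proof (rule inj_onI)
    fix x y assume xy: "x \<in> ?C"
      "y \<in> ?C" "\<Phi> x = \<Phi> y"
    obtain k n u m1 m2 k' n' u' m1' m2' where x: "x = ((k, n, u, m1, m2), (k', n', u', m1', m2'))"
      by (metis surj_pair)
    obtain k2 n2 u2 m12 m22 k2' n2' u2' m12' m22'
      where y: "y = ((k2, n2, u2, m12, m22), (k2', n2', u2', m12', m22'))"
      by (metis surj_pair)
    note c1 = xy(1)[unfolded x] and c2 = xy(2)[unfolded y] and eq = xy(3)[unfolded x y]
    have e: "k2' = k'" "n2' = n'" "u2 = u" "m12 = m1" "m22 = m2" "m12' = m1'" "m22' = m2'" "u2' = u'"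
      and q1: "q k n u' k' n' u m1 m1' = q k2 n2 u' k' n' u m1 m1'"
      and q2: "q k n u' k' n' u m2 m2' = q k2 n2 u' k' n' u m2 m2'"
      using eq by (auto simp: \<Phi>_def)
    note t1 = coll[OF c1] and t2 = coll[OF c2, unfolded e]
    have pos: "u' * m1' \<noteq> 0" "u' * m2' \<noteq> 0" "m1 \<noteq> m2" using t1 by (auto simp: shift_tuples_def)
    have "(a * k + b * m1 * n) * (u' * m1') = (a * k2 + b * m1 * n2) * (u' * m1')"
      using step[of k n u m1 k' n' u' m1'] step[of k2 n2 u m1 k' n' u' m1'] t1 t2 q1
      by (simp add: shift_tuples_def Let_def)
    hence 1: "a * k + b * m1 * n = a * k2 + b * m1 * n2" using pos by simp
    have "(a * k + b * m2 * n) * (u' * m2') = (a * k2 + b * m2 * n2) * (u' * m2')"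
      using step[of k n u m2 k' n' u' m2'] step[of k2 n2 u m2 k' n' u' m2'] t1 t2 q2
      by (simp add: shift_tuples_def Let_def)
    hence 2: "a * k + b * m2 * n = a * k2 + b * m2 * n2" using pos by simp
    show "x = y" unfolding x y using solve[OF 1 2 pos(3)] e by simp
  qed
  have "\<Phi> ` ?C \<subseteq> G3"
  proof (rule image_subsetI, clarify)
    fix k n u m1 m2 k' n' u' m1' m2'
    assume c1: "((k, n, u, m1, m2), (k', n', u', m1', m2')) \<in> ?C"
    note t = coll[OF c1]
    have mem: "k \<in> {1..K}" "n \<in> {-N..N}" "u \<in> {1..U}" "m1 \<in> {1..M}" "m2 \<in> {1..M}" "m1 \<noteq> m2"
      "k' \<in> {1..K}" "n' \<in> {-N..N}" "u' \<in> {1..U}" "m1' \<in> {1..M}" "m2' \<in> {1..M}"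
      using t by (auto simp: shift_tuples_def)
    define h1 where "h1 = q k n u' k' n' u m1 m1'"
    define h2 where "h2 = q k n u' k' n' u m2 m2'"
    have st1: "(a * k + b * m1 * n) * (u' * m1') = R k' n' u m1 m1' h1" "h1 \<in> {-H..H}" "m1' \<in> dv (c k' u m1 h1)"
      "\<bar>R k' n' u m1 m1' h1\<bar> \<le> 3 * L * (U * M)"
      using step[OF mem(1-4,7-10)] t unfolding Let_def h1_def by blast+
    have st2: "(a * k + b * m2 * n) * (u' * m2') = R k' n' u m2 m2' h2" "h2 \<in> {-H..H}" "m2' \<in> dv (c k' u m2 h2)"
      "\<bar>R k' n' u m2 m2' h2\<bar> \<le> 3 * L * (U * M)"
      using step[OF mem(1-3,5,7-9,11)] t unfolding Let_def h2_def by blast+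
    have ne: "R k' n' u m1 m1' h1 \<noteq> 0 \<or> R k' n' u m2 m2' h2 \<noteq> 0"
    proof (rule ccontr)
      assume "\<not> ?thesis"
      hence "a * k + b * m1 * n = a * 0 + b * m1 * 0" "a * k + b * m2 * n = a * 0 + b * m2 * 0"
        using st1(1) st2(1) mem by auto
      from solve[OF this mem(6)] show False using mem by simp
    qed
    have "u' dvd R k' n' u m1 m1' h1" "u' dvd R k' n' u m2 m2' h2"
      unfolding st1(1)[symmetric] st2(1)[symmetric] by simp_all
    hence "u' \<in> dv (if R k' n' u m1 m1' h1 \<noteq> 0 then R k' n' u m1 m1' h1 else R k' n' u m2 m2' h2)"
      using ne mem st1(4) st2(4) by (simp add: dv_def pos_divisors_def)
    thus "\<Phi> ((k, n, u, m1, m2), k', n', u', m1', m2') \<in> G3"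
      using mem st1(2,3) st2(2,3) unfolding \<Phi>_def prod.case h1_def[symmetric] h2_def[symmetric] G3_def F1_def F2_def F3_def G_def
      by (intro SigmaI) simp_all
  qed
  hence "card (?C) \<le> card G3"
    using card_inj_on_le[OF inj] s3 by blast
  thus ?thesis using cardG3 by simp
qed

section \<open>The shifting argument\<close>

text \<open>The power mean inequality by induction. The step is Chebyshev's sum inequality, which
  holds because (x - y) (x^k - y^k) is never negative for x, y >= 0.\<close>

lemma sum_power_le_card_power:
  fixes x :: "'t \<Rightarrow> real"
  assumes x: "\<And>t. t \<in> T \<Longrightarrow> x t \<ge> 0"
  shows "(\<Sum>t\<in>T. x t) ^ Suc r \<le> real (card T) ^ r * (\<Sum>t\<in>T. x t ^ Suc r)"
proof (induction r)
  case (Suc r)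
  let ?S = "\<Sum>t\<in>T. x t" and ?n = "real (card T)"
  have "0 \<le> (\<Sum>s\<in>T. \<Sum>t\<in>T. (x s - x t) * (x s ^ Suc r - x t ^ Suc r))"
  proof (intro sum_nonneg)
    fix s t assume "s \<in> T" "t \<in> T"
    show "0 \<le> (x s - x t) * (x s ^ Suc r - x t ^ Suc r)"
    proof (cases "x s \<le> x t")
      case True
      hence "x s ^ Suc r \<le> x t ^ Suc r" using x \<open>s \<in> T\<close> by (intro power_mono) auto
      thus ?thesis using True by (intro mult_nonpos_nonpos) auto
    next
      case False
      hence "x t ^ Suc r \<le> x s ^ Suc r" using x \<open>t \<in> T\<close> by (intro power_mono) auto
      thus ?thesis using False by (intro mult_nonneg_nonneg) auto
    qed
  qed
  also have "\<dots> = (\<Sum>s\<in>T. \<Sum>t\<in>T. x s ^ Suc (Suc r) + x t ^ Suc (Suc r) - x s * x t ^ Suc r - x s ^ Suc r * x t)"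
    by (intro sum.cong refl) (simp add: algebra_simps)
  also have "\<dots> = 2 * (?n * (\<Sum>t\<in>T. x t ^ Suc (Suc r))) - 2 * (?S * (\<Sum>t\<in>T. x t ^ Suc r))"
    by (simp only: sum_subtractf sum.distrib sum_constant sum_distrib_left[symmetric] sum_distrib_right[symmetric])
       (simp add: mult.commute)
  finally have cheb: "?S * (\<Sum>t\<in>T. x t ^ Suc r) \<le> ?n * (\<Sum>t\<in>T. x t ^ Suc (Suc r))" by simp
  have "?S ^ Suc (Suc r) = ?S * ?S ^ Suc r" by (rule power_Suc)
  also have "\<dots> \<le> ?S * (?n ^ r * (\<Sum>t\<in>T. x t ^ Suc r))"
    using x by (intro mult_left_mono Suc.IH sum_nonneg)
  also have "\<dots> = ?n ^ r * (?S * (\<Sum>t\<in>T. x t ^ Suc r))" by (simp only: mult_ac)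
  also have "\<dots> \<le> ?n ^ r * (?n * (\<Sum>t\<in>T. x t ^ Suc (Suc r)))"
    by (intro mult_left_mono cheb) simp
  finally show ?case by (simp only: power_Suc mult_ac)
qed simp

text \<open>
  Hoelder's inequality with exponents \<open>2 r / (2 r - 2)\<close>, \<open>2 r\<close> and \<open>2 r\<close> for the weights
  \<open>\<nu>(z) = \<bar>f\<^sup>-\<^sup>1(z)\<bar>\<close>, whose second moment counts collisions of \<open>f\<close>.
\<close>
lemma fibre_holder:
  fixes f :: "'t \<Rightarrow> 'z" and g :: "'z \<Rightarrow> real"
  assumes T: "finite T" and Z: "finite Z" "f ` T \<subseteq> Z" and g: "\<And>z. z \<in> Z \<Longrightarrow> g z \<ge> 0"
  shows "(\<Sum>t\<in>T. g (f t)) ^ (2 * Suc r) \<le>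
    real (card T) ^ (2 * r) * real (card {(s, t). s \<in> T \<and> t \<in> T \<and> f s = f t}) * (\<Sum>z\<in>Z. g z ^ (2 * Suc r))"
proof -
  define \<nu> where "\<nu> = (\<lambda>z. real (card {t \<in> T. f t = z}))"
  \<comment> \<open>Hoelder's inequality is obtained from the power mean inequality over
    \<open>T\<close> with exponent r + 1, followed by Cauchy-Schwarz over \<open>Z\<close>.\<close>
  have "(\<Sum>t\<in>T. g (f t)) ^ Suc r \<le> real (card T) ^ r * (\<Sum>t\<in>T. g (f t) ^ Suc r)"
    by (rule sum_power_le_card_power) (use g Z in auto)
  also have "(\<Sum>t\<in>T. g (f t) ^ Suc r) = (\<Sum>z\<in>Z. \<Sum>t | t \<in> T \<and> f t = z. g (f t) ^ Suc r)"
    by (rule sum.group[OF T Z, symmetric])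
  also have "\<dots> = (\<Sum>z\<in>Z. \<nu> z * g z ^ Suc r)"
    by (intro sum.cong refl) (simp add: \<nu>_def)
  finally have "((\<Sum>t\<in>T. g (f t)) ^ Suc r)\<^sup>2 \<le> (real (card T) ^ r * (\<Sum>z\<in>Z. \<nu> z * g z ^ Suc r))\<^sup>2"
    by (intro power_mono zero_le_power sum_nonneg) (use g Z in auto)
  also have "\<dots> = real (card T) ^ (2 * r) * (\<Sum>z\<in>Z. \<nu> z * g z ^ Suc r)\<^sup>2"
    by (simp only: power_mult_distrib power_mult[symmetric] mult.commute[of r])
  also have "(\<Sum>z\<in>Z. \<nu> z * g z ^ Suc r)\<^sup>2 \<le> (\<Sum>z\<in>Z. (\<nu> z)\<^sup>2) * (\<Sum>z\<in>Z. (g z ^ Suc r)\<^sup>2)"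
    by (rule Cauchy_Schwarz_ineq_sum)
  also have "(\<Sum>z\<in>Z. (g z ^ Suc r)\<^sup>2) = (\<Sum>z\<in>Z. g z ^ (2 * Suc r))"
    by (simp only: power_mult[symmetric] mult.commute[of _ 2])
  also have "(\<Sum>z\<in>Z. (\<nu> z)\<^sup>2) = real (\<Sum>z\<in>Z. card ({t \<in> T. f t = z} \<times> {t \<in> T. f t = z}))"
    by (simp add: \<nu>_def power2_eq_square card_cartesian_product)
  also have "(\<Sum>z\<in>Z. card ({t \<in> T. f t = z} \<times> {t \<in> T. f t = z})) = card (\<Union>z\<in>Z. {t \<in> T. f t = z} \<times> {t \<in> T. f t = z})"
    by (rule card_UN_disjoint[symmetric]) (use Z T in auto)
  also have "(\<Union>z\<in>Z. {t \<in> T. f t = z} \<times> {t \<in> T. f t = z}) = {(s, t). s \<in> T \<and> t \<in> T \<and> f s = f t}"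
    using Z by auto
  finally have "((\<Sum>t\<in>T. g (f t)) ^ Suc r)\<^sup>2 \<le> real (card T) ^ (2 * r) *
      (real (card {(s, t). s \<in> T \<and> t \<in> T \<and> f s = f t}) * (\<Sum>z\<in>Z. g z ^ (2 * Suc r)))"
    by (simp add: mult_left_mono)
  thus ?thesis by (simp only: power_mult[symmetric] mult.commute[of _ 2] mult.assoc)
qed

lemma bilinear_cauchy_schwarz:
  fixes c :: "'k \<Rightarrow> 'm \<Rightarrow> 'n \<Rightarrow> complex"
  assumes fin: "finite K" "finite M" "finite N" and A: "\<And>m. m \<in> M \<Longrightarrow> norm (\<alpha> m) \<le> A" "A \<ge> 0"
    and c: "\<And>k m n. norm (c k m n) \<le> 1"
  shows "(norm (\<Sum>k\<in>K. \<Sum>m\<in>M. \<Sum>n\<in>N. \<alpha> m * \<beta> k n * c k m n))\<^sup>2 \<le>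
    (\<Sum>k\<in>K. \<Sum>n\<in>N. (norm (\<beta> k n))\<^sup>2) * (A\<^sup>2 * (real (card K) * real (card M) * real (card N) +
      (\<Sum>m1\<in>M. \<Sum>m2\<in>M - {m1}. norm (\<Sum>k\<in>K. \<Sum>n\<in>N. c k m1 n * cnj (c k m2 n)))))"
proof -
  let ?S = "\<Sum>k\<in>K. \<Sum>m\<in>M. \<Sum>n\<in>N. \<alpha> m * \<beta> k n * c k m n"
  define W where "W = (\<lambda>m1 m2. \<Sum>k\<in>K. \<Sum>n\<in>N. c k m1 n * cnj (c k m2 n))"
  define B where "B = (\<lambda>(k, n). \<Sum>m\<in>M. \<alpha> m * c k m n)"
  define b where "b = (\<lambda>(k, n). \<beta> k n)"
  have "?S = (\<Sum>k\<in>K. \<Sum>n\<in>N. b (k, n) * B (k, n))"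
    by (subst sum.swap[of _ N M]) (simp add: b_def B_def sum_distrib_left mult_ac)
  also have "\<dots> = (\<Sum>t\<in>K \<times> N. b t * B t)"
    by (simp add: sum.cartesian_product case_prod_unfold)
  finally have "norm ?S \<le> (\<Sum>t\<in>K \<times> N. norm (b t) * norm (B t))"
    by (simp only:) (rule sum_norm_le, simp add: norm_mult)
  hence "(norm ?S)\<^sup>2 \<le> (\<Sum>t\<in>K \<times> N. norm (b t) * norm (B t))\<^sup>2"
    by (intro power_mono) auto
  also have "\<dots> \<le> (\<Sum>t\<in>K \<times> N. (norm (b t))\<^sup>2) * (\<Sum>t\<in>K \<times> N. (norm (B t))\<^sup>2)"
    by (rule Cauchy_Schwarz_ineq_sum)
  also have "(\<Sum>t\<in>K \<times> N. (norm (b t))\<^sup>2) = (\<Sum>k\<in>K. \<Sum>n\<in>N. (norm (\<beta> k n))\<^sup>2)"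
    by (simp add: b_def sum.cartesian_product case_prod_unfold)
  also have "\<dots> * (\<Sum>t\<in>K \<times> N. (norm (B t))\<^sup>2) \<le> \<dots> * (A\<^sup>2 * (real (card K) * real (card M) * real (card N) +
      (\<Sum>m1\<in>M. \<Sum>m2\<in>M - {m1}. norm (W m1 m2))))"
  proof (rule mult_left_mono)
    have "complex_of_real (\<Sum>t\<in>K \<times> N. (norm (B t))\<^sup>2) = (\<Sum>t\<in>K \<times> N. B t * cnj (B t))"
      by (simp only: of_real_sum complex_norm_square)
    also have "\<dots> = (\<Sum>(k, n)\<in>K \<times> N. \<Sum>m1\<in>M. \<Sum>m2\<in>M. \<alpha> m1 * cnj (\<alpha> m2) * (c k m1 n * cnj (c k m2 n)))"
      unfolding B_def by (intro sum.cong refl) (auto simp: sum_product mult_ac)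
    also have "\<dots> = (\<Sum>m1\<in>M. \<Sum>(k, n)\<in>K \<times> N. \<Sum>m2\<in>M. \<alpha> m1 * cnj (\<alpha> m2) * (c k m1 n * cnj (c k m2 n)))"
      unfolding case_prod_unfold by (rule sum.swap)
    also have "\<dots> = (\<Sum>m1\<in>M. \<Sum>m2\<in>M. \<Sum>(k, n)\<in>K \<times> N. \<alpha> m1 * cnj (\<alpha> m2) * (c k m1 n * cnj (c k m2 n)))"
      unfolding case_prod_unfold by (intro sum.cong refl sum.swap)
    also have "\<dots> = (\<Sum>m1\<in>M. \<Sum>m2\<in>M. \<alpha> m1 * cnj (\<alpha> m2) * W m1 m2)"
      by (simp add: W_def sum_distrib_left sum.cartesian_product case_prod_unfold)
    finally have "norm (complex_of_real (\<Sum>t\<in>K \<times> N. (norm (B t))\<^sup>2)) \<le> (\<Sum>m1\<in>M. \<Sum>m2\<in>M. norm (\<alpha> m1 * cnj (\<alpha> m2) * W m1 m2))"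
      by (simp only:) (intro order.trans[OF norm_sum] sum_mono norm_sum)
    also have "\<dots> \<le> (\<Sum>m1\<in>M. \<Sum>m2\<in>M. A\<^sup>2 * norm (W m1 m2))"
    proof (intro sum_mono)
      fix m1 m2 assume "m1 \<in> M" "m2 \<in> M"
      hence "norm (\<alpha> m1) * norm (\<alpha> m2) \<le> A * A" using A by (intro mult_mono) auto
      thus "norm (\<alpha> m1 * cnj (\<alpha> m2) * W m1 m2) \<le> A\<^sup>2 * norm (W m1 m2)"
        by (simp add: norm_mult power2_eq_square mult_right_mono)
    qed
    also have "\<dots> = A\<^sup>2 * (\<Sum>m1\<in>M. norm (W m1 m1) + (\<Sum>m2\<in>M - {m1}. norm (W m1 m2)))"
      unfolding sum_distrib_left[symmetric]
      by (intro arg_cong[of _ _ "\<lambda>x. A\<^sup>2 * x"] sum.cong refl sum.remove fin)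
    also have "\<dots> \<le> A\<^sup>2 * (\<Sum>m1\<in>M. real (card K) * real (card N) + (\<Sum>m2\<in>M - {m1}. norm (W m1 m2)))"
    proof (intro mult_left_mono sum_mono add_right_mono)
      fix m
      have "norm (W m m) \<le> (\<Sum>k\<in>K. \<Sum>n\<in>N. 1)"
        unfolding W_def by (intro sum_norm_le) (simp add: norm_mult mult_le_one c)
      thus "norm (W m m) \<le> real (card K) * real (card N)" by simp
    qed simp
    also have "\<dots> = A\<^sup>2 * (real (card K) * real (card M) * real (card N) + (\<Sum>m1\<in>M. \<Sum>m2\<in>M - {m1}. norm (W m1 m2)))"
      by (simp add: sum.distrib)
    finally show "(\<Sum>t\<in>K \<times> N. (norm (B t))\<^sup>2) \<le> A\<^sup>2 * (real (card K) * real (card M) * real (card N) +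
      (\<Sum>m1\<in>M. \<Sum>m2\<in>M - {m1}. norm (W m1 m2)))"
      unfolding norm_of_real by linarith
  qed (intro sum_nonneg, simp)
  finally show ?thesis unfolding W_def .
qed

lemma convex_nat_set_is_interval:
  fixes S :: "nat set"
  assumes "S \<subseteq> {..<V}" and convex: "\<And>x y z. x \<in> S \<Longrightarrow> z \<in> S \<Longrightarrow> x \<le> y \<Longrightarrow> y \<le> z \<Longrightarrow> y \<in> S"
  obtains a b where "S = {a..<b}" "a \<le> b" "b \<le> V"
proof (cases "S = {}")
  case True
  thus ?thesis using that[of 0 0] by simp
next
  case False
  have fin: "finite S" using assms(1) finite_subset by blast
  have "S = {Min S..<Suc (Max S)}"
  proof (intro equalityI subsetI)
    fix y assume "y \<in> {Min S..<Suc (Max S)}"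
    thus "y \<in> S" using convex[of "Min S" "Max S" y] fin False by simp
  qed (use fin in \<open>simp add: less_Suc_eq_le\<close>)
  moreover have "Max S < V" using assms(1) Max_in[OF fin False] by auto
  moreover have "Min S \<le> Suc (Max S)" using fin False by (simp add: le_SucI)
  ultimately show ?thesis using that by (metis Suc_leI)
qed

section \<open>Shifts by u v and the points that they produce\<close>

context
  fixes p :: nat and chi :: "int \<Rightarrow> complex" and a b K M N U :: int and s :: nat
    and Mx :: "int \<Rightarrow> int \<Rightarrow> real"
  assumes chi: "dirichlet_character p chi" and p: "prime p" and b: "\<not> int p dvd b"
    and lt: "M < int p" "U < int p" and UN: "U * 2 ^ s \<le> N" and U: "U \<ge> 1"
    and Mx: "\<And>x y i j. i \<le> j \<Longrightarrow> j \<le> 2 ^ s \<Longrightarrow> norm (\<Sum>v=i..<j. chi (x + int v) * cnj (chi (y + int v))) \<le> Mx x y"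
begin

definition inv_mod :: "int \<Rightarrow> int" where
  "inv_mod c = (SOME w. [c * w = 1] (mod int p))"

definition shift_point :: "int \<Rightarrow> int \<Rightarrow> int \<Rightarrow> int \<Rightarrow> int" where
  "shift_point k n u m = ((a * k + b * m * n) * inv_mod (b * m * u)) mod int p"

lemma not_dvd_bmu:
  assumes "u \<in> {1..U}" "m \<in> {1..M}"
  shows "\<not> int p dvd b * m * u"
proof -
  have "\<not> int p dvd x" if "0 < x" "x < int p" for x using that zdvd_not_zless by blast
  thus ?thesis using assms b lt p by (auto simp: prime_dvd_mult_iff)
qed

lemma inv_mod:
  assumes "\<not> int p dvd c"
  shows "[c * inv_mod c = 1] (mod int p)"
proof -
  have "prime (int p)" using p by simp
  hence "coprime (int p) c" using assms by (rule prime_imp_coprime)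
  hence "\<exists>w. [c * w = 1] (mod int p)" by (intro cong_solve_coprime_int) (simp only: coprime_commute)
  thus ?thesis unfolding inv_mod_def by (rule someI_ex)
qed

lemma shift_point_cong:
  assumes "u \<in> {1..U}" "m \<in> {1..M}"
  shows "[b * m * u * shift_point k n u m = a * k + b * m * n] (mod int p)"
proof -
  have "[b * m * u * shift_point k n u m = b * m * u * ((a * k + b * m * n) * inv_mod (b * m * u))] (mod int p)"
    unfolding shift_point_def by (simp add: cong_def mod_simps)
  also have "b * m * u * ((a * k + b * m * n) * inv_mod (b * m * u)) = (a * k + b * m * n) * (b * m * u * inv_mod (b * m * u))"
    by (simp only: mult_ac)
  also have "[(a * k + b * m * n) * (b * m * u * inv_mod (b * m * u)) = (a * k + b * m * n) * 1] (mod int p)"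
    by (intro cong_scalar_left inv_mod not_dvd_bmu assms)
  finally show ?thesis by simp
qed

text \<open>Modulo \<open>p\<close>, a k + b m (n + u v) = b m u (x + v) with x the shift point, so
  both characters factor, and \<open>\<theta>\<close> collects the parts free of v. The condition on
  n + u v leaves an interval of v.\<close>

lemma inner_shift_bound:
  assumes u: "u \<in> {1..U}" and m: "m1 \<in> {1..M}" "m2 \<in> {1..M}"
  shows "norm (\<Sum>v | v < 2 ^ s \<and> n + u * int v \<in> {1..N}.
           chi (a * k + b * m1 * (n + u * int v)) * cnj (chi (a * k + b * m2 * (n + u * int v))))
         \<le> Mx (shift_point k n u m1) (shift_point k n u m2)"
proof -
  define S where "S = {v :: nat. v < 2 ^ s \<and> n + u * int v \<in> {1..N}}"
  define x where "x = shift_point k n u m1"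
  define y where "y = shift_point k n u m2"
  define \<theta> where "\<theta> = chi (b * m1 * u) * cnj (chi (b * m2 * u))"
  have p0: "p > 0" using p by (rule prime_gt_0_nat)
  obtain i j where S: "S = {i..<j}" "i \<le> j" "j \<le> 2 ^ s"
  proof (rule convex_nat_set_is_interval[of S "2 ^ s"])
    fix v1 v v2 assume v: "v1 \<in> S" "v2 \<in> S" "v1 \<le> v" "v \<le> v2"
    have "u * int v1 \<le> u * int v" "u * int v \<le> u * int v2" using v u by (auto intro!: mult_left_mono)
    thus "v \<in> S" using v by (auto simp: S_def)
  qed (auto simp: S_def)
  have *: "chi (a * k + b * m * (n + u * int v)) = chi (b * m * u) * chi (shift_point k n u m + int v)"
    if "m \<in> {1..M}" for m v
  proof -
    have "[a * k + b * m * n + b * m * u * int v = b * m * u * shift_point k n u m + b * m * u * int v] (mod int p)"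
      by (intro cong_add cong_refl cong_sym[OF shift_point_cong] u that)
    hence "[a * k + b * m * (n + u * int v) = b * m * u * (shift_point k n u m + int v)] (mod int p)"
      by (simp add: algebra_simps)
    thus ?thesis using dirichlet_characterD(1,2)[OF chi] by metis
  qed
  have "(\<Sum>v\<in>S. chi (a * k + b * m1 * (n + u * int v)) * cnj (chi (a * k + b * m2 * (n + u * int v))))
      = (\<Sum>v=i..<j. \<theta> * (chi (x + int v) * cnj (chi (y + int v))))"
    unfolding S(1) *[OF m(1)] *[OF m(2)] by (intro sum.cong refl) (simp add: \<theta>_def x_def y_def mult_ac)
  also have "\<dots> = \<theta> * (\<Sum>v=i..<j. chi (x + int v) * cnj (chi (y + int v)))"
    by (rule sum_distrib_left[symmetric])
  also have "norm \<dots> \<le> 1 * Mx x y"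
    unfolding norm_mult
    by (intro mult_mono Mx S) (simp_all add: \<theta>_def norm_mult mult_le_one norm_dirichlet_character_le[OF chi p0])
  finally show ?thesis unfolding S_def x_def y_def by simp
qed

lemma sum_shift_tuples:
  "(\<Sum>(k, n, u, m1, m2)\<in>shift_tuples K M N U. g k n u m1 m2) =
   (\<Sum>m1\<in>{1..M}. \<Sum>m2\<in>{1..M} - {m1}. \<Sum>k\<in>{1..K}. \<Sum>n\<in>{-N..N}. \<Sum>u\<in>{1..U}. (g k n u m1 m2 :: real))"
proof -
  let ?B = "\<lambda>m1. ({1..M} - {m1}) \<times> {1..K} \<times> {-N..N} \<times> {1..U}"
  have "(\<Sum>m1\<in>{1..M}. \<Sum>m2\<in>{1..M} - {m1}. \<Sum>k\<in>{1..K}. \<Sum>n\<in>{-N..N}. \<Sum>u\<in>{1..U}. g k n u m1 m2)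
      = (\<Sum>m1\<in>{1..M}. \<Sum>(m2, k, n, u)\<in>?B m1. g k n u m1 m2)"
    unfolding sum.cartesian_product ..
  also have "\<dots> = (\<Sum>(m1, m2, k, n, u)\<in>Sigma {1..M} ?B. g k n u m1 m2)"
    by (rule sum.Sigma) auto
  also have "\<dots> = (\<Sum>(k, n, u, m1, m2)\<in>shift_tuples K M N U. g k n u m1 m2)"
    by (rule sum.reindex_bij_witness[of _ "\<lambda>(k, n, u, m1, m2). (m1, m2, k, n, u)" "\<lambda>(m1, m2, k, n, u). (k, n, u, m1, m2)"])
       (auto simp: shift_tuples_def)
  finally show ?thesis ..
qed

text \<open>For each of the U 2^s pairs (u, v) the sum over \<open>n\<close> is unchanged by the
  translation through u v. Extended by 0 to -N..N its range no longer depends on the pair, so the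
  sum over \<open>v\<close> can be moved inside.\<close>

theorem offdiagonal_shift_bound:
  "real_of_int U * 2 ^ s * (\<Sum>m1\<in>{1..M}. \<Sum>m2\<in>{1..M} - {m1}. 
      norm (\<Sum>k\<in>{1..K}. \<Sum>n\<in>{1..N}. chi (a * k + b * m1 * n) * cnj (chi (a * k + b * m2 * n))))
   \<le> (\<Sum>(k, n, u, m1, m2)\<in>shift_tuples K M N U. Mx (shift_point k n u m1) (shift_point k n u m2))"
  unfolding sum_shift_tuples sum_distrib_left
proof (intro sum_mono)
  fix m1 m2 assume m: "m1 \<in> {1..M}" "m2 \<in> {1..M} - {m1}"
  let ?R = "\<Sum>k\<in>{1..K}. \<Sum>n\<in>{-N..N}. \<Sum>u\<in>{1..U}. Mx (shift_point k n u m1) (shift_point k n u m2)"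
  define F where "F = (\<lambda>k n. chi (a * k + b * m1 * n) * cnj (chi (a * k + b * m2 * n)))"
  define W where "W = (\<Sum>k\<in>{1..K}. \<Sum>n\<in>{1..N}. F k n)"
  define F' where "F' = (\<lambda>k u v n. if n + u * int v \<in> {1..N} then F k (n + u * int v) else 0)"
  have shift: "(\<Sum>n\<in>{1..N}. F k n) = (\<Sum>n\<in>{-N..N}. F' k u v n)"
    if u: "u \<in> {1..U}" and v: "v \<in> {..<2 ^ s}" for k u v
  proof -
    have "u * int v \<le> U * 2 ^ s"
      using u v by (intro mult_mono) (auto simp flip: of_nat_less_iff)
    hence "0 \<le> u * int v" "u * int v \<le> N" using UN u by auto
    hence "(\<Sum>n\<in>{1..N}. F k n) = (\<Sum>n\<in>{n \<in> {-N..N}. n + u * int v \<in> {1..N}}. F k (n + u * int v))"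
      by (intro sum.reindex_bij_witness[of _ "\<lambda>n. n + u * int v" "\<lambda>n. n - u * int v"]) auto
    also have "\<dots> = (\<Sum>n\<in>{-N..N}. F' k u v n)"
      unfolding F'_def by (rule sum.inter_filter) simp
    finally show ?thesis .
  qed
  have "of_int U * 2 ^ s * W = (\<Sum>u\<in>{1..U}. \<Sum>v\<in>{..<(2 :: nat) ^ s}. W)"
    using U by simp
  also have "\<dots> = (\<Sum>u\<in>{1..U}. \<Sum>v\<in>{..<(2 :: nat) ^ s}. \<Sum>k\<in>{1..K}. \<Sum>n\<in>{-N..N}.  F' k u v n)"
    unfolding W_def by (intro sum.cong refl shift)
  also have "\<dots> = (\<Sum>u\<in>{1..U}. \<Sum>k\<in>{1..K}. \<Sum>v\<in>{..<(2 :: nat) ^ s}. \<Sum>n\<in>{-N..N}.  F' k u v n)"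
    by (intro sum.cong refl sum.swap)
  also have "\<dots> = (\<Sum>k\<in>{1..K}. \<Sum>u\<in>{1..U}. \<Sum>v\<in>{..<(2 :: nat) ^ s}. \<Sum>n\<in>{-N..N}.  F' k u v n)"
    by (rule sum.swap)
  also have "\<dots> = (\<Sum>k\<in>{1..K}. \<Sum>u\<in>{1..U}. \<Sum>n\<in>{-N..N}. \<Sum>v\<in>{..<(2 :: nat) ^ s}.  F' k u v n)"
    by (intro sum.cong refl sum.swap)
  also have "\<dots> = (\<Sum>k\<in>{1..K}. \<Sum>n\<in>{-N..N}. \<Sum>u\<in>{1..U}. \<Sum>v\<in>{..<(2 :: nat) ^ s}.  F' k u v n)"
    by (intro sum.cong refl sum.swap)
  also have "\<dots> = (\<Sum>k\<in>{1..K}. \<Sum>n\<in>{-N..N}. \<Sum>u\<in>{1..U}. \<Sum>v | v < 2 ^ s \<and> n + u * int v \<in> {1..N}. F k (n + u * int v))"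
  proof -
    have "(\<Sum>v\<in>{..<(2 :: nat) ^ s}. F' k u v n) =
        (\<Sum>v | v < 2 ^ s \<and> n + u * int v \<in> {1..N}. F k (n + u * int v))" for k n u
      unfolding F'_def by (subst sum.inter_filter[symmetric]) (simp_all only: finite_lessThan lessThan_iff)
    thus ?thesis by (simp only:)
  qed
  finally have eq: "of_int U * 2 ^ s * W = (\<Sum>k\<in>{1..K}. \<Sum>n\<in>{-N..N}. \<Sum>u\<in>{1..U}. 
      \<Sum>v | v < 2 ^ s \<and> n + u * int v \<in> {1..N}. F k (n + u * int v))" .
  have "real_of_int U * 2 ^ s * norm W = norm (of_int U * 2 ^ s * W)"
    using U by (simp add: norm_mult norm_power)
  also have "\<dots> \<le> ?R"
    unfolding eq F_def using m by (intro sum_norm_le inner_shift_bound) auto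
  finally show "real_of_int U * 2 ^ s * norm (\<Sum>k\<in>{1..K}. \<Sum>n\<in>{1..N}. chi (a * k + b * m1 * n) * cnj (chi (a * k + b * m2 * n)))
      \<le> ?R"
    unfolding W_def F_def .
qed

definition shift_pair :: "tuple5 \<Rightarrow> int \<times> int" where
  "shift_pair = (\<lambda>(k, n, u, m1, m2). (shift_point k n u m1, shift_point k n u m2))"

lemma shift_point_collision:
  assumes "u \<in> {1..U}" "m \<in> {1..M}" "u' \<in> {1..U}" "m' \<in> {1..M}"
    and eq: "shift_point k n u m = shift_point k' n' u' m'"
  shows "[(a * k + b * m * n) * (u' * m') = (a * k' + b * m' * n') * (u * m)] (mod int p)"
proof -
  define x where "x = shift_point k n u m"
  have "[(a * k + b * m * n) * (u' * m') = (b * m * u * x) * (u' * m')] (mod int p)"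
    unfolding x_def by (intro cong_scalar_right cong_sym[OF shift_point_cong] assms)
  also have "(b * m * u * x) * (u' * m') = (b * m' * u' * x) * (u * m)" by (simp only: mult_ac)
  also have "[(b * m' * u' * x) * (u * m) = (a * k' + b * m' * n') * (u * m)] (mod int p)"
    unfolding x_def eq by (intro cong_scalar_right shift_point_cong assms)
  finally show ?thesis .
qed

lemma shift_pair_collisions:
  "{(t, t'). t \<in> shift_tuples K M N U \<and> t' \<in> shift_tuples K M N U \<and> shift_pair t = shift_pair t'}
     \<subseteq> collisions p a b (shift_tuples K M N U)"
  by (auto simp: collisions_def shift_pair_def shift_tuples_def intro!: shift_point_collision)

theorem offdiagonal_moment_bound:
  "(real_of_int U * 2 ^ s * (\<Sum>m1\<in>{1..M}. \<Sum>m2\<in>{1..M} - {m1}. 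
      norm (\<Sum>k\<in>{1..K}. \<Sum>n\<in>{1..N}. chi (a * k + b * m1 * n) * cnj (chi (a * k + b * m2 * n))))) ^ (2 * Suc r)
   \<le> real (card (shift_tuples K M N U)) ^ (2 * r) * real (card (collisions p a b (shift_tuples K M N U))) *
     (\<Sum>x\<in>{0..<int p}. \<Sum>y\<in>{0..<int p}. Mx x y ^ (2 * Suc r))" (is "(?u * ?S) ^ _ \<le> ?R")
proof -
  let ?T = "shift_tuples K M N U" and ?Z = "{0..<int p} \<times> {0..<int p}"
  have Mx0: "Mx x y \<ge> 0" for x y using order.trans[OF norm_ge_zero Mx[of 0 0 x y]] by simp
  have p0: "int p > 0" using p by (simp add: prime_gt_0_nat)
  have fin: "finite (collisions p a b ?T)"
    by (rule finite_subset[of _ "?T \<times> ?T"]) (auto simp: collisions_def finite_shift_tuples)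
  have "?u * ?S \<le> (\<Sum>t\<in>?T. case_prod Mx (shift_pair t))"
    using offdiagonal_shift_bound by (simp add: shift_pair_def case_prod_unfold)
  hence "(?u * ?S) ^ (2 * Suc r) \<le> (\<Sum>t\<in>?T. case_prod Mx (shift_pair t)) ^ (2 * Suc r)"
    using U by (intro power_mono mult_nonneg_nonneg sum_nonneg) auto
  also have "\<dots> \<le> real (card ?T) ^ (2 * r) * real (card {(t, t'). t \<in> ?T \<and> t' \<in> ?T \<and> shift_pair t = shift_pair t'}) *
      (\<Sum>z\<in>?Z. case_prod Mx z ^ (2 * Suc r))"
    by (rule fibre_holder) (use Mx0 p0 in \<open>auto simp: finite_shift_tuples shift_pair_def shift_point_def\<close>)
  also have "\<dots> \<le> real (card ?T) ^ (2 * r) * real (card (collisions p a b ?T)) * (\<Sum>z\<in>?Z. case_prod Mx z ^ (2 * Suc r))"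
    by (intro mult_right_mono mult_left_mono sum_nonneg)
       (use card_mono[OF fin shift_pair_collisions] Mx0 in \<open>auto intro!: zero_le_power simp del: power_Suc\<close>)
  also have "(\<Sum>z\<in>?Z. case_prod Mx z ^ (2 * Suc r)) = (\<Sum>x\<in>{0..<int p}. \<Sum>y\<in>{0..<int p}. Mx x y ^ (2 * Suc r))"
    by (simp only: sum.cartesian_product case_prod_unfold)
  finally show ?thesis .
qed

end

section \<open>The trilinear sum\<close>

lemma sum_pos_upto_int: "(\<Sum>k\<in>pos_upto K. f (int k)) = (\<Sum>k\<in>{1..\<lfloor>K\<rfloor>}. f k)"
  by (rule sum.reindex_bij_witness[of _ nat int]) (auto simp: pos_upto_altdef le_nat_iff nat_le_iff, linarith)

lemma sum_pos_upto_remove_int: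
  "(\<Sum>k\<in>pos_upto K - {j}. f (int k)) = (\<Sum>k\<in>{1..\<lfloor>K\<rfloor>} - {int j}. f k)"
  by (rule sum.reindex_bij_witness[of _ nat int]) (auto simp: pos_upto_altdef le_nat_iff nat_le_iff, linarith)

lemma card_pos_upto_le: "K > 0 \<Longrightarrow> real (card (pos_upto K)) \<le> K"
  by (simp add: pos_upto_altdef)

lemma exists_power_two_between:
  fixes x :: real
  assumes "x > 1"
  obtains s where "x \<le> 2 ^ s" "2 ^ s < 2 * x"
proof -
  define s where "s = (LEAST s. x \<le> 2 ^ s)"
  have ex: "\<exists>s. x \<le> 2 ^ s" using real_arch_pow[of 2 x] by (auto intro: less_imp_le)
  have s: "x \<le> 2 ^ s" unfolding s_def by (rule LeastI_ex[OF ex])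
  hence "s \<noteq> 0" using assms by (intro notI) simp
  then obtain t where t: "s = Suc t" by (cases s) auto
  have "\<not> x \<le> 2 ^ t" using not_less_Least[of t "\<lambda>s. x \<le> 2 ^ s"] t by (simp add: s_def)
  thus ?thesis using s t by (intro that[of s]) auto
qed

definition offdiagonal_sum :: "(int \<Rightarrow> complex) \<Rightarrow> int \<Rightarrow> int \<Rightarrow> real \<Rightarrow> real \<Rightarrow> real \<Rightarrow> real" where
  "offdiagonal_sum chi a b K M N = (\<Sum>m1\<in>{1..\<lfloor>M\<rfloor>}. \<Sum>m2\<in>{1..\<lfloor>M\<rfloor>} - {m1}. 
      norm (\<Sum>k\<in>{1..\<lfloor>K\<rfloor>}. \<Sum>n\<in>{1..\<lfloor>N\<rfloor>}. chi (a * k + b * m1 * n) * cnj (chi (a * k + b * m2 * n))))"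

lemma trilinear_sum_square_le:
  assumes chi: "dirichlet_character p chi" and p: "p > 0" and K: "K > 1" "M > 1" "N > 1"
  shows "(norm (trilinear_sum chi a b K M N \<alpha> \<beta>))\<^sup>2 \<le>
    (l2_norm K N \<beta>)\<^sup>2 * ((sup_norm M \<alpha>)\<^sup>2 * (K * M * N + offdiagonal_sum chi a b K M N))"
proof -
  have A: "norm (\<alpha> m) \<le> sup_norm M \<alpha>" if "m \<in> pos_upto M" for m
    unfolding sup_norm_def using that by (intro Max_ge) auto
  obtain m0 where "m0 \<in> pos_upto M" using pos_upto_nonempty[of M] K by blast
  hence A0: "sup_norm M \<alpha> \<ge> 0" using A norm_ge_zero order.trans by blast
  have off: "offdiagonal_sum chi a b K M N = (\<Sum>m1\<in>pos_upto M. \<Sum>m2\<in>pos_upto M - {m1}. 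
      norm (\<Sum>k\<in>pos_upto K. \<Sum>n\<in>pos_upto N. chi (a * int k + b * int m1 * int n) * cnj (chi (a * int k + b * int m2 * int n))))"
    unfolding offdiagonal_sum_def sum_pos_upto_int[symmetric] sum_pos_upto_remove_int[symmetric] ..
  have "(norm (trilinear_sum chi a b K M N \<alpha> \<beta>))\<^sup>2 \<le>
    (\<Sum>k\<in>pos_upto K. \<Sum>n\<in>pos_upto N. (norm (\<beta> k n))\<^sup>2) * ((sup_norm M \<alpha>)\<^sup>2 *
     (real (card (pos_upto K)) * real (card (pos_upto M)) * real (card (pos_upto N)) + offdiagonal_sum chi a b K M N))"
    unfolding trilinear_sum_def off
    by (rule bilinear_cauchy_schwarz) (simp_all add: A A0 norm_dirichlet_character_le[OF chi p])
  also have "\<dots> \<le> (\<Sum>k\<in>pos_upto K. \<Sum>n\<in>pos_upto N. (norm (\<beta> k n))\<^sup>2) * ((sup_norm M \<alpha>)\<^sup>2 *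
     (K * M * N + offdiagonal_sum chi a b K M N))"
    using K by (intro mult_left_mono add_right_mono mult_mono card_pos_upto_le sum_nonneg mult_nonneg_nonneg) simp_all
  also have "(\<Sum>k\<in>pos_upto K. \<Sum>n\<in>pos_upto N. (norm (\<beta> k n))\<^sup>2) = (l2_norm K N \<beta>)\<^sup>2"
    unfolding l2_norm_def by (rule real_sqrt_pow2[symmetric]) (intro sum_nonneg zero_le_power2)
  finally show ?thesis .
qed

text \<open>This estimate serves when \<open>L1\<close> is so large that the divisor function cannot
  be bounded in terms of \<open>p\<close>.\<close>

lemma offdiagonal_sum_trivial:
  assumes chi: "dirichlet_character p chi" and p: "p > 0" and K: "K > 1" "M > 1" "N > 1"
  shows "offdiagonal_sum chi a b K M N \<le> K * N * M\<^sup>2"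
proof -
  have card: "real (card {1..\<lfloor>x\<rfloor>}) \<le> x" if "x > 1" for x :: real
    using that by simp
  have "offdiagonal_sum chi a b K M N \<le> (\<Sum>m1\<in>{1..\<lfloor>M\<rfloor>}. \<Sum>m2\<in>{1..\<lfloor>M\<rfloor>} - {m1}. K * N)"
    unfolding offdiagonal_sum_def
  proof (intro sum_mono)
    fix m1 m2
    let ?W = "norm (\<Sum>k\<in>{1..\<lfloor>K\<rfloor>}. \<Sum>n\<in>{1..\<lfloor>N\<rfloor>}. chi (a * k + b * m1 * n) * cnj (chi (a * k + b * m2 * n)))"
    have "?W \<le> (\<Sum>k\<in>{1..\<lfloor>K\<rfloor>}. \<Sum>n\<in>{1..\<lfloor>N\<rfloor>}. 1)"
      by (intro sum_norm_le) (simp add: norm_mult mult_le_one norm_dirichlet_character_le[OF chi p])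
    also have "\<dots> = real (card {1..\<lfloor>K\<rfloor>}) * real (card {1..\<lfloor>N\<rfloor>})" by simp
    also have "\<dots> \<le> K * N" using K by (intro mult_mono card) auto
    finally show "?W \<le> K * N" .
  qed
  also have "\<dots> \<le> (\<Sum>m1\<in>{1..\<lfloor>M\<rfloor>}. \<Sum>m2\<in>{1..\<lfloor>M\<rfloor>}. K * N)"
    using K by (intro sum_mono sum_mono2) auto
  also have "\<dots> = (real (card {1..\<lfloor>M\<rfloor>}))\<^sup>2 * (K * N)" by (simp add: power2_eq_square)
  also have "\<dots> \<le> M\<^sup>2 * (K * N)"
    using K by (intro mult_right_mono power_mono card) auto
  finally show ?thesis by (simp add: mult_ac)
qed

text \<open>The divisor function enters through the parameter \<open>D\<close>, so that the estimate
  is explicit and p^o(1) appears only at the end. \<open>\<Theta>\<close> collects what will be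
  absorbed there: constants, logarithms and D^3.\<close>

theorem offdiagonal_sum_bound:
  assumes nontriv: "nontrivial_character p chi" and p: "prime p" "p \<ge> 5"
    and ab: "\<not> int p dvd a" "\<not> int p dvd b" and r: "r \<ge> 2"
    and K: "K > 1" "M > 1" "N > 1" "K < p" "M < p" "N < p" and N: "N > 4 * real p powr (1 / r)"
    and D: "\<And>m :: nat. m > 0 \<Longrightarrow> real m \<le> 3 * L1 a b K M N * (real p)\<^sup>2 \<Longrightarrow> card {d. d dvd m} \<le> D"
  defines "\<Theta> \<equiv> 44 * real D ^ 3 * ((2 * (2 + log 2 p)) ^ (2 * r + 1) * (2 * real r) ^ (2 * r + 2))"
  defines "H0 \<equiv> 1 + L1 a b K M N * M * N * real p powr (- 1 - 1 / r)"
  shows "offdiagonal_sum chi a b K M N ^ (2 * r) \<le>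
    (3 * (K * N * M\<^sup>2)) ^ (2 * r) * (\<Theta> * H0\<^sup>2 * (real p powr (1 + 1 / r) / (K * (M * N)\<^sup>2)))"
proof -
  have chi: "dirichlet_character p chi" using nontriv by (simp add: nontrivial_character_def)
  define q where "q = real p powr (1 / r)"
  have p1: "real p > 1" using p by simp
  have q1: "q > 1" unfolding q_def using p1 r by simp
  \<comment> \<open>The block length 2^s is at least q with q^r = p, so the moment term V^r p^2 is
    at most V^(2 r) p. It stays below 2 q, which is at most \<open>p\<close> since r >= 2 and p >=
    5.\<close>
  obtain s where s: "q \<le> 2 ^ s" "2 ^ s < 2 * q" using exists_power_two_between[OF q1] .
  have qr: "q ^ r = p" unfolding q_def using p1 r by (simp add: powr_power)
  have "q \<le> real p powr (1 / 2)" unfolding q_def using p1 r by (intro powr_mono) (auto simp: field_simps)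
  also have "\<dots> = sqrt p" by (simp add: powr_half_sqrt)
  finally have q_sqrt: "q \<le> sqrt p" .
  have "(2 :: real) ^ s \<le> 2 * sqrt p" using s q_sqrt by simp
  also have "2 \<le> sqrt p" using p(2) by (intro real_le_rsqrt) simp
  hence "2 * sqrt p \<le> sqrt p * sqrt p" by (intro mult_right_mono) auto
  also have "sqrt p * sqrt p = p" by simp
  finally have "(2 :: real) ^ s \<le> real p" .
  hence sp: "(2 :: nat) ^ s \<le> p" by (metis of_nat_le_iff of_nat_numeral of_nat_power)
  define V where "V = (2 :: real) ^ s"
  have V: "V \<ge> q" "V < 2 * q" "V > 0" using s q1 by (auto simp: V_def)
  define U where "U = \<lfloor>N\<rfloor> div 2 ^ s"
  have U_eq: "U = \<lfloor>N / V\<rfloor>" unfolding U_def V_def using floor_divide_real_eq_div[of "2 ^ s" N] by simp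
  \<comment> \<open>Here N > 4 p^(1/r) enters: N / V is at least 2, so \<open>U\<close> is at least
    1 and rounding down costs at most a factor 2.\<close>
  have NV: "N / V \<ge> 2" using N V by (simp add: q_def[symmetric] field_simps)
  hence U1: "U \<ge> 1" unfolding U_eq by linarith
  have U_le: "real_of_int U \<le> N / V" unfolding U_eq by simp
  have U_ge: "real_of_int U \<ge> N / (4 * q)"
  proof -
    have "N / (4 * q) \<le> N / (2 * V)" using V K q1 by (intro divide_left_mono) auto
    also have "\<dots> = N / V / 2" by simp
    also have "\<dots> \<le> N / V - 1" using NV by simp
    also have "\<dots> \<le> real_of_int U" unfolding U_eq by linarith
    finally show ?thesis .
  qed
  have UN: "U * 2 ^ s \<le> \<lfloor>N\<rfloor>" 
  proof -
    have "U * 2 ^ s + \<lfloor>N\<rfloor> mod 2 ^ s = \<lfloor>N\<rfloor>" unfolding U_def by (rule div_mult_mod_eq)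
    moreover have "\<lfloor>N\<rfloor> mod 2 ^ s \<ge> 0" by simp
    ultimately show ?thesis by linarith
  qed
  have "N / V \<le> N" using V q1 K by (simp add: field_simps)
  hence Up: "real_of_int U < p" using U_le K by linarith
  let ?K = "\<lfloor>K\<rfloor>" and ?M = "\<lfloor>M\<rfloor>" and ?N = "\<lfloor>N\<rfloor>"
  let ?T = "shift_tuples ?K ?M ?N U" and ?cnt = "nat ?K * nat (2 * ?N + 1) * nat U * (nat ?M)\<^sup>2"
  have lt: "?K < int p" "?M < int p" "U < int p" using K Up by (simp_all add: floor_less_iff)
  have pos: "?K \<ge> 0" "?M \<ge> 0" "?N \<ge> 0" "U \<ge> 0" using K U1 by simp_all
  define L0 where "L0 = \<bar>a\<bar> * ?K + \<bar>b\<bar> * ?M * ?N"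
  define L where "L = L1 a b K M N"
  have L0: "L0 \<ge> 0" unfolding L0_def using pos by simp
  have L0L: "real_of_int L0 \<le> L"
    unfolding L0_def L_def L1_def of_int_add of_int_mult of_int_abs
    using K by (intro add_mono mult_mono) auto
  hence L: "L \<ge> 0" using L0 by linarith
  define H where "H = 2 * L0 * (U * ?M) div int p"
  have UM: "real_of_int (U * ?M) \<le> N / q * M"
  proof -
    have "N / V \<le> N / q" using V K q1 by (intro divide_left_mono) auto
    hence "real_of_int U \<le> N / q" using U_le by linarith
    thus ?thesis unfolding of_int_mult using K U1 q1 by (intro mult_mono) auto
  qed
  have coll: "card (collisions p a b ?T) \<le> ?cnt * (nat (2 * H + 1))\<^sup>2 * D ^ 3"
    unfolding H_def L0_def
  proof (rule card_collisions_le[OF p(1) ab lt pos])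
    fix m :: nat assume m: "m > 0" "int m \<le> 3 * (\<bar>a\<bar> * ?K + \<bar>b\<bar> * ?M * ?N) * (U * ?M)"
    have "real_of_int ?M \<le> p" using K by linarith
    have "real m \<le> real_of_int (3 * L0 * (U * ?M))" using m(2) by (simp only: L0_def)
    also have "\<dots> \<le> 3 * L * (real p)\<^sup>2"
      unfolding of_int_mult power2_eq_square
      using L0 L0L L Up K U1 \<open>real_of_int ?M \<le> p\<close> by (intro mult_mono) auto
    finally show "card {d. d dvd m} \<le> D" using D m(1) by (simp add: L_def)
  qed
  \<comment> \<open>The factor 3 comes from the at most 3 N values of \<open>n\<close>;
    \<open>P * U\<close> will bound the number of tuples.\<close>
  define P where "P = 3 * (K * N * M\<^sup>2)"
  have P0: "P > 0" unfolding P_def using K by simp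
  have P_bound: "real (?cnt) \<le> P * U"
  proof -
    have "real (nat (2 * ?N + 1)) \<le> 3 * N" using K by (simp add: of_nat_nat) linarith
    moreover have "real (nat ?K) \<le> K" "real (nat ?M) \<le> M" using K by (simp_all add: of_nat_nat)
    moreover have "real (nat U) = U" using U1 by simp
    ultimately have "real (?cnt) \<le> K * (3 * N) * U * M\<^sup>2"
      unfolding of_nat_mult of_nat_power using K U1 by (intro mult_mono power_mono) auto
    thus ?thesis by (simp add: P_def mult_ac)
  qed
  have H_bound: "real (nat (2 * H + 1)) \<le> 4 * H0"
  proof -
    have "real_of_int H \<le> real_of_int (2 * L0 * (U * ?M)) / real_of_int (int p)"
      unfolding H_def by (rule real_of_int_div4)
    also have "\<dots> \<le> 2 * L * (N / q * M) / p"
      using L0L L UM U1 K pos unfolding of_int_mult[of "2 * L0"] of_int_mult[of 2]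
      by (simp only: of_int_of_nat_eq of_int_numeral) (intro divide_right_mono mult_mono; simp add: L0)
    also have "\<dots> = 2 * (L * M * N * (1 / (q * p)))" by simp
    also have "1 / (q * p) = real p powr (- 1 - 1 / r)"
      using p1 unfolding q_def by (simp add: powr_diff powr_minus field_simps)
    finally have "real_of_int H \<le> 2 * (H0 - 1)" by (simp add: H0_def L_def)
    moreover have "H0 \<ge> 1" unfolding H0_def L_def[symmetric] using L K by simp
    ultimately show ?thesis by (simp add: of_nat_nat)
  qed
  have collP: "real (card (collisions p a b ?T)) \<le> P * U * (4 * H0)\<^sup>2 * real D ^ 3"
  proof -
    have "real (card (collisions p a b ?T)) \<le> real (?cnt) * real (nat (2 * H + 1)) ^ 2 * real D ^ 3"
      using coll by (metis of_nat_le_iff of_nat_mult of_nat_power)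
    also have "\<dots> \<le> P * U * (4 * H0)\<^sup>2 * real D ^ 3"
      using P_bound H_bound P0 U1 by (intro mult_mono power_mono mult_nonneg_nonneg zero_le_power) auto
    finally show ?thesis .
  qed
  have cardT: "real (card ?T) \<le> P * U"
  proof -
    have "card ?T \<le> card ({1..?K} \<times> {-?N..?N} \<times> {1..U} \<times> {1..?M} \<times> {1..?M})"
      by (rule card_mono[OF _ shift_tuples_subset]) auto
    also have "\<dots> = ?cnt"
      by (simp add: card_cartesian_product power2_eq_square)
    finally show ?thesis using P_bound by (meson of_nat_le_iff order.trans)
  qed
  obtain Mx where Mx: "\<And>x y i j. i \<le> j \<Longrightarrow> j \<le> 2 ^ s \<Longrightarrow> norm (\<Sum>v=i..<j. chi (x + int v) * cnj (chi (y + int v))) \<le> Mx x y"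
    and Mx_sum: "(\<Sum>x\<in>{0..<int p}. \<Sum>y\<in>{0..<int p}. Mx x y ^ (2 * r)) \<le> 
       (2 * (real s + 1)) ^ (2 * r) * (real s + 1) * (2 * real r) ^ (2 * r + 2) * 
       ((2 ^ s) ^ r * (real p)\<^sup>2 + (2 ^ s) ^ (2 * r) * real p)"
    by (rule interval_moment_bound[OF nontriv p(1) _ sp, of r]) (use p r in auto)
  define E where "E = (2 * (2 + log 2 p)) ^ (2 * r + 1) * (2 * real r) ^ (2 * r + 2)"
  \<comment> \<open>32 = 4^2 * 2: the square of the bound \<open>4 * H0\<close> for the number of
    lifts, and the two terms of the moment.\<close>
  let ?mom = "(\<Sum>x\<in>{0..<int p}. \<Sum>y\<in>{0..<int p}. Mx x y ^ (2 * r))" and ?Z = "32 * H0\<^sup>2 * real D ^ 3 * E * p"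
  have E0: "E \<ge> 0" unfolding E_def using p1 by (intro mult_nonneg_nonneg zero_le_power) auto
  have moment: "?mom \<le> E * (2 * (V ^ (2 * r) * p))"
  proof -
    have "2 ^ s < 2 * real p" using s q_sqrt \<open>2 \<le> sqrt p\<close> \<open>2 ^ s \<le> real p\<close> p1 by linarith
    hence "log 2 (2 ^ s) \<le> log 2 (2 * real p)" using p1 by (subst log_le_cancel_iff) auto
    hence "real s + 1 \<le> 2 + log 2 p" using p1 by (simp add: log_mult log_nat_power)
    hence "(2 * (real s + 1)) ^ (2 * r + 1) \<le> (2 * (2 + log 2 p)) ^ (2 * r + 1)" by (intro power_mono) auto
    moreover have "(2 * (real s + 1)) ^ (2 * r) * (real s + 1) \<le> (2 * (real s + 1)) ^ (2 * r + 1)"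
      unfolding power_add power_one_right by (intro mult_left_mono) auto
    ultimately have 1: "(2 * (real s + 1)) ^ (2 * r) * (real s + 1) \<le> (2 * (2 + log 2 p)) ^ (2 * r + 1)" by linarith
    have "real p \<le> V ^ r" unfolding qr[symmetric] using V q1 by (intro power_mono) auto
    hence "V ^ r * (real p * p) \<le> V ^ r * (V ^ r * p)" using V by (intro mult_left_mono mult_right_mono) auto
    also have "\<dots> = V ^ (2 * r) * p" by (simp add: mult_2 power_add)
    finally have 2: "V ^ r * (real p)\<^sup>2 + V ^ (2 * r) * p \<le> 2 * (V ^ (2 * r) * p)"
      unfolding power2_eq_square by linarith
    note Mx_sum
    also have "(2 * (real s + 1)) ^ (2 * r) * (real s + 1) * (2 * real r) ^ (2 * r + 2) * 
       ((2 ^ s) ^ r * (real p)\<^sup>2 + (2 ^ s) ^ (2 * r) * real p) \<le> E * (2 * (V ^ (2 * r) * p))"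
      unfolding E_def V_def[symmetric] using 1 2 V E0 p1
      by (intro mult_mono mult_right_mono mult_nonneg_nonneg add_nonneg_nonneg zero_le_power) (auto simp: E_def)
    finally show ?thesis .
  qed
  define S where "S = offdiagonal_sum chi a b K M N"
  have S0: "S \<ge> 0" unfolding S_def offdiagonal_sum_def by (intro sum_nonneg) simp
  define u where "u = real_of_int U"
  have U0: "u > 0" using U1 by (simp add: u_def)
  obtain r' where r': "r = Suc r'" using r by (cases r) auto
  have Mx0: "Mx x y \<ge> 0" for x y using order.trans[OF norm_ge_zero Mx[of 0 0 x y]] by simp
  have H01: "H0 \<ge> 1" unfolding H0_def L_def[symmetric] using L K by simp
  \<comment> \<open>On the right, (P u)^(2 r - 2) comes from the number of tuples and one more P u
    from the collisions, against u^(2 r) on the left. One factor P u is saved, and U >= N / (4 q)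
    turns it into p^(1 + 1/r) / (K (M N)^2).\<close>
  have "(u * V * S) ^ (2 * r) \<le> real (card ?T) ^ (2 * r') * real (card (collisions p a b ?T)) *
     ?mom"
    unfolding S_def V_def offdiagonal_sum_def r' u_def
    by (rule offdiagonal_moment_bound[OF chi p(1) ab(2) lt(2,3) UN U1 Mx])
  also have "\<dots> \<le> (P * u) ^ (2 * r') * (P * u * (4 * H0)\<^sup>2 * real D ^ 3) * (E * (2 * (V ^ (2 * r) * p)))"
    using P0 U0 E0 V by (intro mult_mono power_mono cardT[folded u_def] collP[folded u_def] moment sum_nonneg mult_nonneg_nonneg zero_le_power) 
       (use Mx0 H01 in \<open>auto simp: zero_le_even_power\<close>)
  also have "\<dots> = V ^ (2 * r) * (P ^ (2 * r') * u ^ (2 * r') * (P * u) * (?Z))"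
    by (simp add: power_mult_distrib)
  finally have "V ^ (2 * r) * (u ^ (2 * r) * S ^ (2 * r)) \<le> 
      V ^ (2 * r) * (P ^ (2 * r') * u ^ (2 * r') * (P * u) * (?Z))"
    by (simp only: power_mult_distrib mult_ac)
  hence "u ^ (2 * r) * S ^ (2 * r) \<le> P ^ (2 * r') * u ^ (2 * r') * (P * u) * (?Z)"
    using V by simp
  hence "(u ^ (2 * r') * u) * (u * S ^ (2 * r)) \<le> (u ^ (2 * r') * u) * (P ^ (2 * r') * P * (?Z))"
    by (simp add: r' mult_ac)
  hence "u * S ^ (2 * r) \<le> P ^ (2 * r') * P * (?Z)"
    using U0 by simp
  hence "P * (u * S ^ (2 * r)) \<le> P * (P ^ (2 * r') * P * (?Z))"
    using P0 by (intro mult_left_mono) auto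
  also have "\<dots> = P ^ (2 * r) * (?Z)" by (simp add: r')
  finally have "S ^ (2 * r) \<le> P ^ (2 * r) * (?Z) / (P * u)"
    using P0 U0 by (simp add: pos_le_divide_eq mult_ac)
  also have "\<dots> \<le> P ^ (2 * r) * (?Z) / (P * (N / (4 * q)))"
    using P0 U_ge[folded u_def] U0 K q1 E0 by (intro divide_left_mono mult_left_mono mult_nonneg_nonneg mult_pos_pos) auto
  also have "\<dots> = P ^ (2 * r) * ((32 * 4 / 3) * real D ^ 3 * E * H0\<^sup>2 * (q * p / (K * (M * N)\<^sup>2)))"
    unfolding P_def using K q1 by (simp add: field_simps power2_eq_square)
  \<comment> \<open>128 / 3 < 44, where 4 is from the lower bound for \<open>U\<close> and 3 from
    \<open>P\<close>.\<close>
  also have "\<dots> \<le> P ^ (2 * r) * (44 * real D ^ 3 * E * H0\<^sup>2 * (q * p / (K * (M * N)\<^sup>2)))"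
    using P0 K q1 E0 by (intro mult_left_mono mult_right_mono mult_nonneg_nonneg divide_nonneg_nonneg) auto
  also have "q * p = real p powr (1 + 1 / r)"
    using p1 unfolding q_def by (simp add: powr_add mult.commute)
  finally show ?thesis unfolding S_def P_def \<Theta>_def E_def .
qed


section \<open>Lower bounds for \<open>Delta2\<close>\<close>

lemma Delta2_ge:
  assumes "K > 1" "M > 1" "p > 0"
  shows "Delta2 p r a b K M N \<ge>
    (1 + L1 a b K M N * M * N * real p powr (- 1 - 1 / r)) powr (1 / (2 * real r)) *
    (real p powr (1 + 1 / r) / (K * (M * N)\<^sup>2)) powr (1 / (4 * real r)) + M powr (- 1 / 2)"
proof -
  have "1 \<le> (1 + K / M\<^sup>2) powr (1 / (4 * real r))"
    using assms by (intro ge_one_powr_ge_zero) auto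
  hence "1 * (1 + L1 a b K M N * M * N * real p powr (- 1 - 1 / r)) powr (1 / (2 * real r)) *
    (real p powr (1 + 1 / r) / (K * (M * N)\<^sup>2)) powr (1 / (4 * real r)) \<le>
    (1 + K / M\<^sup>2) powr (1 / (4 * real r)) * (1 + L1 a b K M N * M * N * real p powr (- 1 - 1 / r)) powr (1 / (2 * real r)) *
    (real p powr (1 + 1 / r) / (K * (M * N)\<^sup>2)) powr (1 / (4 * real r))"
    by (intro mult_right_mono) auto
  thus ?thesis unfolding Delta2_def by simp
qed

text \<open>With \<open>H\<close> and \<open>Q\<close> as in the proof, (H - 1)^2 Q = L^2 / (K p^(1
  + 1/r)), and K p^(1 + 1/r) <= p^3 is less than L^2.\<close>

lemma Delta2_ge_1_of_large_L1:
  assumes K: "K > 1" "M > 1" "N > 1" "K < p" and r: "r \<ge> 1" and L: "L1 a b K M N \<ge> real p ^ 4"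
  shows "Delta2 p r a b K M N \<ge> 1"
proof -
  define L where "L = L1 a b K M N"
  define H where "H = 1 + L * M * N * real p powr (- 1 - 1 / r)"
  define Q where "Q = real p powr (1 + 1 / r) / (K * (M * N)\<^sup>2)"
  have p1: "real p > 1" using K by linarith
  have L0: "L > 0" using assms(6) p1 zero_less_power[of "real p" 4] unfolding L_def by linarith
  have H0: "H > 0" unfolding H_def using L0 K by (simp add: add_pos_nonneg)
  have Q0: "Q \<ge> 0" unfolding Q_def using K by simp
  have "K * real p powr (1 + 1 / r) \<le> real p * real p powr 2"
    using K p1 r by (intro mult_mono powr_mono) auto
  also have "\<dots> = real p ^ 3" using p1 by (simp add: powr_realpow[of "real p" 2, simplified] eval_nat_numeral)
  also have "\<dots> \<le> (real p ^ 4)\<^sup>2" using p1 by (simp flip: power_mult)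
  also have "\<dots> \<le> L\<^sup>2" using assms(6) unfolding L_def by (intro power_mono) auto
  finally have *: "K * real p powr (1 + 1 / r) \<le> L\<^sup>2" .
  have "1 = (L * M * N * real p powr (- 1 - 1 / r))\<^sup>2 * Q * (K * real p powr (1 + 1 / r) / L\<^sup>2)"
  proof -
    have "real p powr (- 1 - 1 / r) = inverse (real p powr (1 + 1 / r))"
      by (subst powr_minus[symmetric]) simp
    thus ?thesis unfolding Q_def using K L0 p1 by (simp add: field_simps power2_eq_square)
  qed
  also have "\<dots> \<le> (L * M * N * real p powr (- 1 - 1 / r))\<^sup>2 * Q * 1"
    using * L0 Q0 by (intro mult_left_mono mult_nonneg_nonneg) simp_all
  also have "\<dots> \<le> H\<^sup>2 * Q * 1"
    unfolding H_def using Q0 L0 K by (intro mult_right_mono power_mono) auto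
  finally have "1 \<le> (H\<^sup>2 * Q) powr (1 / (4 * real r))" by (intro ge_one_powr_ge_zero) auto
  also have "\<dots> = (H powr 2) powr (1 / (4 * real r)) * Q powr (1 / (4 * real r))"
    using H0 Q0 by (simp add: powr_mult)
  also have "\<dots> = H powr (1 / (2 * real r)) * Q powr (1 / (4 * real r))"
    unfolding powr_powr by simp
  also have "\<dots> \<le> H powr (1 / (2 * real r)) * Q powr (1 / (4 * real r)) + M powr (- 1 / 2)" by simp
  also have "\<dots> \<le> Delta2 p r a b K M N"
    unfolding H_def Q_def L_def using K p1 by (intro Delta2_ge) auto
  finally show ?thesis .
qed

theorem theorem2p5:
  fixes r :: nat and \<epsilon> :: real
  assumes "r \<ge> 2" and "\<epsilon> > 0"
  shows "\<exists>p0::nat. \<forall>p::nat. prime p \<longrightarrow> p \<ge> p0 \<longrightarrow>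
    (\<forall>(chi :: int \<Rightarrow> complex) (a :: int) (b :: int) (K :: real) (M :: real) (N :: real)
       (\<alpha> :: nat \<Rightarrow> complex) (\<beta> :: nat \<Rightarrow> nat \<Rightarrow> complex).
       nontrivial_character p chi \<longrightarrow>
       gcd (a * b) (int p) = 1 \<longrightarrow>
       K > 1 \<longrightarrow> M > 1 \<longrightarrow> N > 1 \<longrightarrow>
       real p > Max {K, M, N} \<longrightarrow>
       N > 4 * real p powr (1 / real r) \<longrightarrow>
       norm (trilinear_sum chi a b K M N \<alpha> \<beta>)
         \<le> sup_norm M \<alpha> * l2_norm K N \<beta> * M * (N * K) powr (1 / 2) *
            Delta2 p r a b K M N * real p powr \<epsilon>)"
proof -
  \<comment> \<open>Divisors are counted of integers up to p^8, which gives p^(8 \<eta>) =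
    p^(\<epsilon> / 3); the cube of this in \<open>\<Theta>\<close> is p^\<epsilon>.\<close>
  define \<eta> where "\<eta> = \<epsilon> / 24"
  obtain C where C: "C \<ge> 1" "\<And>n. n > 0 \<Longrightarrow> real (card {d :: nat. d dvd n}) \<le> C * real n powr \<eta>"
    using divisor_bound[of \<eta>] assms(2) by (auto simp: \<eta>_def)
  define R where "R = (2 * real r) ^ (2 * r + 2)"
  have "eventually (\<lambda>p :: nat. 44 * C ^ 3 * ((2 * (2 + log 2 (real p))) ^ (2 * r + 1) * R) \<le> real p powr (\<epsilon> / 2)) sequentially"
    using assms(2) by real_asymp
  moreover have "eventually (\<lambda>p :: nat. 2 \<le> real p powr (\<epsilon> / 2)) sequentially"
    using assms(2) by real_asymp
  ultimately have "eventually (\<lambda>p :: nat. p \<ge> 5 \<and> 2 \<le> real p powr (\<epsilon> / 2) \<and>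
      44 * C ^ 3 * ((2 * (2 + log 2 (real p))) ^ (2 * r + 1) * R) \<le> real p powr (\<epsilon> / 2)) sequentially"
    using eventually_ge_at_top[of 5] by eventually_elim blast
  \<comment> \<open>\<open>C\<close> and \<open>R\<close> depend only on \<open>r\<close> and
    \<epsilon>, hence so does \<open>p0\<close>.\<close>
  then obtain p0 where p0: "\<And>p. p \<ge> p0 \<Longrightarrow> p \<ge> 5 \<and> 2 \<le> real p powr (\<epsilon> / 2) \<and>
      44 * C ^ 3 * ((2 * (2 + log 2 (real p))) ^ (2 * r + 1) * R) \<le> real p powr (\<epsilon> / 2)"
    by (auto simp: eventually_sequentially)
  show ?thesis
  proof (intro exI[of _ p0] allI impI)
    fix p :: nat and chi a b K M N \<alpha> \<beta>
    assume p: "prime p" "p \<ge> p0" and nontriv: "nontrivial_character p chi" and gcd: "gcd (a * b) (int p) = 1"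
      and K1: "K > 1" "M > 1" "N > 1" and max: "real p > Max {K, M, N}" and N: "N > 4 * real p powr (1 / real r)"
    note p0 = p0[OF p(2)]
    have p1: "real p > 1" using p0 by simp
    have K: "K > 1" "M > 1" "N > 1" "K < p" "M < p" "N < p" using K1 max by auto
    have chi: "dirichlet_character p chi" using nontriv by (simp add: nontrivial_character_def)
    have "\<not> int p dvd a * b"
    proof
      assume "int p dvd a * b"
      hence "int p dvd gcd (a * b) (int p)" by simp
      thus False using gcd p0 by simp
    qed
    hence ab: "\<not> int p dvd a" "\<not> int p dvd b" by auto
    let ?S = "trilinear_sum chi a b K M N \<alpha> \<beta>"
    define S where "S = offdiagonal_sum chi a b K M N"
    define A where "A = sup_norm M \<alpha>"
    define B where "B = l2_norm K N \<beta>"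
    have S0: "S \<ge> 0" unfolding S_def offdiagonal_sum_def by (intro sum_nonneg) simp
    have "B \<ge> 0" unfolding B_def l2_norm_def by (intro real_sqrt_ge_zero sum_nonneg) simp
    have "A \<ge> 0"
    proof -
      obtain m where "m \<in> pos_upto M" using pos_upto_nonempty K by blast
      hence "norm (\<alpha> m) \<le> A" unfolding A_def sup_norm_def by (intro Max_ge) auto
      thus ?thesis using norm_ge_zero order.trans by blast
    qed
    define G where "G = M * (N * K) powr (1 / 2)"
    define \<Delta> where "\<Delta> = Delta2 p r a b K M N"
    have G: "G = sqrt (K * N * M\<^sup>2)" unfolding G_def using K by (simp add: powr_half_sqrt real_sqrt_mult)
    have G0: "G > 0" unfolding G using K by simp
    have key: "sqrt (K * M * N + S) \<le> G * \<Delta> * real p powr \<epsilon>"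
    proof (cases "L1 a b K M N \<ge> real p ^ 4")
      case True
      have "\<Delta> \<ge> 1" unfolding \<Delta>_def using K assms(1) True by (intro Delta2_ge_1_of_large_L1) auto
      have "2 \<le> real p powr \<epsilon>"
      proof -
        have "real p powr (\<epsilon> / 2) \<le> real p powr \<epsilon>" using assms(2) p1 by (intro powr_mono) auto
        thus ?thesis using p0 by linarith
      qed
      have "K * N * M * 1 \<le> K * N * M * M" using K by (intro mult_left_mono) auto
      hence "K * M * N \<le> K * N * M\<^sup>2" unfolding power2_eq_square by (simp only: mult_ac mult_1)
      moreover have "0 \<le> K * N * M\<^sup>2" using K by simp
      moreover have "S \<le> K * N * M\<^sup>2"
        unfolding S_def using p1 K by (intro offdiagonal_sum_trivial[OF chi]) auto
      ultimately have "K * M * N + S \<le> 4 * (K * N * M\<^sup>2)" by linarith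
      hence "sqrt (K * M * N + S) \<le> sqrt (4 * (K * N * M\<^sup>2))" by (rule real_sqrt_le_mono)
      also have "\<dots> = G * 1 * 2" unfolding G by (simp add: real_sqrt_mult)
      also have "\<dots> \<le> G * \<Delta> * real p powr \<epsilon>"
        using \<open>\<Delta> \<ge> 1\<close> \<open>2 \<le> real p powr \<epsilon>\<close> G0 by (intro mult_mono) auto
      finally show ?thesis .
    next
      case False
      define D where "D = nat \<lfloor>C * real p powr (\<epsilon> / 3)\<rfloor>"
      define \<Theta> where "\<Theta> = 44 * real D ^ 3 * ((2 * (2 + log 2 p)) ^ (2 * r + 1) * (2 * real r) ^ (2 * r + 2))"
      define H where "H = 1 + L1 a b K M N * M * N * real p powr (- 1 - 1 / r)"
      define Q where "Q = real p powr (1 + 1 / r) / (K * (M * N)\<^sup>2)"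
      let ?HQ = "H powr (1 / (2 * real r)) * Q powr (1 / (4 * real r))"
      have D_bound: "card {d. d dvd m} \<le> D" if m: "m > 0" "real m \<le> 3 * L1 a b K M N * (real p)\<^sup>2" for m :: nat
      proof -
        have "real m \<le> 3 * L1 a b K M N * (real p)\<^sup>2" by (rule m(2))
        also have "\<dots> \<le> 3 * real p ^ 4 * (real p)\<^sup>2" using False by (intro mult_right_mono mult_left_mono) auto
        also have "\<dots> \<le> (real p)\<^sup>2 * real p ^ 4 * (real p)\<^sup>2"
        proof (intro mult_right_mono)
          have "5 * 5 \<le> real p * real p" using p0 by (intro mult_mono) auto
          thus "3 \<le> (real p)\<^sup>2" by (simp add: power2_eq_square)
        qed auto
        also have "\<dots> = real p powr 8" using p1 by (simp add: powr_realpow[of _ 8, simplified] flip: power_add)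
        finally have "real m powr \<eta> \<le> (real p powr 8) powr \<eta>" using assms(2) by (intro powr_mono2) (auto simp: \<eta>_def)
        also have "\<dots> = real p powr (\<epsilon> / 3)" unfolding powr_powr \<eta>_def by simp
        finally have "real (card {d. d dvd m}) \<le> C * real p powr (\<epsilon> / 3)"
          using C(1) order.trans[OF C(2)[OF m(1)] mult_left_mono] by auto
        thus ?thesis unfolding D_def by (rule le_nat_floor)
      qed
      have bound: "S ^ (2 * r) \<le> (3 * (K * N * M\<^sup>2)) ^ (2 * r) * (\<Theta> * H\<^sup>2 * Q)"
        unfolding S_def \<Theta>_def H_def Q_def using p0
        by (intro offdiagonal_sum_bound[OF nontriv p(1) _ ab assms(1) K N D_bound]) auto
      have "L1 a b K M N \<ge> 0" unfolding L1_def using K by simp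
      hence H1: "H \<ge> 1" unfolding H_def using K by simp
      have Q0: "Q \<ge> 0" unfolding Q_def using K by simp
      have \<Theta>0: "\<Theta> \<ge> 0" unfolding \<Theta>_def using p1 by (intro mult_nonneg_nonneg zero_le_power) auto
      have \<Theta>: "\<Theta> \<le> real p powr (3 * \<epsilon> / 2)"
      proof -
        have "real D \<le> C * real p powr (\<epsilon> / 3)" unfolding D_def using C(1) by (intro of_nat_floor) simp
        hence "real D ^ 3 \<le> (C * real p powr (\<epsilon> / 3)) ^ 3" by (intro power_mono) auto
        also have "\<dots> = C ^ 3 * real p powr \<epsilon>" using p1 by (simp add: power_mult_distrib powr_power)
        finally have "44 * real D ^ 3 * ((2 * (2 + log 2 p)) ^ (2 * r + 1) * R) \<le>
            44 * (C ^ 3 * real p powr \<epsilon>) * ((2 * (2 + log 2 p)) ^ (2 * r + 1) * R)"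
          unfolding R_def using p1 by (intro mult_right_mono mult_left_mono mult_nonneg_nonneg zero_le_power) auto
        also have "\<dots> = 44 * C ^ 3 * ((2 * (2 + log 2 p)) ^ (2 * r + 1) * R) * real p powr \<epsilon>" by (simp only: mult_ac)
        also have "\<dots> \<le> real p powr (\<epsilon> / 2) * real p powr \<epsilon>" using p0 by (intro mult_right_mono) auto
        also have "\<dots> = real p powr (3 * \<epsilon> / 2)" by (simp flip: powr_add)
        finally show ?thesis unfolding \<Theta>_def R_def .
      qed
      define Y where "Y = \<Theta> * H\<^sup>2 * Q"
      have Y0: "Y \<ge> 0" unfolding Y_def using \<Theta>0 Q0 by simp
      have "S ^ (2 * r) \<le> (3 * (K * N * M\<^sup>2) * Y powr (1 / (2 * real r))) ^ (2 * r)"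
      proof -
        have "(Y powr (1 / (2 * real r))) ^ (2 * r) = Y"
          using Y0 assms(1) by (cases "Y = 0") (simp_all add: powr_power)
        thus ?thesis using bound unfolding power_mult_distrib[of "3 * (K * N * M\<^sup>2)"] Y_def by simp
      qed
      moreover have "2 * r = Suc (2 * r - 1)" using assms(1) by simp
      ultimately have "S ^ Suc (2 * r - 1) \<le> (3 * (K * N * M\<^sup>2) * Y powr (1 / (2 * real r))) ^ Suc (2 * r - 1)"
        by (simp only:)
      hence "S \<le> 3 * (K * N * M\<^sup>2) * Y powr (1 / (2 * real r))"
        by (rule power_le_imp_le_base) (use K in simp)
      hence "sqrt S \<le> sqrt (3 * (K * N * M\<^sup>2) * Y powr (1 / (2 * real r)))" by (rule real_sqrt_le_mono)
      also have "\<dots> = sqrt 3 * G * sqrt (Y powr (1 / (2 * real r)))" by (simp add: G real_sqrt_mult)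
      also have "sqrt (Y powr (1 / (2 * real r))) = Y powr (1 / (4 * real r))"
        by (simp add: powr_half_sqrt[symmetric] powr_powr)
      also have "Y powr (1 / (4 * real r)) = \<Theta> powr (1 / (4 * real r)) * (?HQ)"
      proof -
        have "(H\<^sup>2) powr (1 / (4 * real r)) = (H powr 2) powr (1 / (4 * real r))" using H1 by simp
        also have "\<dots> = H powr (1 / (2 * real r))" unfolding powr_powr by simp
        finally show ?thesis unfolding Y_def using \<Theta>0 Q0 by (simp add: powr_mult)
      qed
      also have "sqrt 3 * G * (\<Theta> powr (1 / (4 * real r)) * (?HQ))
          = (sqrt 3 * \<Theta> powr (1 / (4 * real r))) * (G * (?HQ))"
        by (simp only: mult_ac)
      also have "\<dots> \<le> real p powr \<epsilon> * (G * (?HQ))"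
      proof (intro mult_right_mono)
        \<comment> \<open>The root of order 4 r >= 8 leaves at most p^(3 \<epsilon> / 16); the
          factor sqrt 3 is absorbed by another p^(\<epsilon> / 2), which is at least 2.\<close>
        have "\<Theta> powr (1 / (4 * real r)) \<le> (real p powr (3 * \<epsilon> / 2)) powr (1 / (4 * real r))"
          using \<Theta> \<Theta>0 by (intro powr_mono2) auto
        also have "\<dots> = real p powr (3 * \<epsilon> / 2 * (1 / (4 * real r)))" by (rule powr_powr)
        also have "\<dots> \<le> real p powr (\<epsilon> / 2)"
        proof (rule powr_mono)
          have "3 * \<epsilon> / 2 * (1 / (4 * real r)) \<le> 3 * \<epsilon> / 2 * (1 / (4 * 2))"
            using assms by (intro mult_left_mono divide_left_mono) auto
          thus "3 * \<epsilon> / 2 * (1 / (4 * real r)) \<le> \<epsilon> / 2" using assms(2) by simp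
        qed (use p1 in simp)
        finally have "sqrt 3 * \<Theta> powr (1 / (4 * real r)) \<le> real p powr (\<epsilon> / 2) * real p powr (\<epsilon> / 2)"
          using p0 real_sqrt_le_mono[of 3 4] by (intro mult_mono) auto
        thus "sqrt 3 * \<Theta> powr (1 / (4 * real r)) \<le> real p powr \<epsilon>" by (simp flip: powr_add)
      qed (use G0 in auto)
      finally have sqrtS: "sqrt S \<le> real p powr \<epsilon> * (G * (?HQ))" .
      \<comment> \<open>The diagonal is the source of the summand M^(-1/2) of
        \<open>Delta2\<close>.\<close>
      have "sqrt (K * M * N) = G * M powr (- 1 / 2)"
      proof -
        have "M * M powr (- 1 / 2) = M powr (1 / 2)"
          using K powr_add[of M 1 "- 1 / 2"] by simp
        thus ?thesis using K by (simp add: G_def powr_half_sqrt real_sqrt_mult mult_ac)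
      qed
      also have "\<dots> \<le> real p powr \<epsilon> * (G * M powr (- 1 / 2))"
      proof -
        have "1 \<le> real p powr \<epsilon>" using p1 assms(2) by (intro ge_one_powr_ge_zero) auto
        hence "1 * (G * M powr (- 1 / 2)) \<le> real p powr \<epsilon> * (G * M powr (- 1 / 2))"
          using G0 by (intro mult_right_mono) auto
        thus ?thesis by simp
      qed
      finally have sqrtD: "sqrt (K * M * N) \<le> real p powr \<epsilon> * (G * M powr (- 1 / 2))" .
      have "sqrt (K * M * N + S) \<le> sqrt (K * M * N) + sqrt S"
        using K S0 by (intro sqrt_add_le_add_sqrt) auto
      also have "\<dots> \<le> real p powr \<epsilon> * (G * M powr (- 1 / 2)) + real p powr \<epsilon> * (G * (?HQ))"
        by (intro add_mono sqrtD sqrtS)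
      also have "\<dots> = G * (?HQ + M powr (- 1 / 2)) * real p powr \<epsilon>"
        by (simp add: algebra_simps)
      also have "\<dots> \<le> G * \<Delta> * real p powr \<epsilon>"
        unfolding \<Delta>_def H_def Q_def using G0 K p1 by (intro mult_right_mono mult_left_mono Delta2_ge) auto
      finally show ?thesis .
    qed
    have "(norm ?S)\<^sup>2 \<le> B\<^sup>2 * (A\<^sup>2 * (K * M * N + S))"
      unfolding A_def B_def S_def using p1 K by (intro trilinear_sum_square_le[OF chi]) auto
    also have "\<dots> = (A * B * sqrt (K * M * N + S))\<^sup>2"
      using K S0 by (simp add: power_mult_distrib mult_ac)
    finally have "norm ?S \<le> A * B * sqrt (K * M * N + S)"
      by (rule power2_le_imp_le) (use \<open>A \<ge> 0\<close> \<open>B \<ge> 0\<close> K S0 in auto)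
    also have "\<dots> \<le> A * B * (G * \<Delta> * real p powr \<epsilon>)"
      using \<open>A \<ge> 0\<close> \<open>B \<ge> 0\<close> by (intro mult_left_mono key) auto
    finally show "norm ?S \<le> sup_norm M \<alpha> * l2_norm K N \<beta> * M * (N * K) powr (1 / 2) *
            Delta2 p r a b K M N * real p powr \<epsilon>"
      unfolding A_def B_def G_def \<Delta>_def by (simp only: mult.assoc)
  qed
qed

end
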